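(* Let $p$ be an odd prime, and let $n>0$ and $r$ be integers with $p-1\nmid n$ and $p\nmid r$. Then for every $b\in\{1,\ldots,\mathrm{ord}_p(pn)\}$, $$\frac{(-r)^nF_p(pn,r)+(-1)^{(b-1)n}\prod_{1\le k\le b'n_*,\ p\nmid k}k}{n_*!}\equiv n_*(pB_{\varphi(p^b)}-p+1)-p^bn_*H_{n_*}+n(r^{p-1}-1)-pn\sum_{1<k<p-n_*}\binom{n_*+k}{n_*}\frac{B_k}{kr^k}\pmod{p^{b+1}},$$ where $b'=(p^b-1)/(p-1)$.
   Context: $C_p(n,r)=\sum_{k\equiv r\,(\mathrm{mod}\ p)}\binom nk(-1)^k$ and $F_p(n,r)=(-p)^{-\lfloor (n-1)/(p-1)\rfloor}C_p(n,r)+[\![n=0]\!]$ for $n\in\mathbb{N}$, $r\in\mathbb{Z}$. $n_*$ is the smallest positive residue of $n$ modulo $p-1$. $H_r=\sum_{0<k\le r}1/k$. $B_k$ are Bernoulli numbers ($x/(e^x-1)=\sum_kB_kx^k/k!$), $\varphi$ is Euler's totient function, and $\mathrm{ord}_p$ is the $p$-adic order. Congruences between rationals modulo $p^{b+1}$ mean the difference divided by $p^{b+1}$ is a $p$-adic integer. *)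

theory Defs
  imports
    "HOL-Number_Theory.Number_Theory"
    "HOL-Computational_Algebra.Formal_Power_Series"
begin

definition Cp :: "nat \<Rightarrow> nat \<Rightarrow> int \<Rightarrow> int" where
  "Cp p n r = (\<Sum>k | k \<le> n \<and> [int k = r] (mod int p). int (n choose k) * (-1) ^ k)"

text \<open>The exponent of \<open>-p\<close> is an integer that is negative for large \<open>n\<close>, so the power is
  taken in the rationals; \<open>of_nat n - 1\<close> is rational subtraction and equals \<open>-1\<close> for \<open>n = 0\<close>.\<close>

definition Fp :: "nat \<Rightarrow> nat \<Rightarrow> int \<Rightarrow> rat" where
  "Fp p n r =
     (- of_nat p) powi (- \<lfloor>(of_nat n - 1) / (of_nat p - 1) :: rat\<rfloor>) * of_int (Cp p n r)
       + of_bool (n = 0)"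

definition pos_residue :: "nat \<Rightarrow> nat \<Rightarrow> nat" where
  "pos_residue p n = (LEAST m. 0 < m \<and> [m = n] (mod (p - 1)))"

text \<open>The library's \<open>harm\<close> lives in real normed fields and is not available over \<open>rat\<close>.\<close>

definition harmonic :: "nat \<Rightarrow> rat" where
  "harmonic m = (\<Sum>k\<in>{0<..m}. 1 / of_nat k)"

text \<open>The quotient \<open>x / (e\<^sup>x - 1)\<close> is a formal power series: numerator and denominator both
  have subdegree 1, and division of power series over a field cancels the common factor.\<close>

definition bernoulli :: "nat \<Rightarrow> rat" where
  "bernoulli k = fact k * fps_nth (fps_X / (fps_exp 1 - 1)) k"

text \<open>A rational number is a \<open>p\<close>-adic integer iff \<open>p\<close> does not divide its reduced denominator.\<close>

definition padic_int :: "nat \<Rightarrow> rat \<Rightarrow> bool" where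
  "padic_int p x \<longleftrightarrow> \<not> int p dvd snd (quotient_of x)"

definition rat_cong :: "nat \<Rightarrow> nat \<Rightarrow> rat \<Rightarrow> rat \<Rightarrow> bool" where
  "rat_cong p e x y \<longleftrightarrow> padic_int p ((x - y) / of_nat p ^ e)"

end

theory Submission
  imports Defs
begin

text \<open>
  Let \<open>E a = exp (a (x + x^p / p))\<close> over the rationals. Substituting for \<open>x\<close> a root \<open>\<pi>\<close> of
  \<open>\<pi>^(p - 1) = - p\<close> makes \<open>E 1\<close> a primitive \<open>p\<close>-th root of unity (Dwork), so the \<open>p\<close>-adically
  convergent sums \<open>\<Sum>l. (-p)^l * E a $ ((p - 1) l)\<close>, which are traces of \<open>E a\<close> at \<open>\<pi>\<close>, depend
  only on whether \<open>p\<close> divides \<open>a\<close>. Taking \<open>N\<close>-th differences in \<open>a\<close> turns the Fleck quotient \<open>F\<^sub>p(N, r)\<close> into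
  the trace of \<open>E (- r) * W^N\<close> with \<open>W = (E 1 - 1) / x\<close>. For \<open>N = p n\<close> one has
  \<open>W^N \<equiv> 1 + N log W\<close>, and \<open>log W\<close> carries the Bernoulli numbers. The remaining trace of \<open>E (- r)\<close> is
  a Gauss sum; it is evaluated as in Dwork's proof of the Gross--Koblitz formula, by comparing
  the trace of Frobenius with its action on a one-dimensional cohomology. Everything is
  homogeneous in \<open>\<pi>\<close>, so only rational numbers are needed. The value found is the inverse of a
  product of units up to roughly \<open>p b' (p - 1 - n\<^sub>*)\<close>, which the reflection \<open>k \<mapsto> p^(b + 1) - k\<close> and the
  congruence \<open>p B\<^bsub>\<phi>(p^b)\<^esub> - p \<equiv> \<Prod>k\<close> (over units \<open>k < p^b\<close>) bring into the required form.
\<close>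


section \<open>The \<open>p\<close>-adic order of rationals\<close>

text \<open>Divided by p - 1, the trace is 1 at the root 1 and -1/(p - 1) at a nontrivial p-th root
  of unity. So \<open>1 - p\<close> times the trace of \<open>E a\<close> is 1, lowered by p if p
  divides a; an N-th difference kills the 1 and leaves -p C_p(N, r). The obstacle is precision:
  p^(b+1) is needed, and n supplies only p^(b-1). In W^(p n) the exponent supplies p^b, so log W
  matters only modulo p. But the p-th power of the linear part x/2 of W - 1 has too little weight to
  be dropped; at x^(p-1) = -p it cancels the linear term of log W by Fermat, which is why the
  Bernoulli sum starts at 2. For the Gauss sum, with s' = p - 1 - n_*, the cohomological error
  vanishes at the p-adic number K = s'/(1 - p). The integer K = (1 + p + ... + p^(b-1)) s' takes its
  place: the error is then divisible by p^b, the homotopy adds one more p, and the functional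
  becomes a finite sum with a closed form. This is the origin of b'. No completion is formed: a
  limit is a congruence valid for all large truncations \<open>L\<close>.\<close>

definition ord_ge :: "nat \<Rightarrow> int \<Rightarrow> rat \<Rightarrow> bool" where
  "ord_ge p m x \<longleftrightarrow> padic_int p (x / of_nat p powi m)"

lemma rat_cong_iff_ord_ge: "rat_cong p e x y \<longleftrightarrow> ord_ge p (int e) (x - y)"
  by (simp add: rat_cong_def ord_ge_def)

text \<open>The reduced fraction may be replaced by any fraction whose denominator is prime to
  \<open>p\<close>, so closure properties need no reduction to lowest terms.\<close>

lemma padic_int_iff:
  assumes "prime p"
  shows "padic_int p x \<longleftrightarrow> (\<exists>a b. \<not> int p dvd b \<and> x = of_int a / of_int b)"
proof
  assume "padic_int p x"
  moreover have "x = of_int (fst (quotient_of x)) / of_int (snd (quotient_of x))"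
    by (simp add: quotient_of_div)
  ultimately show "\<exists>a b. \<not> int p dvd b \<and> x = of_int a / of_int b"
    unfolding padic_int_def by blast
next
  assume "\<exists>a b. \<not> int p dvd b \<and> x = of_int a / of_int b"
  then obtain a b where ab: "\<not> int p dvd b" "x = of_int a / of_int b" by blast
  obtain c d where cd: "quotient_of x = (c, d)" by force
  have d0: "d > 0" using cd quotient_of_denom_pos by blast
  have b0: "b \<noteq> 0" using ab by auto
  have "(of_int a / of_int b :: rat) = of_int c / of_int d" using quotient_of_div[OF cd] ab by simp
  hence "(of_int (a * d) :: rat) = of_int (c * b)" using d0 b0 by (simp add: field_simps)
  hence eq: "a * d = c * b" by linarith
  have "\<not> int p dvd d"
  proof
    assume "int p dvd d"
    hence "int p dvd c * b" using eq by (metis dvd_mult)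
    hence "int p dvd c" using ab assms by (auto simp: prime_dvd_mult_iff)
    hence "int p dvd 1" using \<open>int p dvd d\<close> quotient_of_coprime[OF cd] by (meson coprime_common_divisor)
    thus False using assms by (auto simp: prime_gt_Suc_0_nat dest: prime_gt_1_nat)
  qed
  thus "padic_int p x" unfolding padic_int_def cd by simp
qed

lemma euler_theorem_int:
  fixes a :: int
  assumes "m > 0" "coprime a (int m)"
  shows "[a ^ totient m = 1] (mod int m)"
proof -
  define c where "c = nat (a mod int m)"
  have c: "int c = a mod int m" using assms by (simp add: c_def)
  have "coprime (int c) (int m)" using assms unfolding c by (simp add: coprime_mod_left_iff)
  hence "[c ^ totient m = 1] (mod m)" by (intro euler_theorem) simp
  hence "[int c ^ totient m = 1] (mod int m)" by (metis cong_int_iff of_nat_1 of_nat_power)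
  moreover have "[a = int c] (mod int m)" unfolding c by (simp add: cong_def)
  ultimately show ?thesis using cong_pow cong_trans by blast
qed

locale odd_prime =
  fixes p :: nat
  assumes prime_p: "prime p" and odd_p: "odd p"
begin

lemma p_ge_3: "p \<ge> 3"
  using prime_p odd_p prime_ge_2_nat[of p] by (cases "p = 2") auto

lemma p_pos [simp]: "p > 0" and p_ne_0 [simp]: "p \<noteq> 0" "(of_nat p :: rat) \<noteq> 0"
  using p_ge_3 by auto

lemma prime_int_p: "prime (int p)"
  using prime_p by simp

lemma padic_int_of_int [simp]: "padic_int p (of_int a)"
  unfolding padic_int_iff[OF prime_p]
  by (rule exI[of _ a], rule exI[of _ 1]) (use p_ge_3 in \<open>auto\<close>)

lemma padic_int_add:
  assumes "padic_int p x" "padic_int p y" shows "padic_int p (x + y)"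
proof -
  obtain a b c d where "\<not> int p dvd b" "x = of_int a / of_int b" "\<not> int p dvd d" "y = of_int c / of_int d"
    using assms unfolding padic_int_iff[OF prime_p] by blast
  moreover from this have "b \<noteq> 0" "d \<noteq> 0" by auto
  ultimately have "x + y = of_int (a * d + c * b) / of_int (b * d)" "\<not> int p dvd b * d"
    using prime_int_p by (auto simp: field_simps prime_dvd_mult_iff)
  thus ?thesis unfolding padic_int_iff[OF prime_p] by blast
qed

lemma padic_int_mult:
  assumes "padic_int p x" "padic_int p y" shows "padic_int p (x * y)"
proof -
  obtain a b c d where "\<not> int p dvd b" "x = of_int a / of_int b" "\<not> int p dvd d" "y = of_int c / of_int d"
    using assms unfolding padic_int_iff[OF prime_p] by blast
  hence "x * y = of_int (a * c) / of_int (b * d)" "\<not> int p dvd b * d"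
    using prime_int_p by (auto simp: field_simps prime_dvd_mult_iff)
  thus ?thesis unfolding padic_int_iff[OF prime_p] by blast
qed

lemma ord_ge_0_iff: "ord_ge p 0 x \<longleftrightarrow> padic_int p x"
  by (simp add: ord_ge_def)

lemma ord_ge_0 [simp]: "ord_ge p m 0"
  using padic_int_of_int[of 0] by (simp add: ord_ge_def)

lemma ord_ge_add: "ord_ge p m x \<Longrightarrow> ord_ge p m y \<Longrightarrow> ord_ge p m (x + y)"
  unfolding ord_ge_def add_divide_distrib by (rule padic_int_add)

lemma ord_ge_mult: "ord_ge p m x \<Longrightarrow> ord_ge p m' y \<Longrightarrow> ord_ge p (m + m') (x * y)"
  unfolding ord_ge_def
  by (drule (1) padic_int_mult) (simp add: power_int_add)

lemma ord_ge_of_int [simp]: "ord_ge p 0 (of_int a)"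
  by (simp add: ord_ge_0_iff)

lemma ord_ge_of_nat [simp]: "ord_ge p 0 (of_nat a)"
  using ord_ge_of_int[of "int a"] by simp

lemma ord_ge_1 [simp]: "ord_ge p 0 1"
  using ord_ge_of_int[of 1] by simp

lemma ord_ge_neg_1 [simp]: "ord_ge p 0 (- 1)"
  using ord_ge_of_int[of "-1"] by simp

lemma ord_ge_minus: "ord_ge p m x \<Longrightarrow> ord_ge p m (- x)"
  using ord_ge_mult[OF ord_ge_neg_1] by fastforce

lemma ord_ge_diff: "ord_ge p m x \<Longrightarrow> ord_ge p m y \<Longrightarrow> ord_ge p m (x - y)"
  using ord_ge_add[OF _ ord_ge_minus, of m x y] by simp

lemma ord_ge_p_powi: "ord_ge p m (of_nat p powi m)"
  by (simp add: ord_ge_def padic_int_of_int[of 1, simplified])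

lemma ord_ge_neg_p_power: "ord_ge p (int m) ((- of_nat p) ^ m)"
proof -
  have "ord_ge p (0 + int m) ((-1) ^ m * of_nat p powi (int m))"
    by (intro ord_ge_mult ord_ge_p_powi) (use ord_ge_of_int[of "(-1)^m"] in simp)
  thus ?thesis by (simp add: power_minus[of "of_nat p"])
qed

lemma ord_ge_p_power: "ord_ge p (int m) (of_nat p ^ m)"
  using ord_ge_p_powi[of "int m"] by simp

lemma ord_ge_p: "ord_ge p 1 (of_nat p)"
  using ord_ge_p_power[of 1] by simp

lemma ord_ge_mono:
  assumes "ord_ge p m x" "m' \<le> m" shows "ord_ge p m' x"
proof -
  have "ord_ge p (m' - m + m) (of_nat p powi (m' - m) * (of_nat p powi (m - m') * x))"
  proof (intro ord_ge_mult ord_ge_p_powi)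
    have "ord_ge p (0 + m) (of_nat (p ^ nat (m - m')) * x)"
      by (intro ord_ge_mult assms ord_ge_of_nat)
    thus "ord_ge p m (of_nat p powi (m - m') * x)"
      using assms by (simp add: power_int_def)
  qed
  thus ?thesis by (simp add: power_int_diff)
qed

lemma ord_ge_mult_int: "ord_ge p 0 x \<Longrightarrow> ord_ge p m y \<Longrightarrow> ord_ge p m (x * y)"
  and ord_ge_int_mult: "ord_ge p 0 y \<Longrightarrow> ord_ge p m x \<Longrightarrow> ord_ge p m (x * y)"
  using ord_ge_mult[of 0 x m y] ord_ge_mult[of m x 0 y] by simp_all

lemma ord_ge_sum: "(\<And>i. i \<in> A \<Longrightarrow> ord_ge p m (f i)) \<Longrightarrow> ord_ge p m (\<Sum>i\<in>A. f i)"
  by (induction A rule: infinite_finite_induct) (auto intro: ord_ge_add)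

lemma ord_ge_power: "ord_ge p 0 x \<Longrightarrow> ord_ge p 0 (x ^ k)"
  by (induction k) (auto intro: ord_ge_mult_int)

lemma ord_ge_prod: "(\<And>i. i \<in> A \<Longrightarrow> ord_ge p 0 (f i)) \<Longrightarrow> ord_ge p 0 (\<Prod>i\<in>A. f i)"
  by (induction A rule: infinite_finite_induct) (auto intro: ord_ge_mult_int)

lemma ord_ge_inverse_int: "\<not> int p dvd b \<Longrightarrow> ord_ge p 0 (1 / of_int b)"
  unfolding ord_ge_0_iff padic_int_iff[OF prime_p]
  by (rule exI[of _ 1], rule exI[of _ b]) auto

lemma ord_ge_inverse_nat: "\<not> p dvd b \<Longrightarrow> ord_ge p 0 (1 / of_nat b)"
  using ord_ge_inverse_int[of "int b"] by simp

lemma ord_ge_of_int_iff: "ord_ge p (int m) (of_int a) \<longleftrightarrow> int p ^ m dvd a"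
proof
  assume "int p ^ m dvd a"
  then obtain c where "a = int p ^ m * c" by auto
  hence "of_int a / (of_nat p powi int m :: rat) = of_int c" by simp
  thus "ord_ge p (int m) (of_int a)" unfolding ord_ge_def by (metis padic_int_of_int)
next
  assume "ord_ge p (int m) (of_int a)"
  then obtain c d where cd: "\<not> int p dvd d" "of_int a / (of_nat p ^ m :: rat) = of_int c / of_int d"
    unfolding ord_ge_def padic_int_iff[OF prime_p] by auto
  have "d \<noteq> 0" using cd by auto
  hence "(of_int (a * d) :: rat) = of_int (int p ^ m * c)" using cd by (simp add: field_simps)
  hence "a * d = int p ^ m * c" by linarith
  hence "int p ^ m dvd a * d" by simp
  moreover have "coprime (int p ^ m) d"
    using cd(1) prime_int_p prime_imp_coprime[of "int p" d] by simp
  ultimately show "int p ^ m dvd a" by (simp add: coprime_dvd_mult_left_iff)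
qed

lemma ord_ge_cong_int: "[a = b] (mod int p ^ m) \<longleftrightarrow> ord_ge p (int m) (of_int a - of_int b)"
  using ord_ge_of_int_iff[of m "a - b"] by (simp add: cong_iff_dvd_diff)

lemma ord_ge_cancel_unit:
  assumes "ord_ge p m (of_int u * x)" "\<not> int p dvd u" shows "ord_ge p m x"
proof -
  have "ord_ge p m ((1 / of_int u) * (of_int u * x))"
    by (intro ord_ge_mult_int ord_ge_inverse_int assms)
  moreover have "u \<noteq> 0" using assms by auto
  ultimately show ?thesis by simp
qed

lemma ord_ge_cancel_p_power:
  assumes "ord_ge p (m + int j) (of_nat p ^ j * x)" shows "ord_ge p m x"
proof -
  have "ord_ge p (- int j + (m + int j)) (of_nat p powi (- int j) * (of_nat p ^ j * x))"
    by (intro ord_ge_mult ord_ge_p_powi assms)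
  moreover have "of_nat p powi (- int j) * (of_nat p ^ j * x) = x"
    by (simp add: power_int_minus)
  ultimately show ?thesis by simp
qed

lemma ord_ge_mult_diff:
  assumes "ord_ge p 0 x" "ord_ge p 0 y'" "ord_ge p m (x - x')" "ord_ge p m (y - y')"
  shows "ord_ge p m (x * y - x' * y')"
proof -
  have "x * y - x' * y' = x * (y - y') + (x - x') * y'" by (simp add: algebra_simps)
  thus ?thesis using ord_ge_add[OF ord_ge_mult_int[OF assms(1,4)] ord_ge_int_mult[OF assms(2,3)]] by simp
qed

section \<open>Products of units and the order of factorials\<close>

definition units_upto :: "nat \<Rightarrow> nat set" where
  "units_upto m = {k. 1 \<le> k \<and> k \<le> m \<and> \<not> p dvd k}"

text \<open>Up to the sign \<open>(-1)^(m + 1)\<close> this is Morita's p-adic Gamma function at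
  \<open>m + 1\<close>.\<close>

definition unit_fact :: "nat \<Rightarrow> nat" where
  "unit_fact m = (\<Prod>k\<in>units_upto m. k)"

lemma finite_units_upto [simp]: "finite (units_upto m)"
  by (rule finite_subset[of _ "{..m}"]) (auto simp: units_upto_def)

lemma units_upto_0 [simp]: "units_upto 0 = {}"
  by (auto simp: units_upto_def)

lemma units_upto_Suc: "units_upto (Suc m) = (if p dvd Suc m then units_upto m else insert (Suc m) (units_upto m))"
  by (auto simp: units_upto_def le_Suc_eq)

lemma not_in_units_upto [simp]: "Suc m \<notin> units_upto m"
  by (simp add: units_upto_def)

lemma not_dvd_unit_fact: "\<not> p dvd unit_fact m"
  using prime_p by (auto simp: unit_fact_def prime_dvd_prod_iff units_upto_def)

lemma fact_conv_unit_fact: "fact m = p ^ (m div p) * fact (m div p) * unit_fact m"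
proof (induction m)
  case (Suc m)
  show ?case
  proof (cases "p dvd Suc m")
    case True
    hence d: "Suc m div p = Suc (m div p)" by (simp add: div_Suc dvd_eq_mod_eq_0)
    hence "Suc m = p * Suc (m div p)" using True by (metis dvd_mult_div_cancel)
    hence "fact (Suc m) = p * Suc (m div p) * (p ^ (m div p) * fact (m div p) * unit_fact m)"
      using Suc by (metis fact_Suc of_nat_id)
    thus ?thesis unfolding d using True by (simp add: unit_fact_def units_upto_Suc algebra_simps)
  next
    case False
    hence d: "Suc m div p = m div p" by (simp add: div_Suc dvd_eq_mod_eq_0)
    have "unit_fact (Suc m) = Suc m * unit_fact m" using False by (simp add: unit_fact_def units_upto_Suc)
    thus ?thesis unfolding d using Suc by (simp add: algebra_simps)
  qed
qed (simp add: unit_fact_def)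

text \<open>Legendre's bound: removing the factors prime to \<open>p\<close> leads from
  \<open>m\<close> to \<open>m div p\<close>, and \<open>(p - 1) q + (q - 1) = p q - 1\<close>
  carries the estimate through the recursion. Truncated subtraction makes it read
  \<open>0 \<le> 0\<close> at \<open>m = 0\<close>.\<close>

lemma fact_decomp:
  "\<exists>v u. (p - 1) * v \<le> m - 1 \<and> fact m = p ^ v * u \<and> \<not> p dvd (u::nat)"
proof (induction m rule: less_induct)
  case (less m)
  show ?case
  proof (cases "m = 0")
    case True thus ?thesis using p_ge_3 by (intro exI[of _ 0] exI[of _ 1]) auto
  next
    case False
    define q where "q = m div p"
    have qm: "q < m" using False p_ge_3 by (simp add: q_def)
    obtain v u where vu: "(p - 1) * v \<le> q - 1" "fact q = p ^ v * u" "\<not> p dvd u"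
      using less.IH[OF qm] by blast
    have "(p - 1) * (q + v) \<le> p * q - 1"
    proof (cases "q = 0")
      case True
      thus ?thesis using vu p_ge_3 by simp
    next
      case False
      have "(p - 1) * (q + v) = (p - 1) * q + (p - 1) * v" by (rule distrib_left)
      also have "\<dots> \<le> (p - 1) * q + (q - 1)" using vu by simp
      also have "\<dots> = p * q - 1" using False by (cases p) (auto simp: algebra_simps)
      finally show ?thesis .
    qed
    also have "p * q - 1 \<le> m - 1" by (simp add: q_def diff_le_mono)
    finally have "(p - 1) * (q + v) \<le> m - 1" .
    moreover have "fact m = p ^ (q + v) * (u * unit_fact m)"
      using fact_conv_unit_fact[of m] vu(2) by (simp add: q_def power_add)
    moreover have "\<not> p dvd u * unit_fact m"
      using vu(3) not_dvd_unit_fact prime_p prime_dvd_mult_iff by blast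
    ultimately show ?thesis by blast
  qed
qed

text \<open>The free integer \<open>j\<close> stands for any upper bound of
  \<open>(m - 1) / (p - 1)\<close>, which spares rounding where the lemma is applied.\<close>

lemma ord_ge_inverse_fact:
  assumes "int (p - 1) * j \<ge> int (m - 1)" shows "ord_ge p (- j) (1 / fact m)"
proof -
  obtain v u where vu: "(p - 1) * v \<le> m - 1" "fact m = p ^ v * u" "\<not> p dvd (u::nat)"
    using fact_decomp by blast
  have "(fact m :: rat) = of_nat (p ^ v * u)" using vu(2) by (metis of_nat_fact)
  hence eq: "(1 / fact m :: rat) = of_nat p powi (- int v) * (1 / of_nat u)"
    by (simp add: power_int_minus field_simps)
  have "int (p - 1) * int v \<le> int (m - 1)" using vu(1) by (metis of_nat_le_iff of_nat_mult)
  hence "int (p - 1) * int v \<le> int (p - 1) * j" using assms by linarith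
  hence "int v \<le> j" using p_ge_3 by (simp add: mult_le_cancel_left)
  moreover have "ord_ge p (- int v) (1 / fact m)"
    unfolding eq by (intro ord_ge_int_mult ord_ge_p_powi ord_ge_inverse_nat vu)
  ultimately show ?thesis using ord_ge_mono by force
qed

lemma ord_ge_inverse_fact_less: "m < p \<Longrightarrow> ord_ge p 0 (1 / fact m)"
  using ord_ge_inverse_nat[of "fact m"] prime_p by (simp add: prime_dvd_fact_iff)

text \<open>With \<open>x = a / b\<close>, the number \<open>b^p * b * (x^p - x)\<close> is the
  integer \<open>a^p b - a b^p\<close>, so Fermat's congruence for \<open>a\<close> and
  \<open>b\<close> suffices.\<close>

lemma fermat_padic:
  assumes "ord_ge p 0 x" shows "ord_ge p 1 (x ^ p - x)"
proof -
  obtain a b where ab: "\<not> int p dvd b" "x = of_int a / of_int b"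
    using assms unfolding ord_ge_0_iff padic_int_iff[OF prime_p] by blast
  have fermat: "[c ^ p = c] (mod int p)" for c :: int
  proof (cases "int p dvd c")
    case True moreover from this have "int p dvd c ^ p" by (meson dvd_power dvd_trans p_pos)
    ultimately show ?thesis by (simp add: cong_iff_dvd_diff)
  next
    case False
    hence "[c ^ (p - 1) = 1] (mod int p)"
      using euler_theorem_int[of p c] prime_p prime_int_p prime_imp_coprime[of "int p" c]
      by (simp add: totient_prime coprime_commute)
    hence "[c * c ^ (p - 1) = c * 1] (mod int p)" by (intro cong_mult cong_refl)
    thus ?thesis by (simp add: power_eq_if[of c p])
  qed
  have "[a ^ p * b - a * b ^ p = a * b - a * b] (mod int p)"
    by (intro cong_diff cong_mult cong_refl fermat)
  hence "ord_ge p 1 (of_int (a ^ p * b - a * b ^ p))"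
    using ord_ge_of_int_iff[of 1 "a ^ p * b - a * b ^ p"] by (simp add: cong_iff_dvd_diff)
  moreover have b0: "b \<noteq> 0" using ab by auto
  hence "of_int (b ^ p * b) * (x ^ p - x) = of_int (a ^ p * b - a * b ^ p)"
    unfolding ab by (simp add: field_simps power_divide)
  ultimately have "ord_ge p 1 (of_int (b ^ p * b) * (x ^ p - x))" by simp
  moreover have "\<not> int p dvd b ^ p * b"
    using ab(1) prime_int_p prime_dvd_mult_iff prime_dvd_power by blast
  ultimately show ?thesis by (rule ord_ge_cancel_unit)
qed

end

section \<open>Power series with weighted \<open>p\<close>-adic growth\<close>

unbundle fps_syntax

definition expf :: "rat fps \<Rightarrow> rat fps" where
  "expf g = fps_exp 1 oo g"

lemma expf_nth_0 [simp]: "expf g $ 0 = 1"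
  by (simp add: expf_def)

lemma expf_deriv: "g $ 0 = 0 \<Longrightarrow> fps_deriv (expf g) = expf g * fps_deriv g"
  by (simp add: expf_def fps_compose_deriv)

text \<open>In characteristic 0 a first-order linear equation determines each coefficient from the
  earlier ones. This yields the functional equation \<open>expf_add\<close> without multiplying out
  compositions.\<close>

lemma fps_ode_unique:
  fixes f h q :: "rat fps"
  assumes "fps_deriv f = f * q" "fps_deriv h = h * q" "f $ 0 = h $ 0"
  shows "f = h"
proof (rule fps_ext)
  fix n show "f $ n = h $ n"
  proof (induction n rule: less_induct)
    case (less n)
    show ?case
    proof (cases n)
      case 0 thus ?thesis using assms by simp
    next
      case (Suc m)
      have "fps_deriv f $ m = fps_deriv h $ m"
        unfolding assms fps_mult_nth by (intro sum.cong) (use less Suc in auto)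
      thus ?thesis using Suc by simp
    qed
  qed
qed

lemma expf_zero [simp]: "expf 0 = 1"
  by (simp add: expf_def)

lemma expf_add:
  assumes "g $ 0 = 0" "h $ 0 = 0" shows "expf (g + h) = expf g * expf h"
proof (rule fps_ode_unique[where q = "fps_deriv (g + h)"])
  show "fps_deriv (expf (g + h)) = expf (g + h) * fps_deriv (g + h)"
    using assms by (intro expf_deriv) auto
  show "fps_deriv (expf g * expf h) = expf g * expf h * fps_deriv (g + h)"
    using assms by (simp add: expf_deriv algebra_simps)
qed auto

lemma expf_power: "g $ 0 = 0 \<Longrightarrow> expf g ^ n = expf (fps_const (of_nat n) * g)"
proof (induction n)
  case (Suc n)
  have "fps_const (of_nat (Suc n)) * g = g + fps_const (of_nat n) * g"
    by (simp add: fps_eq_iff algebra_simps)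
  thus ?case using Suc by (simp add: expf_add)
qed auto

lemma expf_linear: "expf (fps_const a * fps_X) = fps_exp a"
  using fps_exp_compose_linear[of 1 a] by (simp add: expf_def)

lemma expf_compose_X_power: "g $ 0 = 0 \<Longrightarrow> n > 0 \<Longrightarrow> expf (g oo fps_X ^ n) = expf g oo fps_X ^ n"
  unfolding expf_def by (subst fps_compose_assoc) auto

lemma expf_nth_rec:
  assumes "g $ 0 = 0" "m > 0"
  shows "of_nat m * expf g $ m = (\<Sum>i=1..m. of_nat i * g $ i * expf g $ (m - i))"
proof -
  obtain k where k: "m = Suc k" using assms by (cases m) auto
  have "of_nat m * expf g $ m = fps_deriv (expf g) $ k" by (simp add: k)
  also have "\<dots> = (fps_deriv g * expf g) $ k" using assms by (simp add: expf_deriv mult.commute)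
  also have "\<dots> = (\<Sum>i=0..k. of_nat (Suc i) * g $ Suc i * expf g $ (k - i))"
    by (simp add: fps_mult_nth)
  also have "\<dots> = (\<Sum>i=1..m. of_nat i * g $ i * expf g $ (m - i))"
    unfolding k by (rule sum.reindex_bij_witness[of _ "\<lambda>i. i - 1" Suc]) auto
  finally show ?thesis .
qed

lemma fps_compose_X_power_nth:
  fixes f :: "rat fps"
  assumes "k > 0"
  shows "(f oo fps_X ^ k) $ n = (if k dvd n then f $ (n div k) else 0)"
proof -
  have "(f oo fps_X ^ k) $ n = (\<Sum>i=0..n. if n = k * i then f $ i else 0)"
    unfolding fps_compose_nth power_mult[symmetric] by (intro sum.cong) auto
  also have "\<dots> = (\<Sum>i\<in>{i\<in>{0..n}. n = k * i}. f $ i)" by (intro sum.inter_filter[symmetric]) auto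
  also have "{i\<in>{0..n}. n = k * i} = (if k dvd n then {n div k} else {})"
    using assms by auto
  finally show ?thesis by auto
qed

context odd_prime
begin

text \<open>With \<open>\<pi>^(p - 1) = - p\<close>, membership in \<open>wt 1 c\<close> says that \<open>\<pi>^c\<close> divides all coefficients of
  \<open>f(\<pi> x)\<close>, and membership in \<open>wt 0 c\<close> that it divides those of \<open>f\<close> itself.\<close>

definition wt :: "nat \<Rightarrow> int \<Rightarrow> rat fps set" where
  "wt d c = {f. \<forall>k. \<exists>m. ord_ge p m (f $ k) \<and> int (p - 1) * m + int (d * k) \<ge> c}"

lemma wtI: "(\<And>k. \<exists>m. ord_ge p m (f $ k) \<and> int (p - 1) * m + int (d * k) \<ge> c) \<Longrightarrow> f \<in> wt d c"
  by (simp add: wt_def)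

text \<open>Orders of rationals are integers while weights count in units of
  \<open>1 / (p - 1)\<close>: a weight strictly above the one that order \<open>m - 1\<close> would
  give forces order \<open>m\<close>.\<close>

lemma wt_obtain_ord:
  assumes "f \<in> wt d c" "int (p - 1) * (m - 1) + int (d * k) < c" shows "ord_ge p m (f $ k)"
proof -
  obtain m' where m': "ord_ge p m' (f $ k)" "int (p - 1) * m' + int (d * k) \<ge> c"
    using assms unfolding wt_def by blast
  have "int (p - 1) * (m - 1) < int (p - 1) * m'" using assms m' by linarith
  hence "m - 1 < m'" using p_ge_3 by (simp add: mult_less_cancel_left)
  thus ?thesis using m' ord_ge_mono by force
qed

lemma ord_ge_sum_weight:
  assumes "finite A" "\<And>i. i \<in> A \<Longrightarrow> \<exists>m. ord_ge p m (f i) \<and> int (p - 1) * m + K \<ge> c"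
  shows "\<exists>m. ord_ge p m (\<Sum>i\<in>A. f i) \<and> int (p - 1) * m + K \<ge> c"
  using assms
proof (induction A rule: finite_induct)
  case empty
  \<comment> \<open>The empty sum is 0 and has every order; \<open>\<bar>c - K\<bar>\<close> is a
    large enough witness because \<open>p - 1 \<ge> 1\<close>.\<close>
  have "\<bar>c - K\<bar> \<le> int (p - 1) * \<bar>c - K\<bar>" using p_ge_3 mult_right_mono[of 1 "int (p - 1)" "\<bar>c - K\<bar>"] by auto
  hence "int (p - 1) * \<bar>c - K\<bar> + K \<ge> c" by linarith
  thus ?case by (intro exI[of _ "\<bar>c - K\<bar>"]) auto
next
  case (insert x A)
  obtain m where m: "ord_ge p m (\<Sum>i\<in>A. f i)" "int (p - 1) * m + K \<ge> c" using insert by blast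
  obtain m' where m': "ord_ge p m' (f x)" "int (p - 1) * m' + K \<ge> c" using insert by blast
  have "ord_ge p (min m m') (f x + (\<Sum>i\<in>A. f i))"
    by (intro ord_ge_add) (use m m' ord_ge_mono in \<open>auto simp: min_def\<close>)
  moreover have "int (p - 1) * min m m' + K \<ge> c" using m m' by (auto simp: min_def)
  ultimately show ?case using insert by auto
qed

lemma wt_zero [simp]: "0 \<in> wt d c"
  using ord_ge_sum_weight[of "{}"] by (intro wtI) auto

lemma wt_add: assumes "f \<in> wt d c" "g \<in> wt d c" shows "f + g \<in> wt d c"
proof (rule wtI)
  fix k
  have "\<exists>m. ord_ge p m (\<Sum>b\<in>UNIV. if b then f $ k else g $ k) \<and> int (p - 1) * m + int (d * k) \<ge> c"
    by (rule ord_ge_sum_weight) (use assms in \<open>auto simp: wt_def\<close>)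
  thus "\<exists>m. ord_ge p m ((f + g) $ k) \<and> int (p - 1) * m + int (d * k) \<ge> c"
    by (simp add: UNIV_bool add.commute)
qed

lemma wt_mult: assumes "f \<in> wt d c" "g \<in> wt d c'" shows "f * g \<in> wt d (c + c')"
proof (rule wtI)
  fix k
  show "\<exists>m. ord_ge p m ((f * g) $ k) \<and> int (p - 1) * m + int (d * k) \<ge> c + c'"
    unfolding fps_mult_nth
  proof (rule ord_ge_sum_weight)
    fix i assume i: "i \<in> {0..k}"
    obtain m where m: "ord_ge p m (f $ i)" "int (p - 1) * m + int (d * i) \<ge> c"
      using assms unfolding wt_def by blast
    obtain m' where m': "ord_ge p m' (g $ (k - i))" "int (p - 1) * m' + int (d * (k - i)) \<ge> c'"
      using assms unfolding wt_def by blast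
    have "int (d * i) + int (d * (k - i)) = int (d * k)" using i
      by (metis add_diff_inverse_nat atLeastAtMost_iff distrib_left not_less of_nat_add)
    hence "int (p - 1) * (m + m') + int (d * k) \<ge> c + c'"
      unfolding distrib_left using m m' by linarith
    thus "\<exists>m. ord_ge p m (f $ i * g $ (k - i)) \<and> int (p - 1) * m + int (d * k) \<ge> c + c'"
      using ord_ge_mult[OF m(1) m'(1)] by blast
  qed auto
qed

lemma wt_mono: "f \<in> wt d c \<Longrightarrow> c' \<le> c \<Longrightarrow> f \<in> wt d c'"
  unfolding wt_def by (force intro: order_trans)

lemma wt_const: "ord_ge p m x \<Longrightarrow> int (p - 1) * m \<ge> c \<Longrightarrow> fps_const x \<in> wt d c"
proof (rule wtI)
  fix k assume *: "ord_ge p m x" "int (p - 1) * m \<ge> c"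
  have "int (p - 1) * m + int (d * k) \<ge> c" using * by linarith
  thus "\<exists>m. ord_ge p m (fps_const x $ k) \<and> int (p - 1) * m + int (d * k) \<ge> c"
    using * by (intro exI[of _ m]) auto
qed

lemma wt_one [simp]: "1 \<in> wt d 0"
  using wt_const[of 0 1 0] by simp

lemma wt_scale: "ord_ge p m x \<Longrightarrow> f \<in> wt d c \<Longrightarrow> fps_const x * f \<in> wt d (int (p - 1) * m + c)"
  by (intro wt_mult wt_const) auto

lemma wt_scale_int: "ord_ge p 0 x \<Longrightarrow> f \<in> wt d c \<Longrightarrow> fps_const x * f \<in> wt d c"
  using wt_scale[of 0 x f d c] by simp

lemma wt_sum: "(\<And>i. i \<in> A \<Longrightarrow> f i \<in> wt d c) \<Longrightarrow> (\<Sum>i\<in>A. f i) \<in> wt d c"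
  by (induction A rule: infinite_finite_induct) (auto intro: wt_add)

lemma wt_power: "f \<in> wt d c \<Longrightarrow> f ^ k \<in> wt d (int k * c)"
  by (induction k) (auto simp: algebra_simps dest: wt_mult[of f d c])

lemma wt_X_power: "int (d * k) \<ge> c \<Longrightarrow> fps_X ^ k \<in> wt d c"
proof (rule wtI)
  fix i assume *: "int (d * k) \<ge> c"
  show "\<exists>m. ord_ge p m (fps_X ^ k $ i) \<and> int (p - 1) * m + int (d * i) \<ge> c"
  proof (cases "i = k")
    case True thus ?thesis using * by (intro exI[of _ 0]) auto
  next
    case False thus ?thesis using wt_zero[of d c] by (auto simp: wt_def)
  qed
qed

section \<open>Congruences for p-th powers and Dwork's integrality criterion\<close>

lemma ord_ge_binomial_p:
  assumes "0 < k" "k < p" shows "ord_ge p 1 (of_nat (p choose k))"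
  using ord_ge_of_int_iff[of 1 "int (p choose k)"] dvd_choose_prime[of k p] assms prime_p by auto

text \<open>The mixed terms carry a binomial coefficient divisible by \<open>p\<close>, which is
  worth the summand \<open>p - 1\<close> in the hypothesis on \<open>c\<close>. The two pure powers
  are subtracted because they receive no such gain.\<close>

lemma wt_binomial_p:
  assumes "f \<in> wt d \<alpha>" "g \<in> wt d \<beta>"
    and c: "\<And>k. 1 \<le> k \<Longrightarrow> k < p \<Longrightarrow> int (p - 1) + int k * \<alpha> + int (p - k) * \<beta> \<ge> c"
  shows "(f + g) ^ p - f ^ p - g ^ p \<in> wt d c"
proof -
  have "(f + g) ^ p = (\<Sum>k\<le>p. of_nat (p choose k) * f ^ k * g ^ (p - k))"
    by (rule binomial_ring)
  also have "{..p} = insert 0 (insert p {1..<p})" using p_pos by auto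
  also have "(\<Sum>k\<in>\<dots>. of_nat (p choose k) * f ^ k * g ^ (p - k))
     = f ^ p + g ^ p + (\<Sum>k=1..<p. fps_const (of_nat (p choose k)) * (f ^ k * g ^ (p - k)))"
    by (simp add: fps_of_nat mult.assoc)
  finally have "(f + g) ^ p - f ^ p - g ^ p = (\<Sum>k=1..<p. fps_const (of_nat (p choose k)) * (f ^ k * g ^ (p - k)))"
    by (simp add: algebra_simps)
  also have "\<dots> \<in> wt d c"
  proof (rule wt_sum)
    fix k assume k: "k \<in> {1..<p}"
    have "fps_const (of_nat (p choose k)) * (f ^ k * g ^ (p - k)) \<in> wt d (int (p - 1) * 1 + (int k * \<alpha> + int (p - k) * \<beta>))"
      by (intro wt_scale wt_mult wt_power assms ord_ge_binomial_p) (use k in auto)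
    thus "fps_const (of_nat (p choose k)) * (f ^ k * g ^ (p - k)) \<in> wt d c"
      by (rule wt_mono) (use k c[of k] in auto)
  qed
  finally show ?thesis .
qed

lemma wt_0_0_iff: "f \<in> wt 0 0 \<longleftrightarrow> (\<forall>k. ord_ge p 0 (f $ k))"
proof
  assume f: "f \<in> wt 0 0"
  show "\<forall>k. ord_ge p 0 (f $ k)"
    using p_ge_3 by (auto intro!: wt_obtain_ord[OF f])
qed (auto intro!: wtI exI[of _ 0])

lemma wt_0_p_nth: "f \<in> wt 0 (int (p - 1)) \<Longrightarrow> ord_ge p 1 (f $ k)"
  by (erule wt_obtain_ord) (use p_ge_3 in auto)

text \<open>The Frobenius congruence between \<open>f(x)^p\<close> and \<open>f(x^p)\<close> modulo
  \<open>p\<close>, one monomial at a time. It is stated for a cutoff because the induction in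
  \<open>dwork_integrality\<close> knows integrality only below the current degree.\<close>

lemma frobenius_cutoff:
  assumes "\<And>k. k < n \<Longrightarrow> ord_ge p 0 (f $ k)"
  shows "fps_cutoff n f ^ p - (fps_cutoff n f oo fps_X ^ p) \<in> wt 0 (int (p - 1))"
  using assms
proof (induction n)
  case 0 thus ?case by (simp add: zero_power)
next
  case (Suc n)
  define c where "c = f $ n"
  let ?g = "fps_cutoff n f" and ?h = "fps_const c * fps_X ^ n"
  have eq: "fps_cutoff (Suc n) f = ?g + ?h" by (auto simp: fps_eq_iff c_def less_Suc_eq)
  have g: "?g \<in> wt 0 0" unfolding wt_0_0_iff using Suc.prems by auto
  have c: "ord_ge p 0 c" using Suc.prems by (simp add: c_def)
  have h: "?h \<in> wt 0 0" by (intro wt_scale_int c wt_X_power) auto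
  have comp: "?h oo fps_X ^ p = fps_const c * fps_X ^ (p * n)"
    by (simp add: fps_compose_mult_distrib fps_compose_power[symmetric] power_mult)
  have "?h ^ p - (?h oo fps_X ^ p) = fps_const (c ^ p - c) * fps_X ^ (p * n)"
    unfolding comp by (simp add: power_mult_distrib power_mult[symmetric] fps_const_power
        mult.commute[of p n] left_diff_distrib flip: fps_const_sub)
  also have "\<dots> \<in> wt 0 (int (p - 1) * 1 + 0)"
    by (intro wt_scale fermat_padic c wt_X_power) auto
  finally have h': "?h ^ p - (?h oo fps_X ^ p) \<in> wt 0 (int (p - 1))" by simp
  have bin: "(?g + ?h) ^ p - ?g ^ p - ?h ^ p \<in> wt 0 (int (p - 1))"
    by (rule wt_binomial_p[OF g h]) auto
  have "((?g + ?h) ^ p - ?g ^ p - ?h ^ p) + (?g ^ p - (?g oo fps_X ^ p)) + (?h ^ p - (?h oo fps_X ^ p)) \<in> wt 0 (int (p - 1))"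
    by (intro wt_add bin h' Suc.IH Suc.prems) auto
  thus ?case unfolding eq fps_compose_add_distrib by (simp add: algebra_simps)
qed

text \<open>In degree \<open>n\<close> the unknown coefficient enters \<open>f^p\<close> only as
  \<open>p f_n\<close>, and it does not enter \<open>f(x^p)\<close> at all, since
  \<open>n div p < n\<close>. The Frobenius congruence for the lower part and the divisibility of
  \<open>h\<close> then make \<open>p f_n\<close> divisible by \<open>p\<close>.\<close>

lemma dwork_integrality:
  assumes f0: "f $ 0 = 1" and h0: "h $ 0 = 1" and h: "\<And>k. k > 0 \<Longrightarrow> ord_ge p 1 (h $ k)"
    and eq: "f ^ p = (f oo fps_X ^ p) * h"
  shows "ord_ge p 0 (f $ n)"
proof (induction n rule: less_induct)
  case (less n)
  show ?case
  proof (cases "n = 0")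
    case True thus ?thesis using f0 by simp
  next
    case False
    define g q where "g = fps_cutoff n f" and "q = fps_shift n f"
    have fgq: "f = fps_X ^ n * q + g" unfolding g_def q_def by (simp add: fps_eq_iff fps_X_power_mult_nth)
    have g0: "g $ 0 = 1" using False f0 by (simp add: g_def)
    have "f ^ p = (\<Sum>k\<le>p. of_nat (p choose k) * (fps_X ^ n * q) ^ k * g ^ (p - k))"
      unfolding fgq by (rule binomial_ring)
    hence "(f ^ p) $ n = (\<Sum>k\<le>p. (of_nat (p choose k) * (fps_X ^ n * q) ^ k * g ^ (p - k)) $ n)"
      by (simp add: fps_sum_nth)
    also have "\<dots> = (\<Sum>k\<in>{0,1}. (of_nat (p choose k) * (fps_X ^ n * q) ^ k * g ^ (p - k)) $ n)"
    proof (rule sum.mono_neutral_right)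
      show "\<forall>k\<in>{..p} - {0, 1}. (of_nat (p choose k) * (fps_X ^ n * q) ^ k * g ^ (p - k)) $ n = 0"
      proof
        fix k assume k: "k \<in> {..p} - {0, 1}"
        have "(fps_X ^ n * q) ^ k = fps_X ^ (n * k) * q ^ k"
          by (simp add: power_mult_distrib flip: power_mult)
        hence "of_nat (p choose k) * (fps_X ^ n * q) ^ k * g ^ (p - k)
           = fps_X ^ (n * k) * (of_nat (p choose k) * q ^ k * g ^ (p - k))"
          by (simp only: mult_ac)
        moreover have "n < n * k" using k False by auto
        ultimately show "(of_nat (p choose k) * (fps_X ^ n * q) ^ k * g ^ (p - k)) $ n = 0"
          by (simp only: fps_X_power_mult_nth if_True)
      qed
    qed (use p_ge_3 in auto)
    also have "\<dots> = (g ^ p) $ n + (of_nat p * (fps_X ^ n * q) * g ^ (p - 1)) $ n"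
      by simp
    also have "of_nat p * (fps_X ^ n * q) * g ^ (p - 1) = fps_X ^ n * (fps_const (of_nat p) * q * g ^ (p - 1))"
      by (simp only: fps_of_nat mult_ac)
    also have "(fps_X ^ n * (fps_const (of_nat p) * q * g ^ (p - 1))) $ n = of_nat p * f $ n"
      by (simp only: fps_X_power_mult_nth) (simp add: q_def g0 fps_nth_power_0)
    finally have e1: "of_nat p * f $ n = (f ^ p) $ n - (g ^ p) $ n" by simp
    have e2: "(f oo fps_X ^ p) $ i = (g oo fps_X ^ p) $ i" if "i \<le> n" for i
    proof -
      have "i div p \<le> n div p" using that by (rule div_le_mono)
      also have "n div p < n" using False p_ge_3 by simp
      finally show ?thesis by (simp add: fps_compose_X_power_nth g_def)
    qed
    have "(f ^ p) $ n = (\<Sum>i=0..n. (g oo fps_X ^ p) $ i * h $ (n - i))"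
      unfolding eq fps_mult_nth by (intro sum.cong) (auto simp: e2)
    also have "\<dots> = (g oo fps_X ^ p) $ n + (\<Sum>i<n. (g oo fps_X ^ p) $ i * h $ (n - i))"
      by (simp add: atLeast0AtMost sum.lessThan_Suc[symmetric] lessThan_Suc_atMost[symmetric] h0 add.commute)
    finally have e3: "of_nat p * f $ n = - ((g ^ p - (g oo fps_X ^ p)) $ n)
        + (\<Sum>i<n. (g oo fps_X ^ p) $ i * h $ (n - i))" using e1 by simp
    have "ord_ge p 1 (of_nat p * f $ n)"
      unfolding e3
    proof (intro ord_ge_add ord_ge_minus ord_ge_sum)
      show "ord_ge p 1 ((g ^ p - (g oo fps_X ^ p)) $ n)" unfolding g_def
        by (intro wt_0_p_nth frobenius_cutoff less)
      fix i assume "i \<in> {..<n}"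
      thus "ord_ge p 1 ((g oo fps_X ^ p) $ i * h $ (n - i))"
        by (intro ord_ge_mult_int h) (auto simp: fps_compose_X_power_nth g_def intro: less)
    qed
    thus ?thesis using ord_ge_cancel_p_power[of 0 1] by simp
  qed
qed

section \<open>Dwork's exponential\<close>

definition E :: "rat \<Rightarrow> rat fps" where
  "E a = expf (fps_const a * (fps_X + fps_const (1 / of_nat p) * fps_X ^ p))"

lemma E_nth_0 [simp]: "E a $ 0 = 1"
  by (simp add: E_def)

lemma E_0 [simp]: "E 0 = 1"
  by (simp add: E_def)

lemma E_add: "E (a + b) = E a * E b"
  unfolding E_def
  by (subst expf_add[symmetric]) (simp_all only: distrib_right[symmetric] fps_const_add, simp_all)

lemma E_of_nat: "E (of_nat k) = E 1 ^ k"
  by (induction k) (simp_all add: E_add)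

text \<open>Coefficient form of \<open>x E' = a (x + x^p) E\<close>, the differential equation
  behind the trace formula.\<close>

lemma E_rec:
  "of_nat j * E a $ j = a * ((if j \<ge> 1 then E a $ (j - 1) else 0) + (if j \<ge> p then E a $ (j - p) else 0))"
proof (cases "j = 0")
  case False
  let ?g = "fps_const a * (fps_X + fps_const (1 / of_nat p) * fps_X ^ p)"
  have g: "of_nat i * ?g $ i = (if i = 1 then a else 0) + (if i = p then a else 0)" for i
    using p_ge_3 by auto
  have "of_nat j * E a $ j = (\<Sum>i=1..j. of_nat i * ?g $ i * E a $ (j - i))"
    unfolding E_def by (rule expf_nth_rec) (use False in auto)
  also have "\<dots> = (\<Sum>i=1..j. (if i = 1 then a * E a $ (j - i) else 0) + (if i = p then a * E a $ (j - i) else 0))"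
    unfolding g by (intro sum.cong) auto
  also have "\<dots> = a * ((if j \<ge> 1 then E a $ (j - 1) else 0) + (if j \<ge> p then E a $ (j - p) else 0))"
    using False p_ge_3 by (simp add: sum.distrib algebra_simps)
  finally show ?thesis .
qed (use p_ge_3 in simp)

text \<open>\<open>expf (fps_const a * ah_log)\<close> is the \<open>a\<close>-th power of the Artin--Hasse exponential.\<close>

definition ah_log :: "rat fps" where
  "ah_log = Abs_fps (\<lambda>n. if \<exists>i. n = p ^ i then 1 / of_nat n else 0)"

text \<open>The part of \<open>ah_log\<close> from degree \<open>p^2\<close> on, rewritten in the
  variable \<open>x^(p^2)\<close>; hence the denominator \<open>p^2 * n\<close>.\<close>

definition ah_tail :: "rat fps" where
  "ah_tail = Abs_fps (\<lambda>n. if \<exists>i. n = p ^ i then 1 / of_nat (p ^ 2 * n) else 0)"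

lemma ah_log_nth_0 [simp]: "ah_log $ 0 = 0" and ah_tail_nth_0 [simp]: "ah_tail $ 0 = 0"
  by (auto simp: ah_log_def ah_tail_def)

lemma power_div_p_iff:
  assumes "p dvd n" "n \<noteq> 1" shows "(\<exists>i. n = p ^ i) \<longleftrightarrow> (\<exists>i. n div p = p ^ i)"
proof
  assume "\<exists>i. n = p ^ i"
  then obtain i where "n = p ^ i" by blast
  moreover from this have "i \<noteq> 0" using assms by auto
  ultimately have "n div p = p ^ (i - 1)" by (cases i) auto
  thus "\<exists>i. n div p = p ^ i" ..
next
  assume "\<exists>i. n div p = p ^ i"
  then obtain i where "n div p = p ^ i" by blast
  hence "n = p ^ Suc i" using assms by (metis dvd_mult_div_cancel power_Suc)
  thus "\<exists>i. n = p ^ i" ..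
qed

lemma p_not_dvd_1: "\<not> p dvd Suc 0"
  using p_ge_3 by simp

lemma p_power_dvd: assumes "n = p ^ i" "n \<noteq> 1" shows "p dvd n"
  using assms by (cases i) auto

lemma p2_power_dvd: assumes "n = p ^ i" "n \<noteq> 1" "n \<noteq> p" shows "p ^ 2 dvd n"
proof -
  have "i \<noteq> 0" "i \<noteq> 1" using assms by auto
  thus ?thesis using assms by (auto intro!: le_imp_power_dvd)
qed

text \<open>The functional equation \<open>p L(x) = L(x^p) + p x\<close>. Its exponential has the
  form required by Dwork's criterion, with \<open>exp (a p x)\<close> as correction factor.\<close>

lemma ah_log_dilate: "fps_const (of_nat p) * ah_log = (ah_log oo fps_X ^ p) + fps_const (of_nat p) * fps_X"
proof (rule fps_ext)
  fix n
  consider "n = 0" | "n = 1" | "n \<noteq> 0" "n \<noteq> 1" "p dvd n" | "n \<noteq> 0" "n \<noteq> 1" "\<not> p dvd n" by blast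
  thus "(fps_const (of_nat p) * ah_log) $ n = ((ah_log oo fps_X ^ p) + fps_const (of_nat p) * fps_X) $ n"
  proof cases
    case 2
    have "\<exists>i. Suc 0 = p ^ i" by (rule exI[of _ 0]) simp
    thus ?thesis using 2 p_not_dvd_1 by (simp add: fps_compose_X_power_nth ah_log_def)
  next
    case 3
    thus ?thesis using power_div_p_iff[OF 3(3,2)] by (auto simp: fps_compose_X_power_nth ah_log_def)
  next
    case 4
    thus ?thesis using p_power_dvd[of n] by (auto simp: fps_compose_X_power_nth ah_log_def)
  qed (simp_all add: fps_compose_X_power_nth)
qed

lemma ah_log_split: "ah_log = (fps_X + fps_const (1 / of_nat p) * fps_X ^ p) + (ah_tail oo fps_X ^ (p\<^sup>2))"
proof (rule fps_ext)
  fix n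
  have p2: "p\<^sup>2 > 0" by simp
  have nd: "\<not> p\<^sup>2 dvd 1" "\<not> p\<^sup>2 dvd p" using p_ge_3 by (auto simp: power2_eq_square)
  have iff: "(\<exists>i. n = p ^ i) \<longleftrightarrow> (\<exists>i. n div p\<^sup>2 = p ^ i)" if "p\<^sup>2 dvd n"
  proof
    assume "\<exists>i. n = p ^ i"
    then obtain i where i: "n = p ^ i" by blast
    hence "i \<noteq> 0" "i \<noteq> 1" using nd that by (metis power_0, metis power_one_right)
    hence "2 \<le> i" by linarith
    hence "n = p ^ (i - 2) * p ^ 2" unfolding i by (metis le_add_diff_inverse2 power_add)
    hence "n div p\<^sup>2 = p ^ (i - 2)" by simp
    thus "\<exists>i. n div p\<^sup>2 = p ^ i" ..
  next
    assume "\<exists>i. n div p\<^sup>2 = p ^ i"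
    then obtain i where "n div p\<^sup>2 = p ^ i" by blast
    hence "n = p ^ (i + 2)" using that by (metis dvd_div_mult_self power_add)
    thus "\<exists>i. n = p ^ i" ..
  qed
  consider "n = 1" | "n = p" | "n \<noteq> 1" "n \<noteq> p" "p\<^sup>2 dvd n" | "n \<noteq> 1" "n \<noteq> p" "\<not> p\<^sup>2 dvd n" by blast
  thus "ah_log $ n = ((fps_X + fps_const (1 / of_nat p) * fps_X ^ p) + (ah_tail oo fps_X ^ (p\<^sup>2))) $ n"
  proof cases
    case 1
    have "\<exists>i. 1 = p ^ i" by (rule exI[of _ 0]) simp
    thus ?thesis using 1 nd p_ge_3 by (auto simp: fps_compose_X_power_nth[OF p2] ah_log_def)
  next
    case 2
    have "\<exists>i. p = p ^ i" by (rule exI[of _ 1]) simp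
    thus ?thesis using 2 nd p_ge_3 by (auto simp: fps_compose_X_power_nth[OF p2] ah_log_def)
  next
    case 3
    have "p\<^sup>2 * (n div p\<^sup>2) = n" using 3 by simp
    hence "(of_nat (p\<^sup>2 * (n div p\<^sup>2)) :: rat) = of_nat n" by (rule arg_cong)
    thus ?thesis using 3 iff[OF 3(3)]
      by (simp add: fps_compose_X_power_nth[OF p2] ah_log_def ah_tail_def del: of_nat_mult)
  next
    case 4
    thus ?thesis using p2_power_dvd[of n] by (auto simp: fps_compose_X_power_nth[OF p2] ah_log_def)
  qed
qed

lemma ord_ge_exp_p:
  assumes "k > 0" shows "ord_ge p 1 (fps_exp (of_int a * of_nat p) $ k)"
proof -
  have "ord_ge p (- (int k - 1)) (1 / fact k)"
  proof (rule ord_ge_inverse_fact)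
    have "1 * (int k - 1) \<le> int (p - 1) * (int k - 1)"
      using assms p_ge_3 by (intro mult_right_mono) simp_all
    thus "int (k - 1) \<le> int (p - 1) * (int k - 1)" using assms by (simp add: of_nat_diff)
  qed
  hence "ord_ge p (0 + int k + (- (int k - 1))) (of_int (a ^ k) * of_nat p ^ k * (1 / fact k))"
    by (intro ord_ge_mult ord_ge_p_power ord_ge_of_int)
  thus ?thesis by (simp add: power_mult_distrib)
qed

lemma artin_hasse_integral: "ord_ge p 0 (expf (fps_const (of_int a) * ah_log) $ n)"
proof (rule dwork_integrality[where h = "fps_exp (of_int a * of_nat p)"])
  let ?g = "fps_const (of_int a) * ah_log"
  have "expf ?g ^ p = expf (fps_const (of_int a) * (fps_const (of_nat p) * ah_log))"
    by (subst expf_power) (simp_all add: mult_ac)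
  also have "fps_const (of_int a) * (fps_const (of_nat p) * ah_log)
    = (?g oo fps_X ^ p) + fps_const (of_int a * of_nat p) * fps_X"
    unfolding ah_log_dilate
    by (simp add: fps_compose_mult_distrib algebra_simps flip: fps_const_mult)
  also have "expf \<dots> = (expf ?g oo fps_X ^ p) * fps_exp (of_int a * of_nat p)"
    by (subst expf_add) (simp_all add: expf_compose_X_power expf_linear)
  finally show "expf ?g ^ p = (expf ?g oo fps_X ^ p) * fps_exp (of_int a * of_nat p)" .
  show "ord_ge p 1 (fps_exp (of_int a * of_nat p) $ k)" if "k > 0" for k
    using that by (rule ord_ge_exp_p)
qed auto

text \<open>The numbers \<open>i * g_i\<close> have no denominator beyond \<open>p^2\<close>, so
  each step of the recursion \<open>expf_nth_rec\<close> costs one \<open>p^2\<close> and one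
  division by the index; together these make \<open>p^(2 m)\<close> and \<open>m!\<close>.\<close>

lemma ah_tail_exp_bound:
  "ord_ge p 0 (fact m * of_nat p ^ (2 * m) * expf (fps_const (of_int a) * ah_tail) $ m)"
proof (induction m rule: less_induct)
  case (less m)
  show ?case
  proof (cases m)
    case 0 thus ?thesis by simp
  next
    case (Suc m')
    let ?g = "fps_const (of_int a) * ah_tail"
    let ?\<rho> = "\<lambda>m. expf ?g $ m"
    have rec: "of_nat m * ?\<rho> m = (\<Sum>i=1..m. of_nat i * ?g $ i * ?\<rho> (m - i))"
      by (rule expf_nth_rec) (use Suc in auto)
    have "fact m * of_nat p ^ (2 * m) * ?\<rho> m = fact m' * of_nat p ^ (2 * m) * (of_nat m * ?\<rho> m)"
      using Suc by (simp add: algebra_simps)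
    also have "\<dots> = (\<Sum>i=1..m. fact m' * of_nat p ^ (2 * m) * (of_nat i * ?g $ i * ?\<rho> (m - i)))"
      unfolding rec by (simp add: sum_distrib_left)
    also have "ord_ge p 0 \<dots>"
    proof (rule ord_ge_sum)
      fix i assume i: "i \<in> {1..m}"
      have "m - i \<le> m'" using i Suc by auto
      hence "fact (m - i) dvd (fact m' :: nat)" by (rule fact_dvd)
      then obtain c where c: "fact m' = (fact (m - i) * c :: nat)" by (elim dvdE)
      have c': "(fact m' :: rat) = fact (m - i) * of_nat c"
        using arg_cong[OF c, of "of_nat :: nat \<Rightarrow> rat"] by simp
      have pp: "of_nat p ^ (2 * m) = (of_nat p ^ 2 * of_nat p ^ (2 * (i - 1)) * of_nat p ^ (2 * (m - i)) :: rat)"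
      proof -
        have "2 * m = 2 + 2 * (i - 1) + 2 * (m - i)" using i by auto
        thus ?thesis by (metis power_add)
      qed
      have eps: "of_nat i * ?g $ i = of_int a * (if \<exists>k. i = p ^ k then 1 else 0) / of_nat p ^ 2"
        using i by (simp add: ah_tail_def)
      have "fact m' * of_nat p ^ (2 * m) * (of_nat i * ?g $ i * ?\<rho> (m - i))
        = of_nat c * of_nat (p ^ (2 * (i - 1))) * of_int a * (if \<exists>k. i = p ^ k then 1 else 0)
          * (fact (m - i) * of_nat p ^ (2 * (m - i)) * ?\<rho> (m - i))"
        unfolding eps c' pp by (simp add: field_simps)
      also have "ord_ge p 0 \<dots>"
        by (intro ord_ge_mult_int ord_ge_of_nat ord_ge_of_int less) (use i in auto)
      finally show "ord_ge p 0 (fact m' * of_nat p ^ (2 * m) * (of_nat i * ?g $ i * ?\<rho> (m - i)))" .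
    qed
    finally show ?thesis .
  qed
qed

text \<open>\<open>E a\<close> is the \<open>a\<close>-th power of the Artin--Hasse series times
  \<open>exp (- a * ah_tail)\<close> at \<open>x^(p^2)\<close>. The first factor is integral, so the
  loss comes from an index at most \<open>j div p^2\<close> of the second: \<open>p^2\<close> per
  step, and \<open>p^v\<close> for the factorial.\<close>

lemma E_nth_bound:
  assumes "int (j div p\<^sup>2 - 1) \<le> int (p - 1) * v"
  shows "ord_ge p (- (2 * int (j div p\<^sup>2) + v)) (E (of_int a) $ j)"
proof -
  let ?ah = "expf (fps_const (of_int a) * ah_log)"
  let ?tl = "expf (fps_const (of_int (- a)) * ah_tail)"
  have p2: "p\<^sup>2 > 0" by simp
  let ?u = "fps_X + fps_const (1 / of_nat p) * fps_X ^ p :: rat fps"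
  let ?w = "ah_tail oo fps_X ^ p\<^sup>2"
  have "fps_const (of_int a) * ?u = fps_const (of_int a) * ah_log + (fps_const (of_int (- a)) * ah_tail oo fps_X ^ p\<^sup>2)"
    by (subst ah_log_split)
      (simp add: fps_compose_mult_distrib fps_compose_uminus algebra_simps flip: fps_const_neg)
  hence "E (of_int a) = ?ah * (?tl oo fps_X ^ p\<^sup>2)"
    unfolding E_def by (simp add: expf_add expf_compose_X_power)
  hence "E (of_int a) $ j = (\<Sum>i=0..j. ?ah $ i * (?tl oo fps_X ^ p\<^sup>2) $ (j - i))"
    by (simp add: fps_mult_nth)
  also have "ord_ge p (- (2 * int (j div p\<^sup>2) + v)) \<dots>"
  proof (intro ord_ge_sum ord_ge_mult_int artin_hasse_integral)
    fix i
    define m where "m = (j - i) div p\<^sup>2"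
    have m: "m \<le> j div p\<^sup>2" unfolding m_def by (intro div_le_mono) auto
    have powi: "of_nat p powi (- int (2 * m)) = 1 / (of_nat p ^ (2 * m) :: rat)"
      by (simp only: power_int_minus power_int_of_nat inverse_eq_divide)
    have "ord_ge p (- v) (1 / fact m)"
      by (rule ord_ge_inverse_fact) (use assms m in linarith)
    hence "ord_ge p (- int (2 * m) + - v) (of_nat p powi (- int (2 * m)) * (1 / fact m))"
      by (intro ord_ge_mult ord_ge_p_powi)
    hence "ord_ge p (- int (2 * m) + - v) (of_nat p powi (- int (2 * m)) * (1 / fact m) *
        (fact m * of_nat p ^ (2 * m) * ?tl $ m))"
      by (rule ord_ge_int_mult[OF ah_tail_exp_bound])
    also have "of_nat p powi (- int (2 * m)) * (1 / fact m) * (fact m * of_nat p ^ (2 * m) * ?tl $ m) = ?tl $ m"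
      unfolding powi by simp
    finally have "ord_ge p (- (2 * int (j div p\<^sup>2) + v)) (?tl $ m)"
      by (rule ord_ge_mono) (use m in linarith)
    thus "ord_ge p (- (2 * int (j div p\<^sup>2) + v)) ((?tl oo fps_X ^ p\<^sup>2) $ (j - i))"
      unfolding fps_compose_X_power_nth[OF p2] m_def by auto
  qed
  finally show ?thesis .
qed

lemma E_nth_integral: "j < p\<^sup>2 \<Longrightarrow> ord_ge p 0 (E (of_int a) $ j)"
  using E_nth_bound[of j 0 a] by simp

lemma E_nth_less_p:
  assumes "j < p" shows "E a $ j = a ^ j / fact j"
  using assms
proof (induction j)
  case (Suc j)
  have "of_nat (Suc j) * E a $ Suc j = a * (a ^ j / fact j)"
    unfolding E_rec[of "Suc j" a] using Suc by auto
  hence "E a $ Suc j = a * (a ^ j / fact j) / of_nat (Suc j)"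
    by (simp add: nonzero_eq_divide_eq mult_ac del: of_nat_Suc)
  thus ?case by (simp add: algebra_simps)
qed auto

text \<open>Below degree \<open>p^2\<close> the coefficient is integral and \<open>x^j\<close> alone
  gives weight \<open>j\<close>. Beyond, the degree outweighs the growing denominators and leaves at
  least \<open>p\<close>, which is what \<open>W_nth_weight\<close> uses.\<close>

lemma E_nth_weight:
  assumes "c \<le> int j" "j \<ge> p\<^sup>2 \<Longrightarrow> c \<le> int p"
  shows "\<exists>m. ord_ge p m (E (of_int a) $ j) \<and> int (p - 1) * m + int j \<ge> c"
proof (cases "j < p\<^sup>2")
  case True
  thus ?thesis using assms E_nth_integral[OF True, of a] by (intro exI[of _ 0]) auto
next
  case False
  define m where "m = j div p\<^sup>2"
  define P where "P = int (p - 1)"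
  have P: "P \<ge> 2" "int p = P + 1" using p_ge_3 by (auto simp: P_def)
  \<comment> \<open>\<open>v\<close> is \<open>m / P\<close> rounded up, an admissible exponent for
    the order of \<open>m!\<close> in \<open>E_nth_bound\<close>.\<close>
  define v where "v = (int m + P - 1) div P"
  have "P * v = (int m + P - 1) - (int m + P - 1) mod P"
    unfolding v_def by (simp only: minus_mod_eq_mult_div)
  moreover have "0 \<le> (int m + P - 1) mod P" "(int m + P - 1) mod P < P" using P by auto
  ultimately have v1: "P * v \<le> int m + P - 1" and v2: "int m \<le> P * v" by linarith+
  have m1: "m \<ge> 1" using False unfolding m_def by (simp add: div_greater_zero_iff Suc_le_eq)
  have "p\<^sup>2 * m \<le> j" by (simp add: m_def)
  hence "(P + 1)\<^sup>2 * int m \<le> int j" using P(2) by (metis of_nat_le_iff of_nat_mult of_nat_power)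
  hence "P\<^sup>2 * int m + 2 * P * int m + int m \<le> int j" by (simp add: power2_eq_square algebra_simps)
  moreover have "P\<^sup>2 * 1 \<le> P\<^sup>2 * int m" using m1 by (intro mult_left_mono) auto
  moreover have "2 * P \<le> P\<^sup>2" using P by (simp add: power2_eq_square mult_right_mono)
  ultimately have "P * (- (2 * int m + v)) + int j \<ge> P + 1" using v1 by (simp add: algebra_simps)
  moreover have "c \<le> P + 1" using assms False P by simp
  ultimately have "P * (- (2 * int m + v)) + int j \<ge> c" by linarith
  moreover have "ord_ge p (- (2 * int m + v)) (E (of_int a) $ j)"
    unfolding m_def by (rule E_nth_bound, rule order_trans[OF _ v2[unfolded P_def m_def]]) simp
  ultimately show ?thesis unfolding P_def by blast
qed

end

section \<open>The Dwork trace formula\<close>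

text \<open>The contracting homotopy of the twisted derivation \<open>x d/dx + a \<pi> x - K\<close> modulo its cokernel,
  followed by the linear map with values \<open>\<tau>\<close>; the powers of \<open>\<pi>\<close> are scaled away.\<close>

primrec trace_homotopy :: "rat \<Rightarrow> rat \<Rightarrow> (nat \<Rightarrow> rat) \<Rightarrow> nat \<Rightarrow> rat" where
  "trace_homotopy a K \<tau> 0 = 0"
| "trace_homotopy a K \<tau> (Suc k) = (\<tau> k + (K - of_nat k) * trace_homotopy a K \<tau> k) / a"

context odd_prime
begin

text \<open>Extension by zero to negative indices, so that the recurrence below holds at every
  integer without boundary cases.\<close>

definition coeffE :: "rat \<Rightarrow> int \<Rightarrow> rat" where
  "coeffE a j = (if j < 0 then 0 else E a $ nat j)"

lemma coeffE_rec: "of_int j * coeffE a j = a * (coeffE a (j - 1) + coeffE a (j - int p))"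
proof (cases "j < 0")
  case False
  define i where "i = nat j"
  have j: "j = int i" using False by (simp add: i_def)
  have "coeffE a (int i - 1) = (if i \<ge> 1 then E a $ (i - 1) else 0)"
    by (simp add: coeffE_def nat_diff_distrib')
  moreover have "coeffE a (int i - int p) = (if i \<ge> p then E a $ (i - p) else 0)"
    by (simp add: coeffE_def nat_diff_distrib')
  ultimately show ?thesis using E_rec[of i a] unfolding j by (simp add: coeffE_def)
qed (use p_ge_3 in \<open>simp add: coeffE_def\<close>)

context
  fixes a K :: rat and s :: nat
  assumes a: "a \<noteq> 0" and s: "s < p"
begin

abbreviation "\<tau> l k \<equiv> coeffE a (int s + int p * l - int k)"
abbreviation "\<beta> l \<equiv> trace_homotopy a K (\<tau> l)"
text \<open>After rescaling, the derivation sends \<open>x^i\<close> to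
  \<open>(i - K) x^i + a x^(i + 1)\<close>, so in the cokernel \<open>x^(i + 1)\<close> is
  \<open>(K - i) / a\<close> times \<open>x^i\<close>; \<open>\<phi> k\<close> is the resulting
  class of \<open>x^k\<close> in terms of that of 1.\<close>

abbreviation "\<phi> k \<equiv> \<Prod>i<k. (K - of_nat i) / a"

text \<open>The coefficient of \<open>\<beta> l k\<close> is \<open>s + p l - K\<close>, split in
  two: the part \<open>p (l - K)\<close> cancels in the trace, while \<open>s + (p - 1) K\<close> is
  the obstruction that a good choice of \<open>K\<close> makes small.\<close>

lemma coeffE_homotopy:
  "\<tau> l k = \<phi> k * \<tau> l 0 + (of_nat p * (of_int l - K) + (of_nat s + (of_nat p - 1) * K)) * \<beta> l k - a * \<beta> (l - 1) k"
proof (induction k)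
  case (Suc k)
  define c where "c = of_nat p * (of_int l - K) + (of_nat s + (of_nat p - 1) * K)"
  have eq: "int s + int p * l - int k - 1 = int s + int p * l - int (Suc k)"
     "int s + int p * l - int k - int p = int s + int p * (l - 1) - int k" by (simp_all add: algebra_simps)
  have "of_int (int s + int p * l - int k) * \<tau> l k = a * (\<tau> l (Suc k) + \<tau> (l - 1) k)"
    using coeffE_rec[of "int s + int p * l - int k" a] unfolding eq .
  hence "a * \<tau> l (Suc k) = c * \<tau> l k - a * \<tau> (l - 1) k + (K - of_nat k) * \<tau> l k"
    by (simp add: c_def algebra_simps)
  also have "(K - of_nat k) * \<tau> l k = (K - of_nat k) * (\<phi> k * \<tau> l 0 + c * \<beta> l k - a * \<beta> (l - 1) k)"
    using Suc.IH by (simp add: c_def)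
  also have "c * \<tau> l k - a * \<tau> (l - 1) k + \<dots>
     = c * (\<tau> l k + (K - of_nat k) * \<beta> l k) - a * (\<tau> (l - 1) k + (K - of_nat k) * \<beta> (l - 1) k)
        + (K - of_nat k) * \<phi> k * \<tau> l 0"
    by (simp add: algebra_simps)
  also have "\<tau> l k + (K - of_nat k) * \<beta> l k = a * \<beta> l (Suc k)" using a by simp
  also have "\<tau> (l - 1) k + (K - of_nat k) * \<beta> (l - 1) k = a * \<beta> (l - 1) (Suc k)" using a by simp
  also have "(K - of_nat k) * \<phi> k = a * \<phi> (Suc k)" using a by simp
  finally have "a * \<tau> l (Suc k) = a * (\<phi> (Suc k) * \<tau> l 0 + c * \<beta> l (Suc k) - a * \<beta> (l - 1) (Suc k))"
    by (simp only: algebra_simps)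
  hence "\<tau> l (Suc k) = \<phi> (Suc k) * \<tau> l 0 + c * \<beta> l (Suc k) - a * \<beta> (l - 1) (Suc k)"
    using a by (simp only: mult_cancel_left) simp
  thus ?case unfolding c_def .
qed simp

text \<open>The left-hand side is \<open>1 - p\<close> times a truncated trace of Dwork's Frobenius operator
  \<open>x^e \<mapsto> (\<Sum>l. \<tau> l e x^l)\<close>; the operator commutes up to the factor \<open>p\<close> with a
  twisted derivation whose cokernel is one-dimensional, detected by the functional \<open>\<phi>\<close>.\<close>

lemma trace_formula:
  "(1 - of_nat p) * (\<Sum>k\<le>L. (- of_nat p) ^ k * \<tau> (int k) k)
    = (\<Sum>k\<le>L. (- of_nat p) ^ k * \<phi> k * \<tau> (int k) 0)
      + (of_nat s + (of_nat p - 1) * K) * (\<Sum>k\<le>L. (- of_nat p) ^ k * \<beta> (int k) k)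
      - of_nat p * a * (- of_nat p) ^ L * \<beta> (int L) (Suc L)"
proof (induction L)
  case 0
  show ?case using a by (simp add: algebra_simps)
next
  case (Suc L)
  let ?q = "- of_nat p :: rat" and ?N = "of_nat s + (of_nat p - 1) * K"
  let ?l = "int (Suc L)"
  have h: "\<tau> ?l (Suc L) = \<phi> (Suc L) * \<tau> ?l 0 + (of_nat p * (of_nat (Suc L) - K) + ?N) * \<beta> ?l (Suc L)
     - a * \<beta> (int L) (Suc L)"
    using coeffE_homotopy[of ?l "Suc L"] by simp
  have b: "a * \<beta> ?l (Suc (Suc L)) = \<tau> ?l (Suc L) + (K - of_nat (Suc L)) * \<beta> ?l (Suc L)"
    using a by (simp only: trace_homotopy.simps) simp
  have "(1 - of_nat p) * (?q ^ Suc L * \<tau> ?l (Suc L))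
    = ?q ^ Suc L * (\<tau> ?l (Suc L) - of_nat p * \<tau> ?l (Suc L))" by (simp only: algebra_simps)
  \<comment> \<open>Substituting \<open>b\<close> into \<open>p\<close> times \<open>\<tau>\<close>
    cancels the \<open>p (l - K)\<close> part of \<open>h\<close>; of the remaining
    \<open>\<beta>\<close> terms, the two without the obstruction factor telescope in
    \<open>L\<close>.\<close>
  also have "\<tau> ?l (Suc L) - of_nat p * \<tau> ?l (Suc L)
    = \<phi> (Suc L) * \<tau> ?l 0 + ?N * \<beta> ?l (Suc L) - of_nat p * (a * \<beta> ?l (Suc (Suc L))) - a * \<beta> (int L) (Suc L)"
    unfolding b by (subst (1) h) (simp only: algebra_simps)
  finally have step: "(1 - of_nat p) * (?q ^ Suc L * \<tau> ?l (Suc L))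
    = ?q ^ Suc L * \<phi> (Suc L) * \<tau> ?l 0 + ?N * (?q ^ Suc L * \<beta> ?l (Suc L))
      - of_nat p * a * ?q ^ Suc L * \<beta> ?l (Suc (Suc L)) + of_nat p * a * ?q ^ L * \<beta> (int L) (Suc L)"
    by (simp only: power_Suc algebra_simps mult_minus_left mult_minus_right minus_minus)
  show ?case
    unfolding sum.atMost_Suc distrib_left Suc.IH step by (simp only: algebra_simps)
qed

end

section \<open>Convergence of the trace formula\<close>

lemma coeffE_bound:
  assumes "j < int (p * (l + 1))"
  shows "ord_ge p (- int (2 * (l div p) + l div p div 2)) (coeffE (of_int a) j)"
proof (cases "j < 0")
  case False
  define i where "i = nat j"
  define m where "m = l div p"
  have "i < p * (l + 1)" using assms False by (simp add: i_def nat_less_iff)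
  hence "i div p < l + 1" by (simp add: less_mult_imp_div_less mult.commute)
  hence "i div p div p \<le> l div p" by (intro div_le_mono) simp
  hence im: "i div p\<^sup>2 \<le> m" by (simp add: m_def power2_eq_square div_mult2_eq)
  \<comment> \<open>Since \<open>p - 1 \<ge> 2\<close>, \<open>m div 2\<close> serves as the
    exponent \<open>v\<close> of \<open>E_nth_bound\<close>, uniformly in \<open>p\<close>.\<close>
  have "m - 1 \<le> 2 * (m div 2)" by simp
  also have "\<dots> \<le> (p - 1) * (m div 2)" using p_ge_3 by (intro mult_right_mono) auto
  finally have "i div p\<^sup>2 - 1 \<le> (p - 1) * (m div 2)" using im by linarith
  hence "int (i div p\<^sup>2 - 1) \<le> int (p - 1) * int (m div 2)" by (metis of_nat_le_iff of_nat_mult)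
  hence "ord_ge p (- (2 * int (i div p\<^sup>2) + int (m div 2))) (E (of_int a) $ i)" by (rule E_nth_bound)
  hence "ord_ge p (- int (2 * m + m div 2)) (E (of_int a) $ i)"
    by (rule ord_ge_mono) (use im in linarith)
  thus ?thesis using False by (simp add: coeffE_def i_def m_def)
qed (simp add: coeffE_def)

lemma trace_homotopy_bound:
  assumes "\<not> int p dvd a" "\<And>i. i < k \<Longrightarrow> ord_ge p m (f i)"
  shows "ord_ge p m (trace_homotopy (of_int a) (of_int K) f k)"
  using assms(2)
proof (induction k)
  case (Suc k)
  have "ord_ge p 0 (1 / of_int a)" by (rule ord_ge_inverse_int[OF assms(1)])
  moreover have "ord_ge p m (f k + of_int (K - int k) * trace_homotopy (of_int a) (of_int K) f k)"
    by (intro ord_ge_add ord_ge_mult_int ord_ge_of_int Suc) auto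
  ultimately show ?case using ord_ge_mult_int by fastforce
qed auto

text \<open>The denominators cost at most \<open>5/2 * (l / p)\<close>, hence at most
  \<open>5 l / 6\<close> for \<open>p \<ge> 3\<close>, against the gain \<open>l\<close> from
  \<open>(- p)^l\<close>. The first bound secures a factor \<open>p\<close> in each term with
  \<open>l \<ge> 1\<close>, the second drives the boundary term to 0.\<close>

lemma loss_bounds:
  assumes "l \<ge> 1"
  shows "int l - int (2 * (l div p) + l div p div 2) \<ge> 1"
    and "int l - int (2 * (l div p) + l div p div 2) \<ge> int (l div 6)"
proof -
  have "3 * (l div p) \<le> p * (l div p)" using p_ge_3 by (intro mult_right_mono) auto
  also have "\<dots> \<le> l" by simp
  finally have m: "3 * (l div p) \<le> l" .
  show "int l - int (2 * (l div p) + l div p div 2) \<ge> 1"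
    using m assms by (cases "l div p = 0") auto
  show "int l - int (2 * (l div p) + l div p div 2) \<ge> int (l div 6)"
    using m by linarith
qed

text \<open>Of the two error terms in \<open>trace_formula\<close>, the obstruction is a multiple of
  \<open>p^b\<close> times a sum divisible by \<open>p\<close>, and the boundary term tends to 0.
  That extra \<open>p\<close> raises the precision from \<open>b\<close> to
  \<open>b + 1\<close>.\<close>

lemma trace_formula_cong:
  fixes a K :: int and s b :: nat
  assumes a: "\<not> int p dvd a" and s: "s < p" and b: "int p ^ b dvd int s + (int p - 1) * K"
  shows "\<exists>L0. \<forall>L\<ge>L0. ord_ge p (int b + 1) ((1 - of_nat p) * (\<Sum>k\<le>L. (- of_nat p) ^ k * E (of_int a) $ (s + (p - 1) * k))
    - (\<Sum>k\<le>L. (- of_nat p) ^ k * (\<Prod>i<k. (of_int K - of_nat i) / of_int a) * E (of_int a) $ (s + p * k)))"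
proof (intro exI allI impI)
  fix L assume L: "L \<ge> 6 * (b + 1)"
  let ?a = "of_int a :: rat" and ?K = "of_int K :: rat"
  let ?\<tau> = "\<lambda>l k. coeffE ?a (int s + int p * l - int k)"
  let ?\<beta> = "\<lambda>l. trace_homotopy ?a ?K (?\<tau> l)"
  have a0: "?a \<noteq> 0" using a by auto
  have idx: "int s + int p * int k - int k = int (s + (p - 1) * k)" for k
    using p_ge_3 by (simp add: of_nat_diff left_diff_distrib)
  have t1: "?\<tau> (int k) k = E ?a $ (s + (p - 1) * k)" for k
    unfolding idx by (simp add: coeffE_def del: of_nat_add of_nat_mult)
  have t2: "?\<tau> (int k) 0 = E ?a $ (s + p * k)" for k
  proof -
    have "int s + int p * int k - int 0 = int (s + p * k)" by simp
    thus ?thesis by (simp only:) (simp add: coeffE_def del: of_nat_add of_nat_mult)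
  qed
  have bnd: "ord_ge p (- int (2 * (l div p) + l div p div 2)) (?\<beta> (int l) k)" for l k
    by (intro trace_homotopy_bound a coeffE_bound) (use s in \<open>simp add: algebra_simps\<close>)
  have N: "ord_ge p (int b) (of_nat s + (of_nat p - 1) * ?K)"
    using b ord_ge_of_int_iff[of b "int s + (int p - 1) * K"] by simp
  \<comment> \<open>The homotopy vanishes at \<open>k = 0\<close>, so the sum has no term of order
    0.\<close>
  have "ord_ge p 1 ((- of_nat p) ^ k * ?\<beta> (int k) k)" for k
  proof (cases "k = 0")
    case False
    have "ord_ge p (int k + (- int (2 * (k div p) + k div p div 2))) ((- of_nat p) ^ k * ?\<beta> (int k) k)"
      by (intro ord_ge_mult ord_ge_neg_p_power bnd)
    thus ?thesis by (rule ord_ge_mono) (use loss_bounds[of k] False in linarith)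
  qed simp
  hence 1: "ord_ge p (int b + 1) ((of_nat s + (of_nat p - 1) * ?K) * (\<Sum>k\<le>L. (- of_nat p) ^ k * ?\<beta> (int k) k))"
    by (intro ord_ge_mult N ord_ge_sum)
  have "ord_ge p (0 + (int L + (- int (2 * (L div p) + L div p div 2))))
      (of_int (int p * a) * ((- of_nat p) ^ L * ?\<beta> (int L) (Suc L)))"
    by (intro ord_ge_mult ord_ge_neg_p_power bnd ord_ge_of_int)
  hence 2: "ord_ge p (int b + 1) (of_int (int p * a) * ((- of_nat p) ^ L * ?\<beta> (int L) (Suc L)))"
  proof (rule ord_ge_mono)
    have "b + 1 \<le> L div 6" "1 \<le> L" using L by simp_all
    thus "int b + 1 \<le> 0 + (int L + (- int (2 * (L div p) + L div p div 2)))"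
      using loss_bounds(2)[of L] by linarith
  qed
  have "ord_ge p (int b + 1) ((of_nat s + (of_nat p - 1) * ?K) * (\<Sum>k\<le>L. (- of_nat p) ^ k * ?\<beta> (int k) k)
      - of_int (int p * a) * ((- of_nat p) ^ L * ?\<beta> (int L) (Suc L)))"
    by (intro ord_ge_diff 1 2)
  also have "\<dots> = (1 - of_nat p) * (\<Sum>k\<le>L. (- of_nat p) ^ k * ?\<tau> (int k) k) -
     (\<Sum>k\<le>L. (- of_nat p) ^ k * (\<Prod>i<k. (?K - of_nat i) / ?a) * ?\<tau> (int k) 0)"
    using trace_formula[OF a0 s, of L ?K] by simp
  finally show "ord_ge p (int b + 1) ((1 - of_nat p) * (\<Sum>k\<le>L. (- of_nat p) ^ k * E (of_int a) $ (s + (p - 1) * k))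
    - (\<Sum>k\<le>L. (- of_nat p) ^ k * (\<Prod>i<k. (of_int K - of_nat i) / of_int a) * E (of_int a) $ (s + p * k)))"
    unfolding t1 t2 .
qed

text \<open>For a natural number \<open>K\<close> the functional is
  \<open>K! / ((K - k)! a^k)\<close> and vanishes beyond \<open>K\<close>. Thus the sum is, up to a
  factor, the coefficient of \<open>x^(p K + s)\<close> in
  \<open>E a * exp (- a x^p / p) = exp (a x)\<close>.\<close>

lemma frobenius_functional_value:
  fixes a :: rat and K s :: nat
  assumes a: "a \<noteq> 0" and s: "s < p" and L: "L \<ge> K"
  shows "(\<Sum>k\<le>L. (- of_nat p) ^ k * (\<Prod>i<k. (of_nat K - of_nat i) / a) * E a $ (s + p * k))
     = a ^ (s + (p - 1) * K) * (- of_nat p) ^ K * fact K / fact (p * K + s)"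
proof -
  define c where "c = - a / of_nat p"
  have phi: "(\<Prod>i<k. (of_nat K - of_nat i) / a) = fact K / (fact (K - k) * a ^ k)" if "k \<le> K" for k
    using that
  proof (induction k)
    case (Suc k)
    have f: "(fact (K - k) :: rat) = of_nat (K - k) * fact (K - Suc k)"
      using Suc.prems by (metis Suc_diff_Suc Suc_le_lessD fact_Suc)
    have d: "(of_nat K - of_nat k :: rat) = of_nat (K - k)" using Suc.prems by (simp add: of_nat_diff)
    have nz: "(of_nat (K - k) :: rat) \<noteq> 0" using Suc.prems by simp
    have "(\<Prod>i<Suc k. (of_nat K - of_nat i) / a) = fact K / (fact (K - k) * a ^ k) * (of_nat (K - k) / a)"
      using Suc unfolding prod.lessThan_Suc d by simp
    also have "\<dots> = fact K / (fact (K - Suc k) * a ^ Suc k)"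
      unfolding f using nz by (simp del: of_nat_diff)
    finally show ?case .
  qed simp
  have phi0: "(\<Prod>i<k. (of_nat K - of_nat i) / a) = 0" if "k > K" for k
    using that by (auto simp: prod_zero_iff)
  have G: "(expf (fps_const c * fps_X ^ p)) $ n = (if p dvd n then c ^ (n div p) / fact (n div p) else 0)" for n
  proof -
    have "fps_const c * fps_X ^ p = (fps_const c * fps_X) oo fps_X ^ p"
      by (simp add: fps_compose_mult_distrib)
    hence "expf (fps_const c * fps_X ^ p) = fps_exp c oo fps_X ^ p"
      by (simp add: expf_compose_X_power expf_linear)
    thus ?thesis by (simp add: fps_compose_X_power_nth)
  qed
  have "fps_const a * (fps_X + fps_const (1 / of_nat p) * fps_X ^ p) + fps_const c * fps_X ^ p = fps_const a * fps_X"
    using p_ge_3 by (intro fps_ext) (simp add: c_def)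
  hence "fps_exp a = E a * expf (fps_const c * fps_X ^ p)"
    unfolding E_def expf_linear[symmetric] by (subst expf_add[symmetric]) simp_all
  hence "fps_exp a $ (p * K + s) = (expf (fps_const c * fps_X ^ p) * E a) $ (p * K + s)"
    by (simp only: mult.commute)
  hence "a ^ (p * K + s) / fact (p * K + s) = (\<Sum>i=0..p * K + s. expf (fps_const c * fps_X ^ p) $ i * E a $ (p * K + s - i))"
    unfolding fps_mult_nth fps_exp_nth of_nat_fact .
  also have "\<dots> = (\<Sum>i\<in>(\<lambda>m. p * m) ` {..K}. expf (fps_const c * fps_X ^ p) $ i * E a $ (p * K + s - i))"
  proof (rule sum.mono_neutral_right)
    show "(\<lambda>m. p * m) ` {..K} \<subseteq> {0..p * K + s}" by (auto intro!: trans_le_add1)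
    show "\<forall>i\<in>{0..p * K + s} - (\<lambda>m. p * m) ` {..K}. expf (fps_const c * fps_X ^ p) $ i * E a $ (p * K + s - i) = 0"
    proof
      fix i assume i: "i \<in> {0..p * K + s} - (\<lambda>m. p * m) ` {..K}"
      have "\<not> p dvd i"
      proof
        assume "p dvd i"
        then obtain m where m: "i = p * m" by blast
        hence "p * m < p * (K + 1)" using i s by auto
        hence "m < K + 1" by (rule mult_less_cancel1[THEN iffD1, THEN conjunct2])
        hence "m \<le> K" by simp
        thus False using i m by auto
      qed
      thus "expf (fps_const c * fps_X ^ p) $ i * E a $ (p * K + s - i) = 0" by (simp add: G)
    qed
  qed auto
  also have "\<dots> = (\<Sum>m\<le>K. c ^ m / fact m * E a $ (p * K + s - p * m))"
    by (subst sum.reindex) (auto simp: G inj_on_def)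
  also have "\<dots> = (\<Sum>k\<le>K. c ^ (K - k) / fact (K - k) * E a $ (s + p * k))"
    by (rule sum.reindex_bij_witness[of _ "\<lambda>k. K - k" "\<lambda>k. K - k"])
      (auto simp: algebra_simps diff_mult_distrib2)
  finally have key: "a ^ (p * K + s) / fact (p * K + s) = (\<Sum>k\<le>K. c ^ (K - k) / fact (K - k) * E a $ (s + p * k))" .
  have "(\<Sum>k\<le>L. (- of_nat p) ^ k * (\<Prod>i<k. (of_nat K - of_nat i) / a) * E a $ (s + p * k))
    = (\<Sum>k\<le>K. (- of_nat p) ^ k * (\<Prod>i<k. (of_nat K - of_nat i) / a) * E a $ (s + p * k))"
    by (rule sum.mono_neutral_right) (use L phi0 in auto)
  also have "\<dots> = (\<Sum>k\<le>K. (fact K * (- of_nat p / a) ^ K) * (c ^ (K - k) / fact (K - k) * E a $ (s + p * k)))"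
  proof (rule sum.cong)
    fix k assume "k \<in> {..K}"
    hence k: "k \<le> K" by simp
    have c1: "(- of_nat p / a) * c = 1" using a by (simp add: c_def)
    have "(- of_nat p / a) ^ K * c ^ (K - k) = (- of_nat p / a) ^ k * ((- of_nat p / a) * c) ^ (K - k)"
    proof -
      have "(- of_nat p / a) ^ K = (- of_nat p / a) ^ k * (- of_nat p / a) ^ (K - k)"
        using k by (metis power_add le_add_diff_inverse)
      thus ?thesis by (simp only: power_mult_distrib mult_ac)
    qed
    hence "(- of_nat p / a) ^ K * c ^ (K - k) = (- of_nat p / a) ^ k" unfolding c1 by simp
    have "(fact K * (- of_nat p / a) ^ K) * (c ^ (K - k) / fact (K - k) * E a $ (s + p * k))
      = fact K / fact (K - k) * ((- of_nat p / a) ^ K * c ^ (K - k)) * E a $ (s + p * k)"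
      by (simp only: divide_inverse mult_ac)
    also have "(- of_nat p / a) ^ K * c ^ (K - k) = (- of_nat p / a) ^ k" by fact
    finally have e: "(fact K * (- of_nat p / a) ^ K) * (c ^ (K - k) / fact (K - k) * E a $ (s + p * k))
      = fact K / fact (K - k) * (- of_nat p / a) ^ k * E a $ (s + p * k)" .
    show "(- of_nat p) ^ k * (\<Prod>i<k. (of_nat K - of_nat i) / a) * E a $ (s + p * k) =
      (fact K * (- of_nat p / a) ^ K) * (c ^ (K - k) / fact (K - k) * E a $ (s + p * k))"
      unfolding e phi[OF k] power_divide[of "- of_nat p" a k]
      by (simp only: divide_inverse inverse_mult_distrib mult_ac)
  qed simp
  also have "\<dots> = (fact K * (- of_nat p / a) ^ K) * (a ^ (p * K + s) / fact (p * K + s))"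
    unfolding key by (simp add: sum_distrib_left)
  also have "a ^ (p * K + s) = a ^ (s + (p - 1) * K) * a ^ K"
  proof -
    have "p * K = (p - 1) * K + K" using p_ge_3 by (cases p) auto
    hence "p * K + s = s + (p - 1) * K + K" by simp
    thus ?thesis by (simp only: power_add)
  qed
  finally show ?thesis using a unfolding power_divide[of "- of_nat p" a K] by simp
qed

section \<open>Fleck sums as traces\<close>

text \<open>The trace from the field of \<open>\<pi>\<close> divided by its degree:
  \<open>\<pi>^j\<close> has trace 0 unless \<open>p - 1\<close> divides \<open>j\<close>, and
  \<open>\<pi>^((p - 1) l) = (- p)^l\<close>.\<close>

definition trace_sum :: "nat \<Rightarrow> rat fps \<Rightarrow> rat" where
  "trace_sum L f = (\<Sum>l\<le>L. (- of_nat p) ^ l * f $ ((p - 1) * l))"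

lemma trace_sum_sum: "trace_sum L (\<Sum>j\<in>A. fps_const (c j) * f j) = (\<Sum>j\<in>A. c j * trace_sum L (f j))"
  unfolding trace_sum_def fps_sum_nth
  by (simp add: sum_distrib_left mult_ac) (rule sum.swap)

text \<open>For \<open>K = s = 0\<close> the functional vanishes on all positive powers and the
  obstruction \<open>s + (p - 1) K\<close> is 0, hence divisible by every \<open>p^M\<close>. The
  limit reflects that the nontrivial \<open>p\<close>-th roots of unity sum to -1.\<close>

lemma trace_sum_E_unit:
  assumes "\<not> int p dvd a"
  shows "\<exists>L0. \<forall>L\<ge>L0. ord_ge p (int M) ((1 - of_nat p) * trace_sum L (E (of_int a)) - 1)"
proof -
  have "(\<Sum>k\<le>L. (- of_nat p) ^ k * (\<Prod>i<k. (of_int 0 - of_nat i) / of_int a) * E (of_int a) $ (0 + p * k))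
    = (\<Sum>k\<in>{0}. (- of_nat p) ^ k * (\<Prod>i<k. (of_int 0 - of_nat i) / of_int a) * E (of_int a) $ (0 + p * k))" for L
    by (rule sum.mono_neutral_right) (auto simp: prod_zero_iff intro!: bexI[of _ 0])
  hence *: "(\<Sum>k\<le>L. (- of_nat p) ^ k * (\<Prod>i<k. (of_int 0 - of_nat i) / of_int a) * E (of_int a) $ (0 + p * k)) = 1" for L
    by simp
  obtain L0 where "\<forall>L\<ge>L0. ord_ge p (int M + 1) ((1 - of_nat p) * (\<Sum>k\<le>L. (- of_nat p) ^ k * E (of_int a) $ (0 + (p - 1) * k)) - 1)"
    using trace_formula_cong[OF assms p_pos, of M 0] unfolding * by auto
  hence "\<forall>L\<ge>L0. ord_ge p (int M) ((1 - of_nat p) * trace_sum L (E (of_int a)) - 1)"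
    unfolding trace_sum_def add_0 by (auto elim!: ord_ge_mono)
  thus ?thesis ..
qed

text \<open>Here \<open>E a = exp (c x^p) exp (p c x)\<close> with \<open>a = p c\<close>. The terms
  with \<open>l = q + m\<close> and fixed \<open>q > 0\<close> form an alternating sum of binomial
  coefficients of \<open>(p - 1) q\<close>, which is 0; only blocks cut off by \<open>L\<close>
  remain.\<close>

lemma trace_sum_E_multiple:
  assumes "int p dvd a"
  shows "ord_ge p (int (L div p)) (trace_sum L (E (of_int a)) - 1)"
proof -
  obtain c' where c': "a = int p * c'" using assms by blast
  define c :: rat where "c = of_int c'"
  have a: "(of_int a :: rat) = of_nat p * c" by (simp add: c' c_def)
  have c_int: "ord_ge p 0 c" by (simp add: c_def)
  define P where "P = p - 1"
  have P: "p = P + 1" "P > 0" using p_ge_3 by (simp_all add: P_def)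
  define g where "g q m = (-1) ^ q * of_nat p ^ (p * q) * c ^ (P * q) * ((-1) ^ m * of_nat (P * q choose m)) / fact (P * q)" for q m
  have fE: "E (of_int a) = (fps_exp c oo fps_X ^ p) * fps_exp (of_nat p * c)"
  proof -
    have "fps_const (of_int a) * (fps_X + fps_const (1 / of_nat p) * fps_X ^ p)
      = (fps_const c * fps_X oo fps_X ^ p) + fps_const (of_nat p * c) * fps_X"
      unfolding a using p_ge_3 by (subst fps_compose_mult_distrib) (auto intro!: fps_ext)
    thus ?thesis unfolding E_def by (simp add: expf_add expf_compose_X_power expf_linear)
  qed
  have term_eq: "(- of_nat p) ^ l * (c ^ m / fact m * ((of_nat p * c) ^ (P * l - p * m) / fact (P * l - p * m))) = g (l - m) m"
    if "p * m \<le> P * l" for l m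
  proof -
    have "p * m \<le> p * l" using that P by (metis le_add1 le_trans mult_le_mono1)
    hence ml: "m \<le> l" by simp
    define q where "q = l - m"
    have l: "l = q + m" using ml by (simp add: q_def)
    have d: "P * l - p * m = P * q - m" and mq: "m \<le> P * q" using that P unfolding l by (auto simp: algebra_simps)
    have bin: "(of_nat (P * q choose m) :: rat) = fact (P * q) / (fact m * fact (P * q - m))"
      using mq by (rule binomial_fact)
    have pw: "(of_nat p :: rat) ^ l * of_nat p ^ (P * q - m) = of_nat p ^ (p * q)"
      using mq by (simp add: l P(1) algebra_simps flip: power_add)
    have cw: "c ^ m * c ^ (P * q - m) = c ^ (P * q)" using mq by (simp flip: power_add)
    have sg: "(-1 :: rat) ^ l = (-1) ^ q * (-1) ^ m" by (simp add: l power_add)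
    have "(- of_nat p) ^ l * (c ^ m / fact m * ((of_nat p * c) ^ (P * l - p * m) / fact (P * l - p * m)))
      = (-1) ^ l * (of_nat p ^ l * of_nat p ^ (P * q - m)) * (c ^ m * c ^ (P * q - m)) / (fact m * fact (P * q - m))"
      unfolding d power_mult_distrib power_minus[of "of_nat p"] by simp
    also have "\<dots> = g q m" unfolding pw cw sg g_def bin by simp
    finally show ?thesis unfolding q_def .
  qed
  have coeff: "(- of_nat p) ^ l * E (of_int a) $ (P * l) = (\<Sum>q\<le>l. g q (l - q))" for l
  proof -
    have "E (of_int a) $ (P * l) = (\<Sum>i=0..P * l. (fps_exp c oo fps_X ^ p) $ i * fps_exp (of_nat p * c) $ (P * l - i))"
      unfolding fE fps_mult_nth ..
    also have "\<dots> = (\<Sum>i\<in>(\<lambda>m. p * m) ` {m. p * m \<le> P * l}. (fps_exp c oo fps_X ^ p) $ i * fps_exp (of_nat p * c) $ (P * l - i))"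
    proof (rule sum.mono_neutral_right)
      show "\<forall>i\<in>{0..P * l} - (\<lambda>m. p * m) ` {m. p * m \<le> P * l}. (fps_exp c oo fps_X ^ p) $ i * fps_exp (of_nat p * c) $ (P * l - i) = 0"
      proof
        fix i assume i: "i \<in> {0..P * l} - (\<lambda>m. p * m) ` {m. p * m \<le> P * l}"
        have "\<not> p dvd i"
        proof
          assume "p dvd i"
          then obtain m where "i = p * m" by blast
          thus False using i by auto
        qed
        thus "(fps_exp c oo fps_X ^ p) $ i * fps_exp (of_nat p * c) $ (P * l - i) = 0"
          by (simp add: fps_compose_X_power_nth)
      qed
    qed auto
    also have "\<dots> = (\<Sum>m\<in>{m. p * m \<le> P * l}. c ^ m / fact m * ((of_nat p * c) ^ (P * l - p * m) / fact (P * l - p * m)))"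
      by (subst sum.reindex) (auto simp: fps_compose_X_power_nth inj_on_def)
    finally have e: "E (of_int a) $ (P * l) = (\<Sum>m\<in>{m. p * m \<le> P * l}. c ^ m / fact m * ((of_nat p * c) ^ (P * l - p * m) / fact (P * l - p * m)))" .
    have "(- of_nat p) ^ l * E (of_int a) $ (P * l) = (\<Sum>m\<in>{m. p * m \<le> P * l}. g (l - m) m)"
      unfolding e sum_distrib_left by (intro sum.cong refl term_eq) simp
    also have "\<dots> = (\<Sum>m\<le>l. g (l - m) m)"
    proof (rule sum.mono_neutral_left)
      show "{m. p * m \<le> P * l} \<subseteq> {..l}"
      proof
        fix m assume "m \<in> {m. p * m \<le> P * l}"
        hence "p * m \<le> p * l" using P by (metis le_add1 le_trans mem_Collect_eq mult_le_mono1)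
        thus "m \<in> {..l}" by simp
      qed
      show "\<forall>m\<in>{..l} - {m. p * m \<le> P * l}. g (l - m) m = 0"
      proof
        fix m assume m: "m \<in> {..l} - {m. p * m \<le> P * l}"
        hence ml: "m \<le> l" "P * l < P * m + m" by (auto simp: P(1))
        moreover from ml have "P * m \<le> P * l" by simp
        moreover have "P * (l - m) = P * l - P * m" by (rule diff_mult_distrib2)
        ultimately have "P * (l - m) < m" by linarith
        thus "g (l - m) m = 0" by (simp add: g_def)
      qed
    qed auto
    also have "\<dots> = (\<Sum>q\<le>l. g q (l - q))"
      by (rule sum.reindex_bij_witness[of _ "\<lambda>q. l - q" "\<lambda>q. l - q"]) auto
    finally show ?thesis .
  qed
  have "trace_sum L (E (of_int a)) = (\<Sum>l\<le>L. \<Sum>q\<le>l. g q (l - q))"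
    unfolding trace_sum_def P_def[symmetric] coeff ..
  also have "\<dots> = (\<Sum>(q, m)\<in>{(q, m). q + m \<le> L}. g q m)" by (rule sum.triangle_reindex_eq[symmetric])
  also have "{(q, m). q + m \<le> L} = Sigma {..L} (\<lambda>q. {..L - q})" by auto
  also have "(\<Sum>(q, m)\<in>\<dots>. g q m) = (\<Sum>q\<le>L. \<Sum>m\<le>L - q. g q m)" by (rule sum.Sigma[symmetric]) auto
  also have "\<dots> = (\<Sum>m\<le>L. g 0 m) + (\<Sum>q\<in>{1..L}. \<Sum>m\<le>L - q. g q m)"
    by (simp add: sum.atLeast_Suc_atMost atMost_atLeast0)
  also have "(\<Sum>m\<le>L. g 0 m) = (\<Sum>m\<in>{0}. g 0 m)" by (rule sum.mono_neutral_right) (auto simp: g_def)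
  also have "\<dots> = 1" by (simp add: g_def)
  finally have "trace_sum L (E (of_int a)) - 1 = (\<Sum>q\<in>{1..L}. \<Sum>m\<le>L - q. g q m)" by simp
  also have "ord_ge p (int (L div p)) \<dots>"
  proof (rule ord_ge_sum)
    fix q assume q: "q \<in> {1..L}"
    show "ord_ge p (int (L div p)) (\<Sum>m\<le>L - q. g q m)"
    proof (cases "p * q \<le> L")
      case True
      \<comment> \<open>Here \<open>(p - 1) q \<le> L - q\<close>, so the block is complete.\<close>
      have "(\<Sum>m\<le>L - q. g q m) = (\<Sum>m\<le>P * q. g q m)"
      proof (rule sum.mono_neutral_right)
        show "{..P * q} \<subseteq> {..L - q}" using True P by auto
      qed (auto simp: g_def)
      also have "\<dots> = (-1) ^ q * of_nat p ^ (p * q) * c ^ (P * q) / fact (P * q) * (\<Sum>m\<le>P * q. (-1) ^ m * of_nat (P * q choose m))"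
        by (simp add: g_def sum_distrib_left)
      also have "(\<Sum>m\<le>P * q. (-1) ^ m * of_nat (P * q choose m) :: rat) = 0"
        by (rule choose_alternating_sum) (use q P in auto)
      finally show ?thesis by simp
    next
      case False
      \<comment> \<open>A truncated block has \<open>q > L div p\<close>, and each of its terms has
        order at least \<open>p q - q \<ge> q\<close>.\<close>
      show ?thesis
      proof (rule ord_ge_sum)
        fix m
        have "int (P * q - 1) \<le> int (p - 1) * int q"
          unfolding P_def of_nat_mult[symmetric] of_nat_le_iff by simp
        hence "ord_ge p (- int q) (1 / fact (P * q))" by (rule ord_ge_inverse_fact)
        hence "ord_ge p (0 + int (p * q) + - int q)
           (((-1) ^ q * c ^ (P * q) * ((-1) ^ m * of_nat (P * q choose m))) * of_nat p ^ (p * q) * (1 / fact (P * q)))"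
          by (intro ord_ge_mult ord_ge_p_power ord_ge_mult_int ord_ge_power c_int ord_ge_neg_1 ord_ge_of_nat)
        hence "ord_ge p (0 + int (p * q) + - int q) (g q m)" by (simp add: g_def mult_ac)
        moreover have "L div p < q" using False by (simp add: less_mult_imp_div_less mult.commute)
        moreover have "2 * q \<le> p * q" using p_ge_3 by (intro mult_right_mono) auto
        ultimately show "ord_ge p (int (L div p)) (g q m)" by (elim ord_ge_mono) linarith
      qed
    qed
  qed
  finally show ?thesis .
qed

lemma trace_sum_E:
  "\<exists>L0. \<forall>L\<ge>L0. ord_ge p (int M) ((1 - of_nat p) * trace_sum L (E (of_int a)) - (if int p dvd a then 1 - of_nat p else 1))"
proof (cases "int p dvd a")
  case True
  show ?thesis
  proof (intro exI allI impI)
    fix L assume "L \<ge> p * M"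
    hence "M \<le> L div p" by (metis div_le_mono nonzero_mult_div_cancel_left p_ne_0(1))
    hence "ord_ge p (int M) (trace_sum L (E (of_int a)) - 1)"
      using trace_sum_E_multiple[OF True] ord_ge_mono by (meson of_nat_mono)
    hence "ord_ge p (int M) (of_int (1 - int p) * (trace_sum L (E (of_int a)) - 1))"
      by (intro ord_ge_mult_int ord_ge_of_int)
    thus "ord_ge p (int M) ((1 - of_nat p) * trace_sum L (E (of_int a)) - (if int p dvd a then 1 - of_nat p else 1))"
      using True by (simp add: algebra_simps)
  qed
qed (use trace_sum_E_unit in simp)

section \<open>Differences in the exponent parameter\<close>

definition expansion_W :: "rat fps" where
  "expansion_W = fps_shift 1 (E 1 - 1)"

lemma E_1_conv_W: "E 1 - 1 = fps_X * expansion_W"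
  by (simp add: expansion_W_def fps_eq_iff)

text \<open>The binomial theorem for \<open>(1 - E 1)^N = (- x W)^N\<close>, using
  \<open>E (j - r) = E (- r) * E 1 ^ j\<close>.\<close>

lemma alternating_E_sum:
  "(\<Sum>j\<le>N. fps_const (of_int ((-1) ^ j * int (N choose j))) * E (of_int (int j - r)))
     = fps_const ((-1) ^ N) * (fps_X ^ N * (E (of_int (- r)) * expansion_W ^ N))"
proof -
  have "(\<Sum>j\<le>N. fps_const (of_int ((-1) ^ j * int (N choose j))) * E (of_int (int j - r)))
    = E (of_int (- r)) * (\<Sum>j\<le>N. of_nat (N choose j) * (- E 1) ^ j * 1 ^ (N - j))"
    unfolding sum_distrib_left
  proof (rule sum.cong)
    fix j
    have "E (of_int (int j - r)) = E (of_int (- r)) * E 1 ^ j"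
      by (simp add: E_of_nat[symmetric] E_add[symmetric])
    moreover have "fps_const (of_int ((-1) ^ j * int (N choose j))) = (of_nat (N choose j) * (-1) ^ j :: rat fps)"
      by (simp add: fps_of_nat flip: fps_const_mult fps_const_power fps_const_neg)
    ultimately show "fps_const (of_int ((-1) ^ j * int (N choose j))) * E (of_int (int j - r))
      = E (of_int (- r)) * (of_nat (N choose j) * (- E 1) ^ j * 1 ^ (N - j))"
      unfolding power_minus[of "E 1"] power_one mult_1_right by (simp only: mult_ac)
  qed simp
  also have "(\<Sum>j\<le>N. of_nat (N choose j) * (- E 1) ^ j * 1 ^ (N - j)) = (- E 1 + 1) ^ N"
    by (rule binomial_ring[symmetric])
  also have "- E 1 + 1 = - (fps_X * expansion_W)" using E_1_conv_W by (simp add: algebra_simps)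
  also have "(- (fps_X * expansion_W)) ^ N = (-1) ^ N * (fps_X ^ N * expansion_W ^ N)"
    by (simp only: power_minus[of "fps_X * expansion_W"] power_mult_distrib)
  also have "((-1) ^ N :: rat fps) = fps_const ((-1) ^ N)"
    by (simp flip: fps_const_power fps_const_neg)
  finally show ?thesis by (simp only: mult_ac)
qed

text \<open>The weights are 1, lowered by \<open>p\<close> where \<open>p\<close> divides
  \<open>j - r\<close>; the constant 1 is annihilated by the alternating sum since
  \<open>N > 0\<close>.\<close>

lemma Cp_conv_sum:
  assumes "N > 0"
  shows "(\<Sum>j\<le>N. of_int ((-1) ^ j * int (N choose j)) * (if int p dvd int j - r then 1 - of_nat p else 1))
     = (- of_nat p * of_int (Cp p N r) :: rat)"
proof -
  have "(\<Sum>j\<le>N. of_int ((-1) ^ j * int (N choose j)) * (if int p dvd int j - r then 1 - of_nat p else 1))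
    = (\<Sum>j\<le>N. of_int ((-1) ^ j * int (N choose j)) - (if int p dvd int j - r then of_nat p * of_int ((-1) ^ j * int (N choose j)) else 0) :: rat)"
    by (intro sum.cong) (auto simp: algebra_simps)
  also have "\<dots> = of_int (\<Sum>j\<le>N. (-1) ^ j * int (N choose j))
      - (\<Sum>j\<le>N. if int p dvd int j - r then of_nat p * of_int ((-1) ^ j * int (N choose j)) else 0)"
    by (simp only: sum_subtractf of_int_sum)
  also have "(\<Sum>j\<le>N. (-1) ^ j * int (N choose j)) = 0" using choose_alternating_sum[OF assms, where 'a = int] by simp
  also have "(\<Sum>j\<le>N. if int p dvd int j - r then of_nat p * of_int ((-1) ^ j * int (N choose j)) else 0 :: rat)
     = (\<Sum>j\<in>{j. j \<le> N \<and> [int j = r] (mod int p)}. of_nat p * of_int ((-1) ^ j * int (N choose j)))"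
    by (subst sum.inter_filter[symmetric]) (auto intro!: sum.cong simp: cong_iff_dvd_diff)
  finally show ?thesis by (simp add: Cp_def sum_distrib_left sum_negf mult_ac)
qed

text \<open>The factor \<open>x^N\<close> removes the trace terms with \<open>l \<le> q\<close> and
  shifts the rest by \<open>q + 1\<close>. The power \<open>(- p)^(q + 1)\<close> pulled out is the
  normalisation \<open>(- p)^q\<close> of the Fleck quotient times the \<open>- p\<close> of
  \<open>Cp_conv_sum\<close>. The remaining exponents start at \<open>p - 1 - s\<close>.\<close>

lemma Fp_limit:
  fixes N q s :: nat
  assumes N: "N = (p - 1) * q + s" and s: "1 \<le> s" "s \<le> p - 2"
  shows "\<exists>L0. \<forall>L\<ge>L0. ord_ge p (int M) ((1 - of_nat p) * (-1) ^ N *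
     (\<Sum>i\<le>L. (- of_nat p) ^ i * (E (of_int (- r)) * expansion_W ^ N) $ (p - 1 - s + (p - 1) * i)) - Fp p N r)"
proof -
  let ?f = "E (of_int (- r)) * expansion_W ^ N"
  let ?c = "\<lambda>j. of_int ((-1) ^ j * int (N choose j)) :: rat"
  let ?d = "\<lambda>j. if int p dvd int j - r then 1 - of_nat p else 1 :: rat"
  have N0: "N > 0" using N s by simp
  \<comment> \<open>Precision \<open>M + q + 1\<close>, because \<open>q + 1\<close> powers of
    \<open>p\<close> are cancelled at the end.\<close>
  have "\<forall>j. \<exists>L0. \<forall>L\<ge>L0. ord_ge p (int (M + q + 1)) ((1 - of_nat p) * trace_sum L (E (of_int (int j - r))) - ?d j)"
    using trace_sum_E by blast
  then obtain L0 where L0: "\<And>j L. L \<ge> L0 j \<Longrightarrow> ord_ge p (int (M + q + 1)) ((1 - of_nat p) * trace_sum L (E (of_int (int j - r))) - ?d j)"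
    by metis
  show ?thesis
  proof (intro exI allI impI)
    fix L assume L: "L \<ge> Max (L0 ` {..N})"
    define L' where "L' = L + (q + 1)"
    have L': "L' \<ge> L0 j" if "j \<le> N" for j
    proof -
      have "L0 j \<le> Max (L0 ` {..N})" using that by (intro Max_ge) auto
      thus ?thesis using L unfolding L'_def by linarith
    qed
    have "ord_ge p (int (M + q + 1)) (\<Sum>j\<le>N. ?c j * ((1 - of_nat p) * trace_sum L' (E (of_int (int j - r))) - ?d j))"
      by (intro ord_ge_sum ord_ge_mult_int L0 L' ord_ge_of_int) auto
    also have "(\<Sum>j\<le>N. ?c j * ((1 - of_nat p) * trace_sum L' (E (of_int (int j - r))) - ?d j))
      = (1 - of_nat p) * (\<Sum>j\<le>N. ?c j * trace_sum L' (E (of_int (int j - r)))) - (\<Sum>j\<le>N. ?c j * ?d j)"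
      by (simp only: right_diff_distrib sum_subtractf sum_distrib_left mult_ac)
    also have "(\<Sum>j\<le>N. ?c j * ?d j) = - of_nat p * of_int (Cp p N r)" by (rule Cp_conv_sum[OF N0])
    also have "(\<Sum>j\<le>N. ?c j * trace_sum L' (E (of_int (int j - r))))
        = trace_sum L' (fps_const ((-1) ^ N) * (fps_X ^ N * ?f))"
      unfolding alternating_E_sum[symmetric] trace_sum_sum ..
    also have "\<dots> = (-1) ^ N * (\<Sum>l\<le>L'. (- of_nat p) ^ l * (fps_X ^ N * ?f) $ ((p - 1) * l))"
      unfolding trace_sum_def fps_mult_left_const_nth sum_distrib_left by (simp only: mult_ac)
    also have "(\<Sum>l\<le>L'. (- of_nat p) ^ l * (fps_X ^ N * ?f) $ ((p - 1) * l))
      = (\<Sum>l\<in>{q + 1..L'}. (- of_nat p) ^ l * (fps_X ^ N * ?f) $ ((p - 1) * l))"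
    proof (rule sum.mono_neutral_right)
      show "\<forall>l\<in>{..L'} - {q + 1..L'}. (- of_nat p) ^ l * (fps_X ^ N * ?f) $ ((p - 1) * l) = 0"
      proof
        fix l assume "l \<in> {..L'} - {q + 1..L'}"
        hence "l \<le> q" by auto
        hence "(p - 1) * l \<le> (p - 1) * q" by simp
        hence "(p - 1) * l < N" using N s by linarith
        thus "(- of_nat p) ^ l * (fps_X ^ N * ?f) $ ((p - 1) * l) = 0" by (simp add: fps_X_power_mult_nth)
      qed
    qed auto
    also have "\<dots> = (\<Sum>i\<le>L. (- of_nat p) ^ (i + (q + 1)) * ?f $ (p - 1 - s + (p - 1) * i))"
    proof (rule sum.reindex_bij_witness[of _ "\<lambda>i. i + (q + 1)" "\<lambda>l. l - (q + 1)"])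
      fix l assume l: "l \<in> {q + 1..L'}"
      define i where "i = l - (q + 1)"
      have li: "l = i + (q + 1)" using l by (simp add: i_def)
      have "(p - 1) * l = N + (p - 1 - s + (p - 1) * i)"
      proof -
        have "(p - 1) * l = (p - 1) * i + (p - 1) * q + (p - 1)"
          unfolding li by (simp only: distrib_left mult_1_right add.assoc)
        thus ?thesis unfolding N using s by linarith
      qed
      thus "(- of_nat p) ^ (l - (q + 1) + (q + 1)) * ?f $ (p - 1 - s + (p - 1) * (l - (q + 1)))
         = (- of_nat p) ^ l * (fps_X ^ N * ?f) $ ((p - 1) * l)"
        unfolding i_def[symmetric] li[symmetric] by (simp add: fps_X_power_mult_nth)
    qed (auto simp: L'_def)
    also have "\<dots> = (- of_nat p) ^ (q + 1) * (\<Sum>i\<le>L. (- of_nat p) ^ i * ?f $ (p - 1 - s + (p - 1) * i))"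
      by (simp only: sum_distrib_left power_add mult_ac)
    also have "(1 - of_nat p) * ((-1) ^ N * ((- of_nat p) ^ (q + 1) * (\<Sum>i\<le>L. (- of_nat p) ^ i * ?f $ (p - 1 - s + (p - 1) * i))))
        - - of_nat p * of_int (Cp p N r)
      = of_nat p ^ (q + 1) * ((-1) ^ (q + 1) * ((1 - of_nat p) * (-1) ^ N * (\<Sum>i\<le>L. (- of_nat p) ^ i * ?f $ (p - 1 - s + (p - 1) * i)) - Fp p N r))"
    proof -
      have "(of_nat N - 1) / (of_nat p - 1) = (of_nat q + (of_nat s - 1) / (of_nat p - 1) :: rat)"
        using p_ge_3 N by (simp add: of_nat_diff field_simps)
      moreover have "0 \<le> (of_nat s - 1) / (of_nat p - 1 :: rat)" "(of_nat s - 1) / (of_nat p - 1 :: rat) < 1"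
        using s p_ge_3 by (auto simp: divide_simps)
      ultimately have fl: "\<lfloor>(of_nat N - 1) / (of_nat p - 1) :: rat\<rfloor> = int q" by (simp add: floor_eq_iff)
      have "Fp p N r = of_int (Cp p N r) / (- of_nat p) ^ q"
        using N0 unfolding Fp_def fl by (simp add: power_int_minus field_simps)
      hence "of_nat p ^ (q + 1) * (-1) ^ (q + 1) * Fp p N r = - of_nat p * of_int (Cp p N r)"
        by (simp add: power_minus[of "of_nat p"] field_simps)
      moreover have "(- of_nat p) ^ (q + 1) = (of_nat p ^ (q + 1) * (-1) ^ (q + 1) :: rat)"
        by (simp only: power_minus[of "of_nat p"] mult.commute)
      moreover have aux: "P * (e * ((A * B) * S)) - x = A * (B * (P * e * S - F))"
        if "A * B * F = x" for P e A B S F x :: rat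
        using that by (auto simp: algebra_simps)
      ultimately show ?thesis by (simp only:)
    qed
    finally have "ord_ge p (int M + int (q + 1)) (of_nat p ^ (q + 1) * ((-1) ^ (q + 1) * ((1 - of_nat p) * (-1) ^ N * (\<Sum>i\<le>L. (- of_nat p) ^ i * ?f $ (p - 1 - s + (p - 1) * i)) - Fp p N r)))"
      by (simp only: add.assoc of_nat_add)
    hence "ord_ge p (int M) ((-1) ^ (q + 1) * ((1 - of_nat p) * (-1) ^ N * (\<Sum>i\<le>L. (- of_nat p) ^ i * ?f $ (p - 1 - s + (p - 1) * i)) - Fp p N r))"
      by (rule ord_ge_cancel_p_power)
    hence "ord_ge p (int M) ((-1) ^ (q + 1) * ((-1) ^ (q + 1) * ((1 - of_nat p) * (-1) ^ N * (\<Sum>i\<le>L. (- of_nat p) ^ i * ?f $ (p - 1 - s + (p - 1) * i)) - Fp p N r)))"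
      by (rule ord_ge_mult_int[OF ord_ge_power[OF ord_ge_neg_1]])
    moreover have "(-1) ^ k * ((-1) ^ k * x) = x" for k and x :: rat
      by (simp flip: mult.assoc power_mult_distrib)
    ultimately show "ord_ge p (int M) ((1 - of_nat p) * (-1) ^ N * (\<Sum>i\<le>L. (- of_nat p) ^ i * ?f $ (p - 1 - s + (p - 1) * i)) - Fp p N r)"
      by metis
  qed
qed

end

section \<open>The logarithm of \<open>(E 1 - 1) / X\<close>\<close>

definition fps_expm1_div_X :: "rat fps" where
  "fps_expm1_div_X = fps_shift 1 (fps_exp 1 - 1)"

definition bernoulli_fps :: "rat fps" where
  "bernoulli_fps = fps_X / (fps_exp 1 - 1)"

lemma bernoulli_fps_nth: "bernoulli_fps $ k = bernoulli k / fact k"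
  by (simp add: bernoulli_def bernoulli_fps_def)

lemma X_mult_expm1_div_X: "fps_X * fps_expm1_div_X = fps_exp 1 - 1"
  by (simp add: fps_expm1_div_X_def fps_eq_iff)

lemma expm1_div_X_nth: "fps_expm1_div_X $ k = 1 / fact (Suc k)"
  by (simp add: fps_expm1_div_X_def algebra_simps)

lemma bernoulli_fps_mult: "bernoulli_fps * fps_expm1_div_X = 1"
proof -
  have "subdegree (fps_exp 1 - 1 :: rat fps) = 1"
    by (rule subdegreeI) auto
  hence "bernoulli_fps * (fps_exp 1 - 1) = fps_X"
    unfolding bernoulli_fps_def by (intro fps_times_divide_eq) auto
  hence "fps_X * (bernoulli_fps * fps_expm1_div_X) = fps_X * 1"
    unfolding X_mult_expm1_div_X[symmetric] by (simp add: mult_ac)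
  thus ?thesis by (simp only: mult_cancel_left) simp
qed

text \<open>This is \<open>x (log h)' = x + x / (e^x - 1) - 1\<close> for
  \<open>h = (e^x - 1) / x\<close>, multiplied by \<open>h\<close>.\<close>

lemma expm1_div_X_log_deriv:
  "fps_expm1_div_X * (fps_X + bernoulli_fps - 1) = fps_X * fps_deriv fps_expm1_div_X"
proof -
  have "fps_deriv (fps_X * fps_expm1_div_X) = fps_expm1_div_X + fps_X * fps_deriv fps_expm1_div_X"
    by (simp add: add.commute)
  moreover have "fps_deriv (fps_X * fps_expm1_div_X) = fps_exp 1"
    unfolding X_mult_expm1_div_X by simp
  ultimately have "fps_expm1_div_X + fps_X * fps_deriv fps_expm1_div_X = fps_X * fps_expm1_div_X + 1"
    using X_mult_expm1_div_X by simp
  thus ?thesis using bernoulli_fps_mult by (simp add: algebra_simps)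
qed

lemma fps_mult_left_cancel_upto:
  fixes h f g :: "rat fps"
  assumes "h $ 0 = 1" "\<And>i. i \<le> n \<Longrightarrow> (h * f) $ i = (h * g) $ i" "i \<le> n"
  shows "f $ i = g $ i"
  using assms(3)
proof (induction i rule: less_induct)
  case (less i)
  have "(h * f) $ i = f $ i + (\<Sum>k=1..i. h $ k * f $ (i - k))" for f :: "rat fps"
    using assms(1) by (simp add: fps_mult_nth sum.atLeast_Suc_atMost)
  moreover have "(\<Sum>k=1..i. h $ k * f $ (i - k)) = (\<Sum>k=1..i. h $ k * g $ (i - k))"
    by (intro sum.cong) (use less in auto)
  ultimately show ?case using assms(2)[OF less.prems] by simp
qed

section \<open>Logarithms truncated before denominators divisible by p\<close>

context odd_prime
begin

text \<open>The series of \<open>log (1 + f)\<close>, cut before the first coefficient with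
  denominator \<open>p\<close>. Up to multiples of \<open>p\<close>, its coefficients are the inner
  binomial coefficients of \<open>(1 + f)^p\<close> divided by \<open>p\<close>.\<close>

definition log_trunc :: "rat fps \<Rightarrow> rat fps" where
  "log_trunc f = (\<Sum>k=1..p-1. fps_const ((-1) ^ (k - 1) / of_nat k) * f ^ k)"

definition expm1_trunc :: "rat fps" where
  "expm1_trunc = fps_cutoff (p - 1) fps_expm1_div_X - 1"

lemma expm1_trunc_nth: "expm1_trunc $ k = (if k = 0 \<or> k \<ge> p - 1 then 0 else 1 / fact (Suc k))"
  using p_ge_3 by (auto simp: expm1_trunc_def expm1_div_X_nth)

lemma ord_ge_log_coeff: "k \<in> {1..p-1} \<Longrightarrow> ord_ge p 0 ((-1) ^ (k - 1) / of_nat k)"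
proof -
  assume k: "k \<in> {1..p-1}"
  have "0 < k" "k < p" using k p_ge_3 by auto
  hence "ord_ge p 0 ((-1) ^ (k - 1) * (1 / of_nat k))"
    by (intro ord_ge_mult_int ord_ge_power ord_ge_neg_1 ord_ge_inverse_nat nat_dvd_not_less)
  thus ?thesis by simp
qed

text \<open>A finite geometric sum gives
  \<open>(1 + f) (log_trunc f)' = f' (1 - (- f)^(p - 1))\<close>, and the error starts no earlier
  than degree \<open>p - 1\<close> because \<open>f\<close> has no constant term.\<close>

lemma fps_deriv_log_trunc:
  assumes "f $ 0 = 0" "j < p - 1"
  shows "((1 + f) * (fps_X * fps_deriv (log_trunc f))) $ j = (fps_X * fps_deriv f) $ j"
proof -
  have "fps_deriv (log_trunc f) = (\<Sum>k=1..p-1. fps_deriv f * (- f) ^ (k - 1))"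
    unfolding log_trunc_def fps_deriv_sum
  proof (rule sum.cong)
    fix k assume k: "k \<in> {1..p-1}"
    have "fps_deriv (fps_const ((-1) ^ (k - 1) / of_nat k) * f ^ k)
      = fps_const ((-1) ^ (k - 1) / of_nat k) * (fps_const (of_nat k) * fps_deriv f * f ^ (k - 1))"
      by (simp add: fps_deriv_power)
    also have "\<dots> = (fps_const ((-1) ^ (k - 1) / of_nat k) * fps_const (of_nat k)) * (fps_deriv f * f ^ (k - 1))"
      by (simp only: mult_ac)
    also have "fps_const ((-1) ^ (k - 1) / of_nat k) * fps_const (of_nat k) = ((-1) ^ (k - 1) :: rat fps)"
      using k by (simp flip: fps_const_power fps_const_neg)
    finally show "fps_deriv (fps_const ((-1) ^ (k - 1) / of_nat k) * f ^ k) = fps_deriv f * (- f) ^ (k - 1)"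
      unfolding power_minus[of f] by (simp only: mult_ac)
  qed simp
  also have "\<dots> = fps_deriv f * (\<Sum>i<p-1. (- f) ^ i)"
    unfolding sum_distrib_left
    by (rule sum.reindex_bij_witness[of _ Suc "\<lambda>k. k - 1"]) auto
  finally have "(1 + f) * (fps_X * fps_deriv (log_trunc f)) = fps_X * fps_deriv f * ((1 - (- f)) * (\<Sum>i<p-1. (- f) ^ i))"
    by (simp add: mult_ac)
  also have "(1 - (- f)) * (\<Sum>i<p-1. (- f) ^ i) = 1 - (- f) ^ (p - 1)"
    by (rule one_diff_power_eq[symmetric])
  finally have e: "(1 + f) * (fps_X * fps_deriv (log_trunc f)) = fps_X * fps_deriv f * (1 - (- f) ^ (p - 1))" .
  have "((1 + f) * (fps_X * fps_deriv (log_trunc f))) $ j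
      = (fps_X * fps_deriv f) $ j - (fps_X * fps_deriv f * (- f) ^ (p - 1)) $ j"
    unfolding e right_diff_distrib mult_1_right fps_sub_nth ..
  also have "(fps_X * fps_deriv f * (- f) ^ (p - 1)) $ j = 0"
    unfolding fps_mult_nth[of _ "(- f) ^ (p - 1)"]
    using startsby_zero_power_prefix[of "- f" "p - 1"] assms by (intro sum.neutral) auto
  finally show ?thesis by simp
qed

text \<open>The coefficients of \<open>log ((e^x - 1) / x)\<close> in positive degree. Degree 1 is
  exceptional: the term \<open>x\<close> in the logarithmic derivative turns
  \<open>B_1 = - 1/2\<close> into \<open>1/2\<close>.\<close>

definition log_coeff :: "nat \<Rightarrow> rat" where
  "log_coeff j = (if j = 1 then 1 / 2 else bernoulli j / (of_nat j * fact j))"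

lemma log_trunc_nth:
  assumes "1 \<le> j" "j < p - 1"
  shows "log_trunc expm1_trunc $ j = log_coeff j"
proof -
  have h0: "fps_expm1_div_X $ 0 = 1" by (simp add: expm1_div_X_nth)
  have "(fps_X * fps_deriv (log_trunc expm1_trunc)) $ j = (fps_X + bernoulli_fps - 1) $ j"
  proof (rule fps_mult_left_cancel_upto[OF h0])
    fix i assume i: "i \<le> p - 2"
    have cut: "1 + expm1_trunc = fps_cutoff (p - 1) fps_expm1_div_X" by (simp add: expm1_trunc_def)
    have i': "i < p - 1" using i p_ge_3 by linarith
    have "(fps_expm1_div_X * (fps_X * fps_deriv (log_trunc expm1_trunc))) $ i
       = ((1 + expm1_trunc) * (fps_X * fps_deriv (log_trunc expm1_trunc))) $ i"
      unfolding cut using i' by (simp only: fps_cutoff_left_mult_nth)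
    also have "\<dots> = (fps_X * fps_deriv expm1_trunc) $ i"
      by (rule fps_deriv_log_trunc) (use i' in \<open>auto simp: expm1_trunc_nth\<close>)
    also have "\<dots> = (fps_X * fps_deriv fps_expm1_div_X) $ i"
      using i' by (cases i) (auto simp: expm1_trunc_nth expm1_div_X_nth)
    also have "\<dots> = (fps_expm1_div_X * (fps_X + bernoulli_fps - 1)) $ i"
      unfolding expm1_div_X_log_deriv ..
    finally show "(fps_expm1_div_X * (fps_X * fps_deriv (log_trunc expm1_trunc))) $ i
       = (fps_expm1_div_X * (fps_X + bernoulli_fps - 1)) $ i" .
  qed (use assms in auto)
  moreover have "(fps_X * fps_deriv (log_trunc expm1_trunc)) $ j = of_nat j * log_trunc expm1_trunc $ j"
    using assms by (cases j) auto
  ultimately have eq: "of_nat j * log_trunc expm1_trunc $ j = (fps_X + bernoulli_fps - 1) $ j" by simp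
  show ?thesis
  proof (cases "j = 1")
    case True
    have "(bernoulli_fps * fps_expm1_div_X) $ 1 = 0" unfolding bernoulli_fps_mult by simp
    moreover have "(bernoulli_fps * fps_expm1_div_X) $ 0 = 1" unfolding bernoulli_fps_mult by simp
    ultimately have "bernoulli_fps $ 1 = - 1 / 2" by (simp add: fps_mult_nth expm1_div_X_nth)
    thus ?thesis using eq True by (simp add: log_coeff_def)
  next
    case False
    hence "of_nat j * log_trunc expm1_trunc $ j = bernoulli j / fact j"
      using eq assms by (simp add: bernoulli_fps_nth)
    thus ?thesis using False assms by (simp add: log_coeff_def field_simps)
  qed
qed

lemma expm1_trunc_integral: "expm1_trunc \<in> wt 0 0"
  unfolding wt_0_0_iff by (auto simp: expm1_trunc_nth simp del: fact_Suc intro!: ord_ge_inverse_fact_less)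

lemma log_trunc_wt: "f \<in> wt d 0 \<Longrightarrow> log_trunc f \<in> wt d 0"
  unfolding log_trunc_def
  by (intro wt_sum wt_scale_int ord_ge_log_coeff) (use wt_power[of f d 0] in auto)

text \<open>These numbers are coefficients of an integral polynomial expression in an integral
  series. This stands in for the theorem of von Staudt and Clausen at indices below
  \<open>p - 1\<close>.\<close>

lemma ord_ge_log_coeff_integral:
  assumes "1 \<le> j" "j < p - 1" shows "ord_ge p 0 (log_coeff j)"
  using log_trunc_wt[OF expm1_trunc_integral] log_trunc_nth[OF assms] unfolding wt_0_0_iff by metis

definition log_W :: "rat fps" where
  "log_W = (\<Sum>j=1..p-2. fps_const (log_coeff j) * fps_X ^ j)"

lemma log_W_nth: "log_W $ j = (if 1 \<le> j \<and> j \<le> p - 2 then log_coeff j else 0)"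
  by (simp add: log_W_def fps_sum_nth sum.delta if_distrib cong: if_cong)

lemma log_trunc_minus_log_W: "log_trunc expm1_trunc - log_W \<in> wt 1 (int (p - 1))"
proof (rule wtI)
  fix k
  consider "k = 0" | "1 \<le> k" "k < p - 1" | "k \<ge> p - 1" by linarith
  thus "\<exists>m. ord_ge p m ((log_trunc expm1_trunc - log_W) $ k) \<and> int (p - 1) * m + int (1 * k) \<ge> int (p - 1)"
  proof cases
    case 1
    have "log_trunc expm1_trunc $ 0 = 0"
      by (auto simp: log_trunc_def fps_sum_nth fps_nth_power_0 expm1_trunc_nth intro!: sum.neutral)
    thus ?thesis using 1 by (intro exI[of _ 1]) (simp add: log_W_nth)
  next
    case 2
    thus ?thesis using log_trunc_nth[OF 2] by (intro exI[of _ 1]) (auto simp: log_W_nth)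
  next
    case 3
    have "ord_ge p 0 (log_trunc expm1_trunc $ k)"
      using log_trunc_wt[OF expm1_trunc_integral] unfolding wt_0_0_iff by blast
    thus ?thesis using 3 p_ge_3 by (intro exI[of _ 0]) (auto simp: log_W_nth)
  qed
qed

lemma W_nth: "expansion_W $ k = E 1 $ Suc k"
  by (simp add: expansion_W_def)

lemma W_nth_weight:
  shows "\<exists>m. ord_ge p m (expansion_W $ k) \<and> int (p - 1) * m + int k \<ge> int (min k (p - 1))"
proof -
  have "\<exists>m. ord_ge p m (E (of_int 1) $ Suc k) \<and> int (p - 1) * m + int (Suc k) \<ge> int (min (Suc k) p)"
    by (rule E_nth_weight) (simp_all only: of_nat_le_iff min.cobounded1 min.cobounded2)
  then obtain m where "ord_ge p m (E (of_int 1) $ Suc k)" "int (p - 1) * m + int (Suc k) \<ge> int (min (Suc k) p)"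
    by blast
  thus ?thesis unfolding W_nth using p_ge_3 by (intro exI[of _ m]) (auto simp: min_def split: if_splits)
qed

text \<open>Below degree \<open>p - 1\<close> the coefficients of \<open>W\<close> are those of
  \<open>(e^x - 1) / x\<close>. The three bounds serve respectively for the powers of
  \<open>W - 1\<close>, for isolating its linear part in the \<open>p\<close>-th power, and for
  passing to \<open>expm1_trunc\<close>.\<close>

lemma W_minus_1_wt: "expansion_W - 1 \<in> wt 1 1"
  and W_minus_linear_wt: "expansion_W - 1 - fps_const (1/2) * fps_X \<in> wt 1 2"
  and W_minus_trunc_wt: "expansion_W - 1 - expm1_trunc \<in> wt 1 (int (p - 1))"
proof -
  have W: "expansion_W $ k = 1 / fact (Suc k)" if "k < p - 1" for k
    unfolding W_nth using E_nth_less_p[of "Suc k" 1] that by simp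
  have W0: "expansion_W $ 0 = 1" using W[of 0] p_ge_3 by simp
  have W1: "expansion_W $ Suc 0 = 1 / 2" using W[of 1] p_ge_3 by simp
  have ex: "\<exists>m. ord_ge p m (0::rat) \<and> int (p - 1) * m + int (1 * k) \<ge> c" for c k
    using wt_zero[of 1 c] unfolding wt_def by auto
  have key: "\<exists>m. ord_ge p m (expansion_W $ k) \<and> int (p - 1) * m + int (1 * k) \<ge> c" if "c \<le> int k" "c \<le> int (p - 1)" for k c
    using W_nth_weight[of k] that by (force simp: min_def split: if_splits)
  show "expansion_W - 1 \<in> wt 1 1"
  proof (rule wtI)
    fix k show "\<exists>m. ord_ge p m ((expansion_W - 1) $ k) \<and> int (p - 1) * m + int (1 * k) \<ge> 1"
    proof (cases "k = 0")
      case True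
      hence "(expansion_W - 1) $ k = 0" using W0 by (cases k) auto
      thus ?thesis using ex by simp
    next
      case False
      hence "(expansion_W - 1) $ k = expansion_W $ k" by (cases k) auto
      moreover have "1 \<le> int k" "1 \<le> int (p - 1)" using False p_ge_3 by auto
      ultimately show ?thesis using key by simp
    qed
  qed
  show "expansion_W - 1 - fps_const (1/2) * fps_X \<in> wt 1 2"
  proof (rule wtI)
    fix k show "\<exists>m. ord_ge p m ((expansion_W - 1 - fps_const (1/2) * fps_X) $ k) \<and> int (p - 1) * m + int (1 * k) \<ge> 2"
    proof (cases "k \<le> 1")
      case True
      hence "(expansion_W - 1 - fps_const (1/2) * fps_X) $ k = 0" using W0 W1 by (cases k) auto
      thus ?thesis using ex by simp
    next
      case False
      hence "(expansion_W - 1 - fps_const (1/2) * fps_X) $ k = expansion_W $ k" by (cases k) auto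
      moreover have "2 \<le> int k" "2 \<le> int (p - 1)" using False p_ge_3 by auto
      ultimately show ?thesis using key by simp
    qed
  qed
  show "expansion_W - 1 - expm1_trunc \<in> wt 1 (int (p - 1))"
  proof (rule wtI)
    fix k show "\<exists>m. ord_ge p m ((expansion_W - 1 - expm1_trunc) $ k) \<and> int (p - 1) * m + int (1 * k) \<ge> int (p - 1)"
    proof (cases "k < p - 1")
      case True
      hence "(expansion_W - 1 - expm1_trunc) $ k = 0" using W[OF True] by (auto simp: expm1_trunc_nth)
      thus ?thesis using ex by simp
    next
      case False
      thus ?thesis using key[of "int (p - 1)" k] p_ge_3 by (auto simp: expm1_trunc_nth)
    qed
  qed
qed

lemma wt_power_diff:
  assumes "f \<in> wt d 0" "g \<in> wt d 0" "f - g \<in> wt d c"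
  shows "f ^ k - g ^ k \<in> wt d c"
proof (induction k)
  case (Suc k)
  have "f ^ Suc k - g ^ Suc k = f * (f ^ k - g ^ k) + (f - g) * g ^ k" by (simp add: algebra_simps)
  moreover have "g ^ k \<in> wt d 0" using wt_power[OF assms(2), of k] by simp
  ultimately show ?case using wt_mult[OF assms(1) Suc.IH] wt_mult[OF assms(3), of "g ^ k" 0] by (auto intro: wt_add)
qed simp

lemma binomial_p_minus_1: "k < p \<Longrightarrow> ord_ge p 1 (of_nat (p - 1 choose k) - (-1) ^ k)"
proof (induction k)
  case (Suc k)
  have "p choose Suc k = (p - 1 choose k) + (p - 1 choose Suc k)"
    using p_ge_3 by (cases p) auto
  hence e: "of_nat (p - 1 choose Suc k) - (-1) ^ Suc k = of_nat (p choose Suc k) - (of_nat (p - 1 choose k) - (-1) ^ k :: rat)"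
    by simp
  show ?case unfolding e by (intro ord_ge_diff ord_ge_binomial_p Suc.IH) (use Suc.prems in auto)
qed simp

lemma binomial_p_conv_log_coeff:
  assumes "1 \<le> k" "k < p"
  shows "ord_ge p 2 (of_nat (p choose k) - of_nat p * ((-1) ^ (k - 1) / of_nat k))"
proof -
  have "k * (p choose k) = p * (p - 1 choose (k - 1))"
    using assms p_ge_3 Suc_times_binomial_eq[of "p - 1" "k - 1"] by (cases k; cases p) (auto simp: mult.commute)
  hence "of_nat k * of_nat (p choose k) = (of_nat p * of_nat (p - 1 choose (k - 1)) :: rat)"
    by (metis of_nat_mult)
  hence "of_nat (p choose k) - of_nat p * ((-1) ^ (k - 1) / of_nat k)
    = (1 / of_nat k) * (of_nat p * (of_nat (p - 1 choose (k - 1)) - (-1) ^ (k - 1)) :: rat)"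
    using assms by (simp add: field_simps)
  also have "ord_ge p (0 + (1 + 1)) \<dots>"
    by (intro ord_ge_mult ord_ge_p binomial_p_minus_1 ord_ge_inverse_nat) (use assms nat_dvd_not_less[of k p] in auto)
  finally show ?thesis by simp
qed

text \<open>Expand \<open>(1 + Y)^p\<close> with \<open>Y = W - 1\<close>. The terms with
  \<open>0 < k < p\<close> give \<open>p log W\<close>. The last term \<open>Y^p\<close> has weight
  only \<open>p\<close>, below \<open>2 (p - 1)\<close>, so its leading part
  \<open>(x / 2)^p\<close> has to be kept.\<close>

lemma W_power_p:
  "expansion_W ^ p - 1 - fps_const (of_nat p) * (log_W + fps_const (1 / (2 ^ p * of_nat p)) * fps_X ^ p) \<in> wt 1 (2 * int (p - 1))"
proof -
  define Y where "Y = expansion_W - 1"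
  define Y2 where "Y2 = Y - fps_const (1/2) * fps_X"
  have Y: "Y \<in> wt 1 1" and Y2: "Y2 \<in> wt 1 2"
    using W_minus_1_wt W_minus_linear_wt by (simp_all add: Y_def Y2_def)
  have Y0: "Y \<in> wt 1 0" using Y by (rule wt_mono) simp
  have tr0: "expm1_trunc \<in> wt 1 0"
    by (rule wtI) (use expm1_trunc_integral in \<open>auto simp: wt_0_0_iff intro!: exI[of _ 0]\<close>)
  have "expansion_W ^ p = (Y + 1) ^ p" by (simp add: Y_def)
  also have "\<dots> = (\<Sum>k\<le>p. of_nat (p choose k) * Y ^ k * 1 ^ (p - k))" by (rule binomial_ring)
  also have "{..p} = insert 0 (insert p {1..p-1})" using p_ge_3 by auto
  also have "(\<Sum>k\<in>\<dots>. of_nat (p choose k) * Y ^ k * 1 ^ (p - k)) = 1 + Y ^ p + (\<Sum>k=1..p-1. fps_const (of_nat (p choose k)) * Y ^ k)"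
    using p_ge_3 by (simp add: fps_of_nat)
  finally have Wp: "expansion_W ^ p = 1 + Y ^ p + (\<Sum>k=1..p-1. fps_const (of_nat (p choose k)) * Y ^ k)" .
  have s1: "(\<Sum>k=1..p-1. fps_const (of_nat (p choose k) - of_nat p * ((-1) ^ (k - 1) / of_nat k)) * Y ^ k)
    = (\<Sum>k=1..p-1. fps_const (of_nat (p choose k)) * Y ^ k) - fps_const (of_nat p) * log_trunc Y"
    unfolding log_trunc_def sum_distrib_left sum_subtractf[symmetric]
    by (intro sum.cong refl) (simp only: fps_const_sub[symmetric] fps_const_mult[symmetric] left_diff_distrib mult.assoc)
  have s2: "(fps_const (1/2) * fps_X) ^ p = fps_const (of_nat p) * (fps_const (1 / (2 ^ p * of_nat p)) * fps_X ^ p :: rat fps)"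
    by (simp add: power_mult_distrib power_divide flip: mult.assoc)
  have "expansion_W ^ p - 1 - fps_const (of_nat p) * (log_W + fps_const (1 / (2 ^ p * of_nat p)) * fps_X ^ p)
    = (\<Sum>k=1..p-1. fps_const (of_nat (p choose k) - of_nat p * ((-1) ^ (k - 1) / of_nat k)) * Y ^ k)
      + fps_const (of_nat p) * (log_trunc Y - log_trunc expm1_trunc)
      + fps_const (of_nat p) * (log_trunc expm1_trunc - log_W)
      + (Y ^ p - (fps_const (1/2) * fps_X) ^ p)"
    unfolding Wp s1 s2 by (simp only: distrib_left right_diff_distrib) simp
  also have "\<dots> \<in> wt 1 (2 * int (p - 1))"
  proof (intro wt_add)
    show "(\<Sum>k=1..p-1. fps_const (of_nat (p choose k) - of_nat p * ((-1) ^ (k - 1) / of_nat k)) * Y ^ k) \<in> wt 1 (2 * int (p - 1))"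
    proof (rule wt_sum)
      fix k assume k: "k \<in> {1..p-1}"
      have "fps_const (of_nat (p choose k) - of_nat p * ((-1) ^ (k - 1) / of_nat k)) * Y ^ k \<in> wt 1 (int (p - 1) * 2 + int k * 1)"
        by (intro wt_scale wt_power Y binomial_p_conv_log_coeff) (use k in auto)
      thus "fps_const (of_nat (p choose k) - of_nat p * ((-1) ^ (k - 1) / of_nat k)) * Y ^ k \<in> wt 1 (2 * int (p - 1))"
        by (rule wt_mono) auto
    qed
    have "log_trunc Y - log_trunc expm1_trunc = (\<Sum>k=1..p-1. fps_const ((-1) ^ (k - 1) / of_nat k) * (Y ^ k - expm1_trunc ^ k))"
      by (simp add: log_trunc_def sum_subtractf right_diff_distrib)
    also have "\<dots> \<in> wt 1 (int (p - 1))"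
      by (intro wt_sum wt_scale_int ord_ge_log_coeff wt_power_diff Y0 tr0) (use W_minus_trunc_wt in \<open>simp_all add: Y_def\<close>)
    finally have "fps_const (of_nat p) * (log_trunc Y - log_trunc expm1_trunc) \<in> wt 1 (int (p - 1) * 1 + int (p - 1))"
      by (intro wt_scale ord_ge_p)
    thus "fps_const (of_nat p) * (log_trunc Y - log_trunc expm1_trunc) \<in> wt 1 (2 * int (p - 1))" by simp
    have "fps_const (of_nat p) * (log_trunc expm1_trunc - log_W) \<in> wt 1 (int (p - 1) * 1 + int (p - 1))"
      by (intro wt_scale ord_ge_p log_trunc_minus_log_W)
    thus "fps_const (of_nat p) * (log_trunc expm1_trunc - log_W) \<in> wt 1 (2 * int (p - 1))" by simp
    have X1: "fps_const (1/2) * fps_X \<in> wt 1 1"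
    proof (rule wt_scale_int)
      show "ord_ge p 0 (1 / 2 :: rat)" using ord_ge_inverse_fact_less[of 2] p_ge_3 by simp
      show "fps_X \<in> wt 1 1" using wt_X_power[of 1 1 1] by simp
    qed
    have "(fps_const (1/2) * fps_X + Y2) ^ p - (fps_const (1/2) * fps_X) ^ p - Y2 ^ p \<in> wt 1 (2 * int (p - 1))"
      by (rule wt_binomial_p[OF X1 Y2]) (auto simp: of_nat_diff)
    moreover have "Y2 ^ p \<in> wt 1 (2 * int (p - 1))"
      by (rule wt_mono[OF wt_power[OF Y2, of p]]) auto
    ultimately have "((fps_const (1/2) * fps_X + Y2) ^ p - (fps_const (1/2) * fps_X) ^ p - Y2 ^ p) + Y2 ^ p \<in> wt 1 (2 * int (p - 1))"
      by (rule wt_add)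
    thus "Y ^ p - (fps_const (1/2) * fps_X) ^ p \<in> wt 1 (2 * int (p - 1))"
      by (simp add: Y2_def)
  qed
  finally show ?thesis .
qed

section \<open>Fleck quotients modulo \<open>p ^ (b + 1)\<close>\<close>

text \<open>The order of \<open>k\<close> is at most \<open>k - 2\<close> since \<open>p\<close> is
  odd; equality occurs at \<open>k = p = 3\<close>. The \<open>k\<close>-th power of a multiple of
  \<open>p\<close> thus keeps two factors \<open>p\<close> after division by
  \<open>k\<close>.\<close>

lemma ord_ge_inverse_ge_2:
  assumes "k \<ge> 2" shows "ord_ge p (- int (k - 2)) (1 / of_nat k)"
proof (cases "k = 2")
  case True
  thus ?thesis using ord_ge_inverse_fact_less[of 2] p_ge_3 by simp
next
  case False
  hence k: "k \<ge> 3" using assms by simp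
  have "k - 1 \<le> 2 * (k - 2)" using k by simp
  also have "\<dots> \<le> (p - 1) * (k - 2)" using p_ge_3 by (intro mult_right_mono) auto
  finally have "int (k - 1) \<le> int (p - 1) * int (k - 2)" by (metis of_nat_le_iff of_nat_mult)
  hence "ord_ge p (- int (k - 2)) (1 / fact k)" by (rule ord_ge_inverse_fact)
  hence "ord_ge p (- int (k - 2)) (of_nat (fact (k - 1)) * (1 / fact k))"
    by (intro ord_ge_mult_int ord_ge_of_nat)
  moreover have "of_nat (fact (k - 1)) * (1 / fact k) = (1 / of_nat k :: rat)"
    using k by (cases k) (auto simp del: of_nat_Suc)
  ultimately show ?thesis by simp
qed

text \<open>As \<open>(n choose k) = n / k * (n - 1 choose (k - 1))\<close>, the term of index
  \<open>k \<ge> 2\<close> is worth at least \<open>(b - 1) - (k - 2) + k = b + 1\<close> powers of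
  \<open>p\<close>.\<close>

lemma wt_one_plus_power:
  assumes Z: "Z \<in> wt d (int (p - 1))" and b: "p ^ (b - 1) dvd n" "b \<ge> 1"
  shows "(1 + Z) ^ n - 1 - fps_const (of_nat n) * Z \<in> wt d (int (p - 1) * int (b + 1))"
proof -
  have bin: "fps_const (of_nat (n choose k)) * Z ^ k \<in> wt d (int (p - 1) * int (b + 1))" if k: "k \<ge> 2" for k
  proof -
    have "k * (n choose k) = n * (n - 1 choose (k - 1))"
      using k Suc_times_binomial_eq[of "n - 1" "k - 1"] by (cases k; cases n) (auto simp: mult.commute)
    hence "of_nat k * of_nat (n choose k) = (of_nat n * of_nat (n - 1 choose (k - 1)) :: rat)"
      by (metis of_nat_mult)
    hence "of_nat (n choose k) = of_nat n * of_nat (n - 1 choose (k - 1)) * (1 / of_nat k :: rat)"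
      using k by (simp add: field_simps)
    moreover have "ord_ge p (int (b - 1)) (of_nat n)"
      using ord_ge_of_int_iff[of "b - 1" "int n"] b by (metis of_int_of_nat_eq of_nat_dvd_iff of_nat_power)
    ultimately have "ord_ge p (int (b - 1) + 0 + - int (k - 2)) (of_nat (n choose k))"
      by (simp only:) (intro ord_ge_mult ord_ge_inverse_ge_2 ord_ge_of_nat k)
    hence "fps_const (of_nat (n choose k)) * Z ^ k \<in> wt d (int (p - 1) * (int (b - 1) + 0 + - int (k - 2)) + int k * int (p - 1))"
      by (intro wt_scale wt_power Z)
    thus ?thesis
    proof (rule wt_mono)
      have "int (p - 1) * (int (b - 1) + 0 + - int (k - 2)) + int k * int (p - 1)
         = int (p - 1) * int (b + 1)"
        using b k p_ge_3 by (simp add: of_nat_diff algebra_simps)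
      thus "int (p - 1) * int (b + 1) \<le> int (p - 1) * (int (b - 1) + 0 + - int (k - 2)) + int k * int (p - 1)"
        by simp
    qed
  qed
  have "(1 + Z) ^ n = (\<Sum>k\<le>n. of_nat (n choose k) * Z ^ k * 1 ^ (n - k))"
    unfolding add.commute[of 1 Z] by (rule binomial_ring)
  also have "\<dots> = (\<Sum>k\<le>n. fps_const (of_nat (n choose k)) * Z ^ k)" by (simp add: fps_of_nat)
  also have "\<dots> = (\<Sum>k\<le>n + 1. fps_const (of_nat (n choose k)) * Z ^ k)" by simp
  also have "{..n + 1} = insert 0 (insert 1 {2..n + 1})" by auto
  also have "(\<Sum>k\<in>\<dots>. fps_const (of_nat (n choose k)) * Z ^ k) = 1 + (fps_const (of_nat n) * Z + (\<Sum>k=2..n + 1. fps_const (of_nat (n choose k)) * Z ^ k))"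
    by simp
  finally have "(1 + Z) ^ n - 1 - fps_const (of_nat n) * Z = (\<Sum>k=2..n + 1. fps_const (of_nat (n choose k)) * Z ^ k)"
    by simp
  also have "\<dots> \<in> wt d (int (p - 1) * int (b + 1))" by (intro wt_sum bin) auto
  finally show ?thesis .
qed

lemma one_plus_power_lift:
  assumes "ord_ge p 1 e" and b: "p ^ (b - 1) dvd n" "b \<ge> 1"
  shows "ord_ge p (int b + 1) ((1 + e) ^ n - 1 - of_nat n * e)"
proof -
  have "fps_const e \<in> wt 0 (int (p - 1))" using assms by (intro wt_const[of 1]) auto
  from wt_one_plus_power[OF this b]
  have "ord_ge p (int b + 1) (((1 + fps_const e) ^ n - 1 - fps_const (of_nat n) * fps_const e) $ 0)"
    by (rule wt_obtain_ord) (use p_ge_3 in simp)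
  thus ?thesis by (simp add: fps_nth_power_0)
qed

text \<open>\<open>p\<close> times the second summand is \<open>(x / 2)^p\<close>. At
  \<open>\<pi>\<close>, where \<open>x^p\<close> becomes \<open>- p x\<close>, that summand acts as
  \<open>- x / 2^p\<close> and so cancels the linear term \<open>x / 2\<close> modulo
  \<open>p\<close>.\<close>

definition log_W_full :: "rat fps" where
  "log_W_full = log_W + fps_const (1 / (2 ^ p * of_nat p)) * fps_X ^ p"

lemma ord_ge_half_power: "ord_ge p 0 (1 / 2 ^ k)"
  using ord_ge_power[OF ord_ge_inverse_fact_less[of 2], of k] p_ge_3 by (simp add: power_divide)

lemma log_W_full_wt: "log_W_full \<in> wt 1 1"
  unfolding log_W_full_def
proof (rule wt_add)
  show "log_W \<in> wt 1 1" unfolding log_W_def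
    by (intro wt_sum wt_scale_int ord_ge_log_coeff_integral wt_X_power) auto
  have "ord_ge p (0 + - 1) (1 / 2 ^ p * of_nat p powi (- 1))"
    by (intro ord_ge_mult ord_ge_p_powi ord_ge_half_power)
  hence "ord_ge p (- 1) (1 / (2 ^ p * of_nat p))" by (simp add: divide_inverse power_int_minus)
  hence "fps_const (1 / (2 ^ p * of_nat p)) * fps_X ^ p \<in> wt 1 (int (p - 1) * (- 1) + int p)"
    by (intro wt_scale wt_X_power) auto
  thus "fps_const (1 / (2 ^ p * of_nat p)) * fps_X ^ p \<in> wt 1 1"
    by (rule wt_mono) (use p_ge_3 in auto)
qed

lemma W_power_pn:
  assumes b: "p ^ (b - 1) dvd n" "b \<ge> 1"
  shows "expansion_W ^ (p * n) - 1 - fps_const (of_nat (p * n)) * log_W_full \<in> wt 1 (int (p - 1) * int (b + 1))"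
proof -
  define Z where "Z = expansion_W ^ p - 1"
  have Z1: "Z - fps_const (of_nat p) * log_W_full \<in> wt 1 (2 * int (p - 1))"
    using W_power_p by (simp add: Z_def log_W_full_def)
  have Z2: "fps_const (of_nat p) * log_W_full \<in> wt 1 (int p)"
    using wt_scale[OF ord_ge_p log_W_full_wt] p_ge_3 by (auto simp: of_nat_diff)
  have "(Z - fps_const (of_nat p) * log_W_full) + fps_const (of_nat p) * log_W_full \<in> wt 1 (int p)"
    by (intro wt_add Z2 wt_mono[OF Z1]) (use p_ge_3 in linarith)
  hence Z: "Z \<in> wt 1 (int p)" by simp
  have n: "ord_ge p (int (b - 1)) (of_nat n)"
    using ord_ge_of_int_iff[of "b - 1" "int n"] b by (metis of_int_of_nat_eq of_nat_dvd_iff of_nat_power)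
  have "fps_const (of_nat n) * (Z - fps_const (of_nat p) * log_W_full) \<in> wt 1 (int (p - 1) * int (b - 1) + 2 * int (p - 1))"
    by (intro wt_scale n Z1)
  moreover have "int (p - 1) * int (b - 1) + 2 * int (p - 1) = int (p - 1) * int (b + 1)"
    using b by (simp add: of_nat_diff algebra_simps)
  ultimately have "((1 + Z) ^ n - 1 - fps_const (of_nat n) * Z) + fps_const (of_nat n) * (Z - fps_const (of_nat p) * log_W_full)
     \<in> wt 1 (int (p - 1) * int (b + 1))"
    by (intro wt_add wt_one_plus_power[OF wt_mono[OF Z] b]) simp_all
  also have "((1 + Z) ^ n - 1 - fps_const (of_nat n) * Z) + fps_const (of_nat n) * (Z - fps_const (of_nat p) * log_W_full)
    = expansion_W ^ (p * n) - 1 - fps_const (of_nat (p * n)) * log_W_full"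
  proof -
    have "(1 + Z) ^ n = expansion_W ^ (p * n)" by (simp add: Z_def power_mult)
    moreover have "fps_const (of_nat (p * n)) = fps_const (of_nat n) * fps_const (of_nat p :: rat)"
      by (simp add: mult.commute)
    ultimately show ?thesis by (simp only: right_diff_distrib mult.assoc) simp
  qed
  finally show ?thesis .
qed

text \<open>The index leaves a remainder \<open>s < p - 1\<close>, too small to lower the order by
  1, so the weight \<open>(p - 1) (b + 1)\<close> becomes the full order
  \<open>b + 1\<close>.\<close>

lemma wt_trace_term:
  assumes "f \<in> wt 1 (int (p - 1) * int (b + 1))" "s < p - 1"
  shows "ord_ge p (int b + 1) ((- of_nat p) ^ i * f $ (s + (p - 1) * i))"
proof -
  have "ord_ge p (int b + 1 - int i) (f $ (s + (p - 1) * i))"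
  proof (rule wt_obtain_ord[OF assms(1)])
    have "int (p - 1) * (int b + 1 - int i - 1) + int (1 * (s + (p - 1) * i)) = int (p - 1) * int b + int s"
    proof -
      have "P * (x + 1 - y - 1) + (z + P * y) = P * x + z" for P x y z :: int
        by (simp add: algebra_simps)
      thus ?thesis by (simp only: mult_1 of_nat_add of_nat_mult)
    qed
    also have "\<dots> < int (p - 1) * int (b + 1)" using assms(2) by (simp only: of_nat_add distrib_left)
    finally show "int (p - 1) * (int b + 1 - int i - 1) + int (1 * (s + (p - 1) * i)) < int (p - 1) * int (b + 1)" .
  qed
  hence "ord_ge p (int i + (int b + 1 - int i)) ((- of_nat p) ^ i * f $ (s + (p - 1) * i))"
    by (intro ord_ge_mult ord_ge_neg_p_power)
  thus ?thesis by simp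
qed

lemma E_trace_term:
  assumes "j < p * (l + 1)" "l \<ge> 1"
  shows "ord_ge p 1 ((- of_nat p) ^ l * E (of_int a) $ j)"
proof -
  have "int j < int (p * (l + 1))" using assms by (simp only: of_nat_less_iff)
  from coeffE_bound[OF this, of a]
  have "ord_ge p (- int (2 * (l div p) + l div p div 2)) (E (of_int a) $ j)" by (simp add: coeffE_def)
  hence "ord_ge p (int l + (- int (2 * (l div p) + l div p div 2))) ((- of_nat p) ^ l * E (of_int a) $ j)"
    by (intro ord_ge_mult ord_ge_neg_p_power)
  thus ?thesis by (rule ord_ge_mono) (use loss_bounds(1)[OF assms(2)] in linarith)
qed

text \<open>The coefficient of \<open>x^s\<close> in \<open>exp (a x)\<close> times the terms of
  \<open>log ((e^x - 1) / x)\<close> of degree at least 2.\<close>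

definition bernoulli_part :: "rat \<Rightarrow> nat \<Rightarrow> rat" where
  "bernoulli_part a s = (\<Sum>k | 1 < k \<and> k \<le> s. log_coeff k * (a ^ (s - k) / fact (s - k)))"

text \<open>Modulo \<open>p\<close> the terms with \<open>i \<ge> 1\<close> vanish with one
  exception: the denominator \<open>p\<close> of the \<open>x^p\<close> term keeps a contribution at
  \<open>i = 1\<close>. It cancels the linear term of \<open>log W\<close>, by Fermat's congruence
  for \<open>1/2\<close>.\<close>

lemma log_W_trace:
  assumes s: "1 \<le> s" "s < p - 1" and L: "L \<ge> 1"
  shows "ord_ge p 1 ((\<Sum>i\<le>L. (- of_nat p) ^ i * (E (of_int a) * log_W_full) $ (s + (p - 1) * i)) - bernoulli_part (of_int a) s)"
proof -
  let ?E = "E (of_int a)"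
  let ?c = "1 / (2 ^ p * of_nat p) :: rat"
  have coeff: "(?E * log_W_full) $ j = (\<Sum>k=1..p-2. log_coeff k * (if k \<le> j then ?E $ (j - k) else 0))
      + ?c * (if p \<le> j then ?E $ (j - p) else 0)" for j
  proof -
    have "?E * log_W_full = (\<Sum>k=1..p-2. fps_const (log_coeff k) * (fps_X ^ k * ?E)) + fps_const ?c * (fps_X ^ p * ?E)"
      unfolding log_W_full_def log_W_def by (simp add: distrib_left sum_distrib_left mult_ac)
    thus ?thesis by (simp only: fps_add_nth fps_sum_nth fps_mult_left_const_nth fps_X_power_mult_nth not_less[symmetric])
      (auto intro!: sum.cong arg_cong2[of _ _ _ _ "(+)"])
  qed
  have s': "s - 1 < p" using s by simp
  have c0: "(?E * log_W_full) $ s = log_coeff 1 * ?E $ (s - 1) + bernoulli_part (of_int a) s"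
  proof -
    have "(?E * log_W_full) $ s = (\<Sum>k=1..p-2. if k \<le> s then log_coeff k * ?E $ (s - k) else 0)"
      unfolding coeff using s by (auto intro!: sum.cong)
    also have "\<dots> = (\<Sum>k\<in>{k \<in> {1..p-2}. k \<le> s}. log_coeff k * ?E $ (s - k))"
      by (intro sum.inter_filter[symmetric]) auto
    also have "{k \<in> {1..p-2}. k \<le> s} = insert 1 {k. 1 < k \<and> k \<le> s}" using s by auto
    also have "(\<Sum>k\<in>\<dots>. log_coeff k * ?E $ (s - k)) = log_coeff 1 * ?E $ (s - 1) + (\<Sum>k | 1 < k \<and> k \<le> s. log_coeff k * ?E $ (s - k))"
      by (subst sum.insert) (auto intro: finite_subset[of _ "{..s}"])
    also have "(\<Sum>k | 1 < k \<and> k \<le> s. log_coeff k * ?E $ (s - k)) = bernoulli_part (of_int a) s"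
      unfolding bernoulli_part_def by (intro sum.cong) (use s E_nth_less_p in auto)
    finally show ?thesis .
  qed
  have tail: "ord_ge p 1 ((- of_nat p) ^ i * (\<Sum>k=1..p-2. log_coeff k * (if k \<le> s + (p - 1) * i then ?E $ (s + (p - 1) * i - k) else 0)))"
    if i: "i \<ge> 1" for i
    unfolding sum_distrib_left
  proof (rule ord_ge_sum)
    fix k assume k: "k \<in> {1..p-2}"
    have "(p - 1) * i + i = p * i" using p_ge_3 by (cases p) auto
    hence "s + (p - 1) * i - k < p * (i + 1)" using s i by (simp only: distrib_left mult_1_right)
    hence "ord_ge p 1 (log_coeff k * ((- of_nat p) ^ i * ?E $ (s + (p - 1) * i - k)))"
      by (intro ord_ge_mult_int ord_ge_log_coeff_integral E_trace_term i) (use k p_ge_3 in auto)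
    thus "ord_ge p 1 ((- of_nat p) ^ i * (log_coeff k * (if k \<le> s + (p - 1) * i then ?E $ (s + (p - 1) * i - k) else 0)))"
      by (simp add: mult_ac)
  qed
  have X1: "(- of_nat p) ^ 1 * (?c * (if p \<le> s + (p - 1) * 1 then ?E $ (s + (p - 1) * 1 - p) else 0)) = - (1 / 2 ^ p) * ?E $ (s - 1)"
    using s by simp
  have X2: "ord_ge p 1 ((- of_nat p) ^ i * (?c * (if p \<le> s + (p - 1) * i then ?E $ (s + (p - 1) * i - p) else 0)))" if i: "i \<ge> 2" for i
  proof -
    obtain l where l: "i = Suc l" "l \<ge> 1" using i by (cases i) auto
    have "(p - 1) * i = (p - 1) * l + (p - 1)" by (simp add: l)
    moreover have "(p - 1) * l + l = p * l" using p_ge_3 by (cases p) auto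
    ultimately have "s + (p - 1) * i - p < p * (l + 1)" using s by (simp only: distrib_left mult_1_right)
    hence "ord_ge p 1 (- (1 / 2 ^ p) * ((- of_nat p) ^ l * ?E $ (s + (p - 1) * i - p)))"
      by (intro ord_ge_mult_int ord_ge_minus ord_ge_half_power E_trace_term l)
    moreover have "(- of_nat p) ^ i * (?c * x) = - (1 / 2 ^ p) * ((- of_nat p) ^ l * x)" for x
      by (simp add: l)
    ultimately show ?thesis by simp
  qed
  have lc: "log_coeff 1 = 1 / 2" by (simp add: log_coeff_def)
  have half: "ord_ge p 1 (log_coeff 1 - 1 / 2 ^ p)" unfolding lc
    using ord_ge_minus[OF fermat_padic[of "1/2"]] ord_ge_inverse_fact_less[of 2] p_ge_3 by (simp add: power_divide)
  have "(\<Sum>i\<le>L. (- of_nat p) ^ i * (?E * log_W_full) $ (s + (p - 1) * i))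
     = (?E * log_W_full) $ s + (- of_nat p) ^ 1 * (?E * log_W_full) $ (s + (p - 1) * 1) + (\<Sum>i=2..L. (- of_nat p) ^ i * (?E * log_W_full) $ (s + (p - 1) * i))"
  proof -
    have "{..L} = insert 0 (insert 1 {2..L})" using L by auto
    thus ?thesis by simp
  qed
  also have "\<dots> = log_coeff 1 * ?E $ (s - 1) + bernoulli_part (of_int a) s
      + ((- of_nat p) ^ 1 * (\<Sum>k=1..p-2. log_coeff k * (if k \<le> s + (p - 1) * 1 then ?E $ (s + (p - 1) * 1 - k) else 0))
         + - (1 / 2 ^ p) * ?E $ (s - 1))
      + (\<Sum>i=2..L. (- of_nat p) ^ i * (?E * log_W_full) $ (s + (p - 1) * i))"
    unfolding c0 coeff[of "s + (p - 1) * 1"] distrib_left[of "(- of_nat p) ^ 1"] X1 ..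
  finally have "(\<Sum>i\<le>L. (- of_nat p) ^ i * (?E * log_W_full) $ (s + (p - 1) * i)) = \<dots>" .
  moreover have aux: "X - \<beta> = (h - q) * e + T + R" if "X = h * e + \<beta> + (T + - q * e) + R" for X \<beta> h q e T R :: rat
    using that by (simp add: algebra_simps)
  ultimately have eq: "(\<Sum>i\<le>L. (- of_nat p) ^ i * (?E * log_W_full) $ (s + (p - 1) * i)) - bernoulli_part (of_int a) s
    = (log_coeff 1 - 1 / 2 ^ p) * ?E $ (s - 1)
      + (- of_nat p) ^ 1 * (\<Sum>k=1..p-2. log_coeff k * (if k \<le> s + (p - 1) * 1 then ?E $ (s + (p - 1) * 1 - k) else 0))
      + (\<Sum>i=2..L. (- of_nat p) ^ i * (?E * log_W_full) $ (s + (p - 1) * i))"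
    by (intro aux)
  show ?thesis unfolding eq
  proof (intro ord_ge_add ord_ge_sum)
    show "ord_ge p 1 ((log_coeff 1 - 1 / 2 ^ p) * ?E $ (s - 1))"
      by (intro ord_ge_int_mult half E_nth_integral) (use s' self_le_power[of p 2] p_ge_3 in linarith)
    show "ord_ge p 1 ((- of_nat p) ^ 1 * (\<Sum>k=1..p-2. log_coeff k * (if k \<le> s + (p - 1) * 1 then ?E $ (s + (p - 1) * 1 - k) else 0)))"
      by (rule tail) simp
    fix i assume i: "i \<in> {2..L}"
    show "ord_ge p 1 ((- of_nat p) ^ i * (?E * log_W_full) $ (s + (p - 1) * i))"
      unfolding coeff distrib_left by (intro ord_ge_add tail X2) (use i in auto)
  qed
qed

text \<open>The trace of \<open>E (- r) * W^(p n)\<close> splits along the approximation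
  \<open>1 + p n log W\<close>. Since \<open>p^b\<close> divides \<open>p n\<close>, the second part
  is needed only modulo \<open>p\<close>, and the factor \<open>1 - p\<close> may be dropped from
  it.\<close>

lemma Fp_cong:
  fixes n b s K :: nat and r :: int
  assumes b: "p ^ (b - 1) dvd n" "b \<ge> 1" and s: "1 \<le> s" "s \<le> p - 2" "[n = s] (mod (p - 1))"
    and r: "\<not> int p dvd r" and K: "p ^ b dvd (p - 1 - s) + (p - 1) * K"
  shows "ord_ge p (int b + 1) ((-1) ^ n * Fp p (p * n) r -
     (of_int (- r) ^ (p - 1 - s + (p - 1) * K) * (- of_nat p) ^ K * fact K / fact (p * K + (p - 1 - s))
       + of_nat (p * n) * bernoulli_part (of_int (- r)) (p - 1 - s)))"
proof -
  define s' where "s' = p - 1 - s"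
  have s': "1 \<le> s'" "s' < p - 1" "s' < p" using s by (auto simp: s'_def)
  let ?E = "E (of_int (- r))"
  let ?N = "p * n"
  have nr: "\<not> int p dvd - r" using r by simp
  have "[p = 1] (mod (p - 1))" using p_ge_3 by (simp add: cong_def le_mod_geq)
  hence "[?N = 1 * s] (mod (p - 1))" by (intro cong_mult s)
  moreover have "s < p - 1" using s p_ge_3 by linarith
  ultimately have "?N mod (p - 1) = s" by (simp add: cong_def)
  then obtain q where q: "?N = (p - 1) * q + s" by (metis mult_div_mod_eq)
  obtain L1 where L1: "\<And>L. L \<ge> L1 \<Longrightarrow> ord_ge p (int (b + 1)) ((1 - of_nat p) * (-1) ^ ?N *
     (\<Sum>i\<le>L. (- of_nat p) ^ i * (?E * expansion_W ^ ?N) $ (s' + (p - 1) * i)) - Fp p ?N r)"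
    using Fp_limit[OF q s(1,2), of "b + 1" r] unfolding s'_def by blast
  have "int p ^ b dvd int s' + (int p - 1) * int K"
  proof -
    have "int (p ^ b) dvd int (s' + (p - 1) * K)" using K unfolding s'_def of_nat_dvd_iff .
    thus ?thesis using p_ge_3 by (simp add: of_nat_diff)
  qed
  from trace_formula_cong[OF nr s'(3) this]
  obtain L2 where L2: "\<And>L. L \<ge> L2 \<Longrightarrow> ord_ge p (int b + 1) ((1 - of_nat p) * (\<Sum>k\<le>L. (- of_nat p) ^ k * ?E $ (s' + (p - 1) * k))
    - (\<Sum>k\<le>L. (- of_nat p) ^ k * (\<Prod>i<k. (of_int (int K) - of_nat i) / of_int (- r)) * ?E $ (s' + p * k)))"
    by blast
  define L where "L = L1 + L2 + K + 1"
  have LK: "L \<ge> L1" "L \<ge> L2" "L \<ge> K" "L \<ge> 1" by (simp_all add: L_def)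
  define \<gamma> where "\<gamma> = of_int (- r) ^ (s' + (p - 1) * K) * (- of_nat p) ^ K * fact K / (fact (p * K + s') :: rat)"
  define A where "A = (\<Sum>k\<le>L. (- of_nat p) ^ k * ?E $ (s' + (p - 1) * k))"
  define B where "B = (\<Sum>i\<le>L. (- of_nat p) ^ i * (?E * log_W_full) $ (s' + (p - 1) * i))"
  define C where "C = (\<Sum>i\<le>L. (- of_nat p) ^ i * (?E * expansion_W ^ ?N) $ (s' + (p - 1) * i))"
  have r0: "(of_int (- r) :: rat) \<noteq> 0" using r by auto
  have \<gamma>: "ord_ge p (int b + 1) ((1 - of_nat p) * A - \<gamma>)"
    using L2[OF LK(2)] frobenius_functional_value[OF r0 s'(3) LK(3)] unfolding A_def \<gamma>_def by simp
  have BB: "ord_ge p 1 (B - bernoulli_part (of_int (- r)) s')"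
    unfolding B_def by (rule log_W_trace[OF s'(1,2) LK(4)])
  define D where "D = expansion_W ^ ?N - 1 - fps_const (of_nat ?N) * log_W_full"
  have "?E \<in> wt 1 0"
    using E_nth_weight[of 0 _ "- r"] by (intro wtI) auto
  hence "?E * D \<in> wt 1 (0 + int (p - 1) * int (b + 1))"
    unfolding D_def by (intro wt_mult W_power_pn b)
  hence ED: "?E * D \<in> wt 1 (int (p - 1) * int (b + 1))" by simp
  have EW: "?E * expansion_W ^ ?N = ?E + fps_const (of_nat ?N) * (?E * log_W_full) + ?E * D"
    unfolding D_def by (simp add: algebra_simps)
  have "C = A + of_nat ?N * B + (\<Sum>i\<le>L. (- of_nat p) ^ i * (?E * D) $ (s' + (p - 1) * i))"
    unfolding A_def B_def C_def EW fps_add_nth fps_mult_left_const_nth distrib_left sum.distrib sum_distrib_left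
    by (simp only: mult.left_commute[of "of_nat ?N"])
  moreover have "ord_ge p (int b + 1) (\<Sum>i\<le>L. (- of_nat p) ^ i * (?E * D) $ (s' + (p - 1) * i))"
    by (intro ord_ge_sum wt_trace_term ED s')
  ultimately have C: "ord_ge p (int b + 1) (C - (A + of_nat ?N * B))" by simp
  have Nb: "ord_ge p (int b) (of_nat ?N)"
  proof -
    have "p ^ b dvd ?N" using b by (cases b) auto
    thus ?thesis using ord_ge_of_int_iff[of b "int ?N"] by (metis of_int_of_nat_eq of_nat_dvd_iff of_nat_power)
  qed
  have bp_int: "ord_ge p 0 (bernoulli_part (of_int (- r)) s')"
    unfolding bernoulli_part_def
  proof (rule ord_ge_sum)
    fix k assume k: "k \<in> {k. 1 < k \<and> k \<le> s'}"
    have "ord_ge p 0 (log_coeff k * (of_int ((- r) ^ (s' - k)) * (1 / fact (s' - k))))"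
      by (intro ord_ge_mult_int ord_ge_log_coeff_integral ord_ge_of_int ord_ge_inverse_fact_less) (use k s' in auto)
    thus "ord_ge p 0 (log_coeff k * (of_int (- r) ^ (s' - k) / fact (s' - k)))" by simp
  qed
  let ?\<beta> = "bernoulli_part (of_int (- r)) s'"
  have F: "ord_ge p (int b + 1) ((1 - of_nat p) * (-1) ^ ?N * C - Fp p ?N r)"
    using L1[OF LK(1)] unfolding C_def by (simp add: add.commute)
  have sgn: "(-1) ^ ?N = ((-1) ^ n :: rat)" using odd_p by (simp add: power_mult)
  have one: "(-1) ^ n * ((-1) ^ n * x) = x" for x :: rat
    by (simp flip: mult.assoc power_mult_distrib)
  have "ord_ge p (int b + 1) ((of_int (1 - int p) * (C - (A + of_nat ?N * B)) + ((1 - of_nat p) * A - \<gamma>)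
     + of_int (1 - int p) * (of_nat ?N * (B - ?\<beta>)) - of_nat ?N * (of_nat p * ?\<beta>))
     - (-1) ^ n * ((1 - of_nat p) * (-1) ^ ?N * C - Fp p ?N r))"
    by (intro ord_ge_add ord_ge_diff ord_ge_mult_int[OF ord_ge_of_int] C \<gamma> F ord_ge_mult_int[OF ord_ge_power[OF ord_ge_neg_1]]
        ord_ge_mult[OF Nb BB] ord_ge_mult[OF Nb ord_ge_int_mult[OF bp_int ord_ge_p]])
  also have "\<dots> = (-1) ^ n * Fp p ?N r - (\<gamma> + of_nat ?N * ?\<beta>)"
    unfolding sgn right_diff_distrib[of "(-1) ^ n"] mult.assoc[of "1 - of_nat p" "(-1) ^ n"] mult.left_commute[of "(-1) ^ n" "1 - of_nat p"] one
    by (simp add: algebra_simps)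
  finally show ?thesis unfolding \<gamma>_def s'_def .
qed

section \<open>Products of units modulo prime powers\<close>

lemma prod_one_plus_cong:
  assumes "finite A" "ord_ge p b c" "\<And>k. k \<in> A \<Longrightarrow> ord_ge p 0 (x k)" "b \<ge> 0"
  shows "ord_ge p (2 * b) ((\<Prod>k\<in>A. 1 + c * x k) - (1 + c * (\<Sum>k\<in>A. x k)))"
  using assms(1,3)
proof (induction A rule: finite_induct)
  case (insert k A)
  have c0: "ord_ge p 0 c" using assms(2,4) ord_ge_mono by blast
  have "ord_ge p (2 * b) ((1 + c * x k) * ((\<Prod>k\<in>A. 1 + c * x k) - (1 + c * (\<Sum>k\<in>A. x k))))"
    by (intro ord_ge_mult_int ord_ge_add ord_ge_1 c0 insert.IH) (use insert.prems in auto)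
  moreover have "ord_ge p (b + b) (c * c * (x k * (\<Sum>k\<in>A. x k)))"
    by (intro ord_ge_int_mult[OF _ ord_ge_mult[OF assms(2,2)]] ord_ge_mult_int ord_ge_sum) (use insert.prems in auto)
  ultimately have "ord_ge p (2 * b) ((1 + c * x k) * ((\<Prod>k\<in>A. 1 + c * x k) - (1 + c * (\<Sum>k\<in>A. x k)))
     + c * c * (x k * (\<Sum>k\<in>A. x k)))"
    by (intro ord_ge_add) simp_all
  thus ?case using insert.hyps by (simp add: algebra_simps)
qed simp

lemma units_upto_shift:
  "units_upto (p * c + m) = units_upto (p * c) \<union> (\<lambda>k. p * c + k) ` units_upto m"
  "units_upto (p * c) \<inter> (\<lambda>k. p * c + k) ` units_upto m = {}"
proof -
  show "units_upto (p * c + m) = units_upto (p * c) \<union> (\<lambda>k. p * c + k) ` units_upto m" (is "?A = ?B")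
  proof (intro equalityI subsetI)
    fix k assume k: "k \<in> ?A"
    show "k \<in> ?B"
    proof (cases "k \<le> p * c")
      case False
      then obtain j where "k = p * c + j" "j \<ge> 1" by (metis add_diff_inverse_nat less_imp_le_nat not_le Suc_leI zero_less_diff One_nat_def)
      thus ?thesis using k by (auto simp: units_upto_def)
    qed (use k in \<open>auto simp: units_upto_def\<close>)
  qed (auto simp: units_upto_def dvd_add_right_iff[of p "p * c"])
qed (auto simp: units_upto_def)

lemma prod_units_upto_shift:
  fixes f :: "nat \<Rightarrow> rat"
  shows "(\<Prod>k\<in>units_upto (p * c + m). f k) = (\<Prod>k\<in>units_upto (p * c). f k) * (\<Prod>k\<in>units_upto m. f (p * c + k))"
  unfolding units_upto_shift(1)
  by (subst prod.union_disjoint) (auto simp: units_upto_shift(2) prod.reindex inj_on_def)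

lemma sum_units_upto_shift:
  fixes f :: "nat \<Rightarrow> rat"
  shows "(\<Sum>k\<in>units_upto (p * c + m). f k) = (\<Sum>k\<in>units_upto (p * c). f k) + (\<Sum>k\<in>units_upto m. f (p * c + k))"
  unfolding units_upto_shift(1)
  by (subst sum.union_disjoint) (auto simp: units_upto_shift(2) sum.reindex inj_on_def)

lemma ord_ge_inverse_unit: "k \<in> units_upto m \<Longrightarrow> ord_ge p 0 (1 / of_nat k)"
  by (rule ord_ge_inverse_nat) (simp add: units_upto_def)

section \<open>First-order expansion of products of units\<close>

definition unit_harmonic :: "nat \<Rightarrow> rat" where
  "unit_harmonic m = (\<Sum>k\<in>units_upto m. 1 / of_nat k)"

lemma ord_ge_unit_harmonic: "ord_ge p 0 (unit_harmonic m)"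
  unfolding unit_harmonic_def by (intro ord_ge_sum ord_ge_inverse_unit)

lemma unit_fact_eq_prod: "(of_nat (unit_fact m) :: rat) = (\<Prod>k\<in>units_upto m. of_nat k)"
  by (simp add: unit_fact_def)

lemma units_upto_less_p: "m < p \<Longrightarrow> units_upto m = {1..m}"
  using nat_dvd_not_less by (auto simp: units_upto_def)

lemma units_upto_p: "units_upto p = {1..p-1}"
proof -
  have "units_upto p = units_upto (p - 1)" using p_ge_3 units_upto_Suc[of "p - 1"] by simp
  thus ?thesis using units_upto_less_p[of "p - 1"] p_ge_3 by simp
qed

lemma unit_fact_less_p: "m < p \<Longrightarrow> unit_fact m = fact m"
  by (simp add: unit_fact_def units_upto_less_p fact_prod)

lemma unit_harmonic_shift: "ord_ge p 1 (unit_harmonic (p * c + m) - unit_harmonic (p * c) - unit_harmonic m)"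
proof -
  have "unit_harmonic (p * c + m) - unit_harmonic (p * c) - unit_harmonic m
     = (\<Sum>k\<in>units_upto m. 1 / of_nat (p * c + k) - 1 / of_nat k)"
    by (simp only: unit_harmonic_def sum_units_upto_shift sum_subtractf add_diff_cancel_left')
  also have "ord_ge p 1 \<dots>"
  proof (rule ord_ge_sum)
    fix k assume k: "k \<in> units_upto m"
    hence "k \<noteq> 0" by (auto simp: units_upto_def)
    hence k0: "(of_nat k :: rat) \<noteq> 0" "(of_nat (p * c + k) :: rat) \<noteq> 0" by (simp_all only: of_nat_eq_0_iff add_is_0 simp_thms)
    have "\<not> p dvd p * c + k" using k by (simp add: units_upto_def dvd_add_right_iff[of p "p * c"])
    hence "ord_ge p 1 (- (1 / of_nat (p * c + k) * (1 / of_nat k) * (of_nat c * of_nat p)))"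
      by (intro ord_ge_minus ord_ge_mult_int ord_ge_inverse_nat ord_ge_p ord_ge_of_nat)
        (use k in \<open>auto simp: units_upto_def\<close>)
    also have "- (1 / of_nat (p * c + k) * (1 / of_nat k) * (of_nat c * of_nat p)) = 1 / of_nat (p * c + k) - (1 / of_nat k :: rat)"
    proof -
      have "1 / x - 1 / y = - (1 / x * (1 / y) * (x - y))" if "x \<noteq> 0" "y \<noteq> 0" for x y :: rat
        using that by (simp add: field_simps)
      from this[OF k0(2,1)] show ?thesis by (simp add: mult.commute)
    qed
    finally show "ord_ge p 1 (1 / of_nat (p * c + k) - 1 / of_nat k)" .
  qed
  finally show ?thesis .
qed

text \<open>Each block pairs \<open>k\<close> with \<open>p - k\<close>, and
  \<open>1/k + 1/(p - k) = p / (k (p - k))\<close>; the resulting factor 2 is a unit.\<close>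

lemma unit_harmonic_p_mult: "ord_ge p 1 (unit_harmonic (p * c))"
proof (induction c)
  case (Suc c)
  have "unit_harmonic p = (\<Sum>k=1..p-1. 1 / of_nat k)" by (simp add: unit_harmonic_def units_upto_p)
  moreover have "(\<Sum>k=1..p-1. 1 / of_nat k) = (\<Sum>k=1..p-1. 1 / of_nat (p - k) :: rat)"
    by (rule sum.reindex_bij_witness[of _ "\<lambda>k. p - k" "\<lambda>k. p - k"]) auto
  ultimately have "2 * unit_harmonic p = (\<Sum>k=1..p-1. 1 / of_nat k + 1 / of_nat (p - k))"
    by (simp add: sum.distrib)
  also have "ord_ge p 1 \<dots>"
  proof (rule ord_ge_sum)
    fix k assume k: "k \<in> {1..p-1}"
    hence k': "0 < k" "k < p" "0 < p - k" "p - k < p" using p_ge_3 by auto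
    have "ord_ge p 1 (1 / of_nat k * (1 / of_nat (p - k)) * of_nat p)"
      by (intro ord_ge_mult_int ord_ge_inverse_nat ord_ge_p nat_dvd_not_less k')
    also have "1 / of_nat k * (1 / of_nat (p - k)) * of_nat p = 1 / of_nat k + (1 / of_nat (p - k) :: rat)"
    proof -
      have "1 / x * (1 / y) * (x + y) = 1 / x + 1 / y" if "x \<noteq> 0" "y \<noteq> 0" for x y :: rat
        using that by (simp add: field_simps)
      moreover have "(of_nat p :: rat) = of_nat k + of_nat (p - k)" using k' by (simp add: of_nat_diff)
      ultimately show ?thesis using k' by (metis of_nat_eq_0_iff less_numeral_extra(3))
    qed
    finally show "ord_ge p 1 (1 / of_nat k + 1 / of_nat (p - k))" .
  qed
  finally have "ord_ge p 1 (of_int 2 * unit_harmonic p)" by simp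
  hence "ord_ge p 1 (unit_harmonic p)"
    by (rule ord_ge_cancel_unit) (use p_ge_3 zdvd_not_zless[of 2 "int p"] in auto)
  hence "ord_ge p 1 ((unit_harmonic (p * c + p) - unit_harmonic (p * c) - unit_harmonic p) + unit_harmonic (p * c) + unit_harmonic p)"
    by (intro ord_ge_add unit_harmonic_shift Suc)
  thus ?case by (simp add: add.commute)
qed (simp add: unit_harmonic_def)

text \<open>Each shifted factor is \<open>k (1 + p c / k)\<close>. The first-order expansion has an
  error of order \<open>2 b\<close>, which is at least \<open>b + 1\<close>.\<close>

lemma unit_fact_shift:
  assumes "p ^ b dvd p * c" "b \<ge> 1"
  shows "ord_ge p (int b + 1) (of_nat (unit_fact (p * c + m))
     - of_nat (unit_fact (p * c)) * of_nat (unit_fact m) * (1 + of_nat (p * c) * unit_harmonic m))"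
proof -
  have "of_nat (unit_fact (p * c + m)) = of_nat (unit_fact (p * c)) * (\<Prod>k\<in>units_upto m. of_nat (p * c + k) :: rat)"
    unfolding unit_fact_eq_prod by (rule prod_units_upto_shift)
  also have "(\<Prod>k\<in>units_upto m. of_nat (p * c + k) :: rat) = (\<Prod>k\<in>units_upto m. of_nat k * (1 + of_nat (p * c) * (1 / of_nat k)))"
    by (intro prod.cong refl) (auto simp: units_upto_def field_simps)
  also have "\<dots> = of_nat (unit_fact m) * (\<Prod>k\<in>units_upto m. 1 + of_nat (p * c) * (1 / of_nat k))"
    unfolding unit_fact_eq_prod by (rule prod.distrib)
  finally have eq: "of_nat (unit_fact (p * c + m))
     - of_nat (unit_fact (p * c)) * of_nat (unit_fact m) * (1 + of_nat (p * c) * unit_harmonic m)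
     = of_nat (unit_fact (p * c)) * (of_nat (unit_fact m) * ((\<Prod>k\<in>units_upto m. 1 + of_nat (p * c) * (1 / of_nat k))
        - (1 + of_nat (p * c) * unit_harmonic m)))"
    by (simp only: right_diff_distrib mult.assoc)
  have "ord_ge p (int b) (of_nat (p * c))"
    using ord_ge_of_int_iff[of b "int (p * c)"] assms(1) by (metis of_int_of_nat_eq of_nat_dvd_iff of_nat_power)
  hence "ord_ge p (2 * int b) ((\<Prod>k\<in>units_upto m. 1 + of_nat (p * c) * (1 / of_nat k)) - (1 + of_nat (p * c) * unit_harmonic m))"
    unfolding unit_harmonic_def by (intro prod_one_plus_cong ord_ge_inverse_unit) auto
  hence "ord_ge p (int b + 1) ((\<Prod>k\<in>units_upto m. 1 + of_nat (p * c) * (1 / of_nat k)) - (1 + of_nat (p * c) * unit_harmonic m))"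
    by (rule ord_ge_mono) (use assms(2) in simp)
  thus ?thesis unfolding eq by (intro ord_ge_mult_int ord_ge_of_nat)
qed

lemma unit_fact_mod_p: "ord_ge p 1 (of_nat (unit_fact (p * c + m)) - of_nat (unit_fact (p * c)) * of_nat (unit_fact m))"
proof -
  have "ord_ge p 1 (of_nat (unit_fact (p * c + m)) - of_nat (unit_fact (p * c)) * of_nat (unit_fact m) * (1 + of_nat (p * c) * unit_harmonic m))"
    by (rule ord_ge_mono[OF unit_fact_shift[of 1]]) auto
  moreover have "ord_ge p 1 (of_nat (unit_fact (p * c)) * of_nat (unit_fact m) * (of_nat c * unit_harmonic m) * of_nat p)"
    by (intro ord_ge_mult_int ord_ge_of_nat ord_ge_p ord_ge_unit_harmonic)
  ultimately have "ord_ge p 1 ((of_nat (unit_fact (p * c + m)) - of_nat (unit_fact (p * c)) * of_nat (unit_fact m) * (1 + of_nat (p * c) * unit_harmonic m))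
      + of_nat (unit_fact (p * c)) * of_nat (unit_fact m) * (of_nat c * unit_harmonic m) * of_nat p)"
    by (rule ord_ge_add)
  thus ?thesis by (simp add: algebra_simps)
qed

lemma unit_fact_p: "ord_ge p 1 (of_nat (unit_fact p) + 1)"
proof -
  have "unit_fact p = fact (p - 1)" by (simp add: unit_fact_def units_upto_p fact_prod)
  moreover have "[fact (p - 1) = - 1] (mod int p)" using wilson_theorem[OF prime_p] by simp
  hence "ord_ge p (int 1) (of_int (fact (p - 1)) - of_int (- 1))"
    unfolding ord_ge_cong_int[symmetric] by simp
  ultimately show ?thesis by simp
qed

lemma unit_fact_p_mult_mod_p: "ord_ge p 1 (of_nat (unit_fact (p * c)) - (-1) ^ c)"
proof (induction c)
  case (Suc c)
  have "ord_ge p 1 (of_nat (unit_fact (p * c + p)) - of_nat (unit_fact (p * c)) * of_nat (unit_fact p))"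
    by (rule unit_fact_mod_p)
  moreover have "ord_ge p 1 (of_nat (unit_fact (p * c)) * of_nat (unit_fact p) - (-1) ^ c * (- 1))"
    using unit_fact_p Suc by (intro ord_ge_mult_diff) auto
  ultimately have "ord_ge p 1 ((of_nat (unit_fact (p * c + p)) - of_nat (unit_fact (p * c)) * of_nat (unit_fact p))
      + (of_nat (unit_fact (p * c)) * of_nat (unit_fact p) - (-1) ^ c * (- 1)))" by (rule ord_ge_add)
  thus ?case by (simp add: add.commute)
qed (simp add: unit_fact_def)

text \<open>Every block of length \<open>p^b\<close> contributes the same modulo
  \<open>p^(b + 1)\<close>: the first-order term is a multiple of \<open>p^b\<close> times a
  harmonic sum that is itself divisible by \<open>p\<close>.\<close>

lemma unit_fact_block:
  assumes "b \<ge> 1"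
  shows "ord_ge p (int b + 1) (of_nat (unit_fact (p ^ b * j)) - of_nat (unit_fact (p ^ b)) ^ j)"
proof (induction j)
  case (Suc j)
  define c where "c = p ^ (b - 1) * j"
  have pb: "p ^ b = p * p ^ (b - 1)" using assms by (cases b) auto
  have c: "p * c = p ^ b * j" by (simp add: c_def pb)
  have "ord_ge p (int b) (of_nat (p * c))"
    unfolding c using ord_ge_p_power[of b] by (simp add: ord_ge_int_mult)
  moreover have "ord_ge p 1 (unit_harmonic (p ^ b))" unfolding pb by (rule unit_harmonic_p_mult)
  ultimately have h: "ord_ge p (int b + 1) (of_nat (p * c) * unit_harmonic (p ^ b))" by (rule ord_ge_mult)
  have "ord_ge p (int b + 1) (of_nat (unit_fact (p * c + p ^ b))
     - of_nat (unit_fact (p * c)) * of_nat (unit_fact (p ^ b)) * (1 + of_nat (p * c) * unit_harmonic (p ^ b)))"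
    by (rule unit_fact_shift) (use assms c in auto)
  moreover have "ord_ge p (int b + 1) (of_nat (unit_fact (p * c)) * of_nat (unit_fact (p ^ b)) * (of_nat (p * c) * unit_harmonic (p ^ b)))"
    by (intro ord_ge_mult_int h ord_ge_of_nat)
  moreover have "ord_ge p (int b + 1) ((of_nat (unit_fact (p * c)) - of_nat (unit_fact (p ^ b)) ^ j) * of_nat (unit_fact (p ^ b)))"
    unfolding c by (intro ord_ge_int_mult Suc ord_ge_of_nat)
  ultimately have "ord_ge p (int b + 1) ((of_nat (unit_fact (p * c + p ^ b))
     - of_nat (unit_fact (p * c)) * of_nat (unit_fact (p ^ b)) * (1 + of_nat (p * c) * unit_harmonic (p ^ b)))
     + of_nat (unit_fact (p * c)) * of_nat (unit_fact (p ^ b)) * (of_nat (p * c) * unit_harmonic (p ^ b))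
     + (of_nat (unit_fact (p * c)) - of_nat (unit_fact (p ^ b)) ^ j) * of_nat (unit_fact (p ^ b)))"
    by (intro ord_ge_add)
  also have "\<dots> = of_nat (unit_fact (p * c + p ^ b)) - of_nat (unit_fact (p ^ b)) ^ Suc j"
    by (simp add: algebra_simps)
  also have "p * c + p ^ b = p ^ b * Suc j" by (simp add: c)
  finally show ?case .
qed (simp add: unit_fact_def)

lemma one_plus_power_cong:
  assumes "ord_ge p (int b) e" shows "ord_ge p (2 * int b) ((1 + e) ^ k - (1 + of_nat k * e))"
  using prod_one_plus_cong[of "{..<k}" "int b" e "\<lambda>_. 1"] assms by (simp add: mult.commute)

text \<open>Induction on \<open>b\<close>: an interval of length \<open>p^(b + 1)\<close> consists
  of \<open>p\<close> blocks, and raising \<open>- (1 + e)\<close> to the odd power \<open>p\<close>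
  turns the error \<open>e\<close> into \<open>p e\<close>, to first order.\<close>

lemma wilson_prime_power: "b \<ge> 1 \<Longrightarrow> ord_ge p (int b) (of_nat (unit_fact (p ^ b)) + 1)"
proof (induction b rule: nat_induct_at_least)
  case base
  show ?case using unit_fact_p by simp
next
  case (Suc b)
  define e where "e = - (of_nat (unit_fact (p ^ b)) + 1 :: rat)"
  have e: "ord_ge p (int b) e" unfolding e_def by (intro ord_ge_minus Suc)
  have "ord_ge p (2 * int b) ((1 + e) ^ p - (1 + of_nat p * e))" by (rule one_plus_power_cong[OF e])
  hence 1: "ord_ge p (int b + 1) ((1 + e) ^ p - (1 + of_nat p * e))"
    by (rule ord_ge_mono) (use Suc in simp)
  have "ord_ge p (1 + int b) (of_nat p * e)" by (intro ord_ge_mult ord_ge_p e)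
  hence 2: "ord_ge p (int b + 1) (of_nat p * e)" by (simp add: add.commute)
  have "ord_ge p (int b + 1) ((of_nat (unit_fact (p ^ b * p)) - of_nat (unit_fact (p ^ b)) ^ p)
     - (((1 + e) ^ p - (1 + of_nat p * e)) + of_nat p * e))"
    by (intro ord_ge_diff ord_ge_add unit_fact_block 1 2 Suc)
  also have "of_nat (unit_fact (p ^ b)) = - (1 + e)" by (simp add: e_def)
  also have "(- (1 + e)) ^ p = - ((1 + e) ^ p)" using odd_p by (rule power_minus_odd)
  finally show ?case by (simp add: algebra_simps)
qed

text \<open>The number of units is \<open>m - m div p\<close>, of the same parity as the
  exponent.\<close>

lemma prod_neg_one_units: "(\<Prod>k\<in>units_upto m. (-1 :: rat)) = (-1) ^ (m + m div p)"
proof (induction m)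
  case (Suc m)
  show ?case
  proof (cases "p dvd Suc m")
    case True
    hence "Suc m div p = Suc (m div p)" by (simp add: div_Suc dvd_eq_mod_eq_0)
    thus ?thesis using Suc True unfolding units_upto_Suc by simp
  next
    case False
    hence "Suc m div p = m div p" by (simp add: div_Suc dvd_eq_mod_eq_0)
    thus ?thesis using Suc False unfolding units_upto_Suc by simp
  qed
qed simp

lemma ord_ge_prod_diff:
  assumes "finite A" "\<And>k. k \<in> A \<Longrightarrow> ord_ge p 0 (f k)" "\<And>k. k \<in> A \<Longrightarrow> ord_ge p 0 (g k)" "\<And>k. k \<in> A \<Longrightarrow> ord_ge p e (f k - g k)"
  shows "ord_ge p e ((\<Prod>k\<in>A. f k) - (\<Prod>k\<in>A. g k))"
  using assms
proof (induction A rule: finite_induct)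
  case (insert k A)
  have "ord_ge p e (f k * (\<Prod>k\<in>A. f k) - g k * (\<Prod>k\<in>A. g k))"
    by (intro ord_ge_mult_diff ord_ge_prod insert) (use insert in auto)
  thus ?case using insert by simp
qed simp

text \<open>The reflection formula of the p-adic Gamma function: \<open>k \<mapsto> p^e - k\<close>
  exchanges the units between \<open>M'\<close> and \<open>p^e\<close> with those up to
  \<open>M\<close>, and Wilson's theorem modulo \<open>p^e\<close> evaluates the whole
  product.\<close>

lemma unit_fact_reflection:
  assumes "M + M' = p ^ e - 1" "e \<ge> 1"
  shows "ord_ge p (int e) (of_nat (unit_fact M') * ((-1) ^ (M + M div p) * of_nat (unit_fact M)) + 1)"
proof -
  have pe: "p ^ e > 0" "p dvd p ^ e" using assms by (auto simp: dvd_power)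
  have set: "units_upto (p ^ e) = units_upto M' \<union> (\<lambda>j. p ^ e - j) ` units_upto M" (is "?A = ?B")
  proof (intro equalityI subsetI)
    fix k assume k: "k \<in> ?A"
    show "k \<in> ?B"
    proof (cases "k \<le> M'")
      case False
      have kp: "k \<noteq> p ^ e" using k pe by (auto simp: units_upto_def)
      have k1: "k \<le> p ^ e" "1 \<le> k" "\<not> p dvd k" using k by (auto simp: units_upto_def)
      have "\<not> p dvd p ^ e - k" using k1 pe by (metis dvd_diffD1)
      hence "p ^ e - k \<in> units_upto M" using kp k1 False assms(1) by (auto simp: units_upto_def)
      moreover have "k = p ^ e - (p ^ e - k)" using k1 by simp
      ultimately show ?thesis by blast
    qed (use k in \<open>auto simp: units_upto_def\<close>)
  next
    fix k assume "k \<in> ?B"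
    thus "k \<in> ?A"
    proof
      assume "k \<in> units_upto M'" thus ?thesis using assms(1) by (auto simp: units_upto_def)
    next
      assume "k \<in> (\<lambda>j. p ^ e - j) ` units_upto M"
      then obtain j where j: "k = p ^ e - j" "1 \<le> j" "j \<le> M" "\<not> p dvd j" by (auto simp: units_upto_def)
      have "j < p ^ e" using j assms(1) pe by linarith
      moreover from this have "\<not> p dvd p ^ e - j" using j(4) pe by (metis dvd_diffD1 less_imp_le)
      ultimately show ?thesis using j by (auto simp: units_upto_def)
    qed
  qed
  have dis: "units_upto M' \<inter> (\<lambda>j. p ^ e - j) ` units_upto M = {}"
    using assms(1) pe by (auto simp: units_upto_def)
  have inj: "inj_on (\<lambda>j. p ^ e - j) (units_upto M)"
    using assms(1) by (auto simp: units_upto_def inj_on_def)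
  have "of_nat (unit_fact (p ^ e)) = of_nat (unit_fact M') * (\<Prod>j\<in>units_upto M. of_nat (p ^ e - j) :: rat)"
    unfolding unit_fact_eq_prod set by (subst prod.union_disjoint) (auto simp: dis prod.reindex[OF inj])
  also have "(\<Prod>j\<in>units_upto M. of_nat (p ^ e - j) :: rat) = (\<Prod>j\<in>units_upto M. of_nat p ^ e - of_nat j)"
    by (intro prod.cong refl) (use assms(1) in \<open>auto simp: units_upto_def of_nat_diff\<close>)
  finally have eq: "of_nat (unit_fact (p ^ e)) = of_nat (unit_fact M') * (\<Prod>j\<in>units_upto M. of_nat p ^ e - of_nat j :: rat)" .
  have "ord_ge p (int e) ((\<Prod>j\<in>units_upto M. of_nat p ^ e - of_nat j) - (\<Prod>j\<in>units_upto M. - 1 * of_nat j))"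
  proof (rule ord_ge_prod_diff)
    fix j
    show "ord_ge p 0 (of_nat p ^ e - of_nat j)" using ord_ge_of_int[of "int p ^ e - int j"] by simp
    show "ord_ge p 0 (- 1 * of_nat j)" by (intro ord_ge_mult_int) auto
    show "ord_ge p (int e) (of_nat p ^ e - of_nat j - - 1 * of_nat j)" using ord_ge_p_power by simp
  qed simp
  also have "(\<Prod>j\<in>units_upto M. - 1 * of_nat j) = (-1) ^ (M + M div p) * (of_nat (unit_fact M) :: rat)"
    unfolding prod.distrib prod_neg_one_units unit_fact_eq_prod ..
  finally have "ord_ge p (int e) (of_nat (unit_fact M') * ((\<Prod>j\<in>units_upto M. of_nat p ^ e - of_nat j) - (-1) ^ (M + M div p) * of_nat (unit_fact M)))"
    by (intro ord_ge_mult_int ord_ge_of_nat)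
  hence "ord_ge p (int e) ((of_nat (unit_fact (p ^ e)) + 1) - of_nat (unit_fact M') * ((\<Prod>j\<in>units_upto M. of_nat p ^ e - of_nat j) - (-1) ^ (M + M div p) * of_nat (unit_fact M)))"
    by (intro ord_ge_diff wilson_prime_power assms)
  thus ?thesis unfolding eq by (simp add: algebra_simps)
qed

end

section \<open>Bernoulli numbers and the Wilson quotient\<close>

lemma bernoulli_fps_0 [simp]: "bernoulli_fps $ 0 = 1" and bernoulli_fps_1: "bernoulli_fps $ 1 = - 1 / 2"
proof -
  have "(bernoulli_fps * fps_expm1_div_X) $ 0 = 1" "(bernoulli_fps * fps_expm1_div_X) $ 1 = 0"
    unfolding bernoulli_fps_mult by simp_all
  thus "bernoulli_fps $ 0 = 1" "bernoulli_fps $ 1 = - 1 / 2"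
    by (simp_all add: fps_mult_nth expm1_div_X_nth)
qed

text \<open>Coefficient of \<open>x^(n + 1)\<close> in
  \<open>x * (\<Sum>k<m. e^(k x)) = (e^(m x) - 1) * x / (e^x - 1)\<close>. For \<open>n = 0\<close>
  the summand \<open>0^0 = 1\<close> is counted.\<close>

lemma faulhaber:
  "(\<Sum>k<m. of_nat k ^ n) = (\<Sum>j\<le>n. of_nat (n choose j) * bernoulli (n - j) * of_nat m ^ (j + 1) / of_nat (j + 1))"
proof -
  have "(\<Sum>k<m. fps_exp 1 ^ k) * (fps_exp 1 - 1) = (fps_exp 1 ^ m - 1 :: rat fps)"
    by (simp only: power_diff_1_eq mult.commute)
  hence "fps_expm1_div_X * (fps_X * (\<Sum>k<m. fps_exp (of_nat k))) = (fps_exp (of_nat m) - 1 :: rat fps)"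
    unfolding fps_exp_power_mult X_mult_expm1_div_X[symmetric] by (simp add: mult_ac)
  hence "bernoulli_fps * fps_expm1_div_X * (fps_X * (\<Sum>k<m. fps_exp (of_nat k))) = bernoulli_fps * (fps_exp (of_nat m) - 1)"
    by (simp only: mult.assoc)
  hence eq: "fps_X * (\<Sum>k<m. fps_exp (of_nat k)) = (fps_exp (of_nat m) - 1) * bernoulli_fps"
    unfolding bernoulli_fps_mult by (simp add: mult.commute)
  have "(\<Sum>k<m. of_nat k ^ n) / fact n = ((fps_X * (\<Sum>k<m. fps_exp (of_nat k))) $ Suc n :: rat)"
    by (simp add: fps_sum_nth sum_divide_distrib)
  also have "\<dots> = (\<Sum>i=0..Suc n. (fps_exp (of_nat m) - 1) $ i * bernoulli_fps $ (Suc n - i))"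
    unfolding eq by (rule fps_mult_nth)
  also have "\<dots> = (\<Sum>i=1..Suc n. (fps_exp (of_nat m) - 1) $ i * bernoulli_fps $ (Suc n - i))"
    by (simp add: sum.atLeast_Suc_atMost)
  also have "\<dots> = (\<Sum>j\<le>n. of_nat m ^ (j + 1) / fact (j + 1) * bernoulli_fps $ (n - j))"
    by (rule sum.reindex_bij_witness[of _ "\<lambda>j. j + 1" "\<lambda>i. i - 1"]) auto
  finally have e: "(\<Sum>k<m. of_nat k ^ n) / fact n = (\<Sum>j\<le>n. of_nat m ^ (j + 1) / fact (j + 1) * bernoulli_fps $ (n - j))" .
  have "(\<Sum>k<m. of_nat k ^ n) = fact n * ((\<Sum>k<m. of_nat k ^ n) / fact n :: rat)" by simp
  also have "\<dots> = (\<Sum>j\<le>n. fact n * (of_nat m ^ (j + 1) / fact (j + 1) * bernoulli_fps $ (n - j)))"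
    unfolding e by (rule sum_distrib_left)
  also have "\<dots> = (\<Sum>j\<le>n. of_nat (n choose j) * bernoulli (n - j) * of_nat m ^ (j + 1) / of_nat (j + 1))"
  proof (intro sum.cong refl)
    fix j assume "j \<in> {..n}"
    hence "(of_nat (n choose j) :: rat) = fact n / (fact j * fact (n - j))" by (intro binomial_fact) auto
    thus "fact n * (of_nat m ^ (j + 1) / fact (j + 1) * bernoulli_fps $ (n - j))
       = of_nat (n choose j) * bernoulli (n - j) * of_nat m ^ (j + 1) / (of_nat (j + 1) :: rat)"
      unfolding bernoulli_fps_nth by (simp add: mult_ac del: of_nat_Suc)
  qed
  finally show ?thesis .
qed

context odd_prime
begin

lemma bernoulli_integral:
  assumes "k < p - 1" shows "ord_ge p 0 (bernoulli k)"
proof -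
  consider "k = 0" | "k = 1" | "k \<ge> 2" by linarith
  thus ?thesis
  proof cases
    case 1
    thus ?thesis using bernoulli_fps_0 by (simp add: bernoulli_fps_nth del: bernoulli_fps_0)
  next
    case 2
    hence "bernoulli k = - (1 / 2 ^ 1)" using bernoulli_fps_1 by (simp add: bernoulli_fps_nth)
    thus ?thesis using ord_ge_minus[OF ord_ge_half_power[of 1]] by simp
  next
    case 3
    have "ord_ge p 0 (of_nat (k * fact k) * log_coeff k)"
      by (intro ord_ge_mult_int ord_ge_of_nat ord_ge_log_coeff_integral) (use 3 assms in auto)
    moreover have "of_nat (k * fact k) * log_coeff k = bernoulli k" using 3 by (simp add: log_coeff_def)
    ultimately show ?thesis by simp
  qed
qed

text \<open>The weak half of von Staudt--Clausen, by solving Faulhaber's formula with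
  \<open>m = p\<close> for its term \<open>j = 0\<close>. For \<open>j \<ge> 1\<close> the power
  \<open>p^j\<close> absorbs the denominator \<open>j + 1\<close>.\<close>

lemma p_bernoulli_integral: "ord_ge p 0 (of_nat p * bernoulli n)"
proof (induction n rule: less_induct)
  case (less n)
  have "(\<Sum>k<p. of_nat k ^ n) = of_nat p * bernoulli n
      + (\<Sum>j=1..n. of_nat (n choose j) * bernoulli (n - j) * of_nat p ^ (j + 1) / of_nat (j + 1))"
    unfolding faulhaber by (simp add: atMost_atLeast0 sum.atLeast_Suc_atMost)
  hence "of_nat p * bernoulli n = of_nat (\<Sum>k<p. k ^ n)
      - (\<Sum>j=1..n. of_nat (n choose j) * bernoulli (n - j) * of_nat p ^ (j + 1) / of_nat (j + 1))"
    by simp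
  also have "ord_ge p 0 \<dots>"
  proof (intro ord_ge_diff ord_ge_of_nat ord_ge_sum)
    fix j assume j: "j \<in> {1..n}"
    have "ord_ge p (0 + (int j + - int (j + 1 - 2))) (of_nat (n choose j) * (of_nat p * bernoulli (n - j)) * (of_nat p ^ j * (1 / of_nat (j + 1))))"
      by (intro ord_ge_mult ord_ge_mult_int ord_ge_of_nat less ord_ge_p_power ord_ge_inverse_ge_2) (use j in auto)
    hence "ord_ge p 0 (of_nat (n choose j) * (of_nat p * bernoulli (n - j)) * (of_nat p ^ j * (1 / of_nat (j + 1))))"
      by (rule ord_ge_mono) simp
    thus "ord_ge p 0 (of_nat (n choose j) * bernoulli (n - j) * of_nat p ^ (j + 1) / of_nat (j + 1))"
      by (simp add: mult_ac)
  qed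
  finally show ?case .
qed

lemma ord_ge_bernoulli: "ord_ge p (- 1) (bernoulli n)"
proof -
  have "ord_ge p (- 1 + 0) (of_nat p powi (- 1) * (of_nat p * bernoulli n))"
    by (intro ord_ge_mult ord_ge_p_powi p_bernoulli_integral)
  thus ?thesis by (simp add: power_int_minus flip: mult.assoc)
qed

section \<open>Power sums over the units modulo p^b\<close>

lemma totient_p_power: "b \<ge> 1 \<Longrightarrow> totient (p ^ b) = p ^ (b - 1) * (p - 1)"
  using prime_p by (intro totient_prime_power) auto

lemma card_units_upto: "b \<ge> 1 \<Longrightarrow> card (units_upto (p ^ b)) = totient (p ^ b)"
proof -
  assume b: "b \<ge> 1"
  have "units_upto (p ^ b) = totatives (p ^ b)"
    using b prime_p prime_imp_coprime[of p]
    by (auto simp: units_upto_def totatives_def coprime_commute coprime_absorb_left)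
  thus ?thesis by (simp add: totient_def)
qed

text \<open>In Faulhaber's formula only \<open>j = 0\<close> survives modulo \<open>p^(2 b)\<close>.
  The narrow cases are \<open>b = 1\<close>, where the other Bernoulli numbers have index below
  \<open>p - 1\<close> and are integral, and \<open>j = 1\<close>, where the binomial coefficient is
  \<open>totient (p ^ b)\<close> and supplies \<open>p^(b - 1)\<close>.\<close>

lemma power_sum_cong:
  assumes b: "b \<ge> 1"
  shows "ord_ge p (2 * int b) ((\<Sum>k<p^b. of_nat k ^ totient (p ^ b)) - of_nat p ^ b * bernoulli (totient (p ^ b)))"
proof -
  let ?t = "totient (p ^ b)"
  have "(\<Sum>k<p^b. of_nat k ^ ?t) = of_nat p ^ b * bernoulli ?t
      + (\<Sum>j=1..?t. of_nat (?t choose j) * bernoulli (?t - j) * of_nat (p ^ b) ^ (j + 1) / of_nat (j + 1))"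
    unfolding faulhaber by (simp add: atMost_atLeast0 sum.atLeast_Suc_atMost)
  hence eq: "(\<Sum>k<p^b. of_nat k ^ ?t) - of_nat p ^ b * bernoulli ?t =
     (\<Sum>j=1..?t. of_nat (?t choose j) * bernoulli (?t - j) * of_nat (p ^ b) ^ (j + 1) / of_nat (j + 1))" by simp
  show ?thesis unfolding eq
  proof (rule ord_ge_sum)
    fix j assume j: "j \<in> {1..?t}"
    have split: "of_nat (?t choose j) * bernoulli (?t - j) * of_nat (p ^ b) ^ (j + 1) / of_nat (j + 1)
       = of_nat (?t choose j) * bernoulli (?t - j) * (of_nat p ^ (b * (j + 1)) * (1 / of_nat (j + 1)))"
      by (simp add: power_mult power_add)
    have base: "ord_ge p (int (b * (j + 1)) + - int (j + 1 - 2)) (of_nat p ^ (b * (j + 1)) * (1 / of_nat (j + 1)))"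
      by (intro ord_ge_mult ord_ge_p_power ord_ge_inverse_ge_2) (use j in auto)
    have j1: "int (j + 1 - 2) = int j - 1" using j by auto
    show "ord_ge p (2 * int b) (of_nat (?t choose j) * bernoulli (?t - j) * of_nat (p ^ b) ^ (j + 1) / of_nat (j + 1))"
      unfolding split
    proof (cases "b = 1")
      case True
      have "?t - j < p - 1" using j True totient_p_power[OF b] by auto
      hence "ord_ge p (0 + (int (b * (j + 1)) + - int (j + 1 - 2))) (of_nat (?t choose j) * bernoulli (?t - j) * (of_nat p ^ (b * (j + 1)) * (1 / of_nat (j + 1))))"
        by (intro ord_ge_mult base ord_ge_mult_int ord_ge_of_nat bernoulli_integral)
      thus "ord_ge p (2 * int b) (of_nat (?t choose j) * bernoulli (?t - j) * (of_nat p ^ (b * (j + 1)) * (1 / of_nat (j + 1))))"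
        by (rule ord_ge_mono) (use True j1 in simp)
    next
      case False
      hence b2: "b \<ge> 2" using b by simp
      show "ord_ge p (2 * int b) (of_nat (?t choose j) * bernoulli (?t - j) * (of_nat p ^ (b * (j + 1)) * (1 / of_nat (j + 1))))"
      proof (cases "j = 1")
        case True
        have "of_nat (?t choose j) = (of_nat (p - 1) * of_nat p ^ (b - 1) :: rat)"
          using True totient_p_power[OF b] by simp
        hence "ord_ge p (int (b - 1)) (of_nat (?t choose j))"
          by (simp only:) (intro ord_ge_mult_int ord_ge_of_nat ord_ge_p_power)
        hence "ord_ge p (int (b - 1) + (- 1) + (int (b * (j + 1)) + - int (j + 1 - 2))) (of_nat (?t choose j) * bernoulli (?t - j) * (of_nat p ^ (b * (j + 1)) * (1 / of_nat (j + 1))))"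
          by (intro ord_ge_mult[OF _ base] ord_ge_mult ord_ge_bernoulli)
        thus ?thesis by (rule ord_ge_mono) (use True b2 in simp)
      next
        case False
        hence j2: "j \<ge> 2" using j by auto
        have "ord_ge p (- 1 + (int (b * (j + 1)) + - int (j + 1 - 2))) (of_nat (?t choose j) * bernoulli (?t - j) * (of_nat p ^ (b * (j + 1)) * (1 / of_nat (j + 1))))"
          by (intro ord_ge_mult[OF _ base] ord_ge_mult_int ord_ge_of_nat ord_ge_bernoulli)
        thus ?thesis
        proof (rule ord_ge_mono)
          have "1 * 1 \<le> (int b - 1) * (int j - 1)" using b2 j2 by (intro mult_mono) auto
          hence "2 * int b \<le> - 1 + (int b * (int j + 1) + - (int j - 1))" by (simp add: algebra_simps)
          thus "2 * int b \<le> - 1 + (int (b * (j + 1)) + - int (j + 1 - 2))" unfolding j1 by (simp add: distrib_left)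
        qed
      qed
    qed
  qed
qed

text \<open>A multiple of \<open>p\<close> contributes at least \<open>totient (p ^ b)\<close>
  powers of \<open>p\<close>, and this exponent is at least \<open>2 b\<close>.\<close>

lemma power_sum_units_cong:
  assumes b: "b \<ge> 1"
  shows "ord_ge p (2 * int b) ((\<Sum>k<p^b. of_nat k ^ totient (p ^ b)) - (\<Sum>k\<in>units_upto (p ^ b). of_nat k ^ totient (p ^ b)))"
proof -
  let ?t = "totient (p ^ b)"
  have "b - 1 < p ^ (b - 1)" using p_ge_3 by (intro power_gt_expt) auto
  hence "2 * b \<le> p ^ (b - 1) * 2" by simp
  also have "\<dots> \<le> p ^ (b - 1) * (p - 1)" using p_ge_3 by (intro mult_left_mono) auto
  finally have t: "2 * b \<le> ?t" using totient_p_power[OF b] by simp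
  have sub: "units_upto (p ^ b) \<subseteq> {..<p ^ b}"
  proof
    fix k assume k: "k \<in> units_upto (p ^ b)"
    hence "k \<noteq> p ^ b" using b by (auto simp: units_upto_def dvd_power)
    thus "k \<in> {..<p ^ b}" using k by (auto simp: units_upto_def)
  qed
  have "(\<Sum>k<p^b. of_nat k ^ ?t) = (\<Sum>k\<in>{..<p ^ b} - units_upto (p ^ b). of_nat k ^ ?t) + (\<Sum>k\<in>units_upto (p ^ b). of_nat k ^ ?t :: rat)"
    by (rule sum.subset_diff[OF sub]) simp
  moreover have "ord_ge p (2 * int b) (\<Sum>k\<in>{..<p ^ b} - units_upto (p ^ b). of_nat k ^ ?t)"
  proof (rule ord_ge_sum)
    fix k assume k: "k \<in> {..<p ^ b} - units_upto (p ^ b)"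
    hence "p dvd k" by (cases "k = 0") (auto simp: units_upto_def)
    then obtain c where c: "k = p * c" by blast
    have "ord_ge p (int ?t) (of_nat (c ^ ?t) * of_nat p ^ ?t)"
      by (intro ord_ge_mult_int ord_ge_of_nat ord_ge_p_power)
    hence "ord_ge p (int ?t) (of_nat k ^ ?t)" by (simp add: c power_mult_distrib mult.commute)
    thus "ord_ge p (2 * int b) (of_nat k ^ ?t)" by (rule ord_ge_mono) (use t in linarith)
  qed
  ultimately show ?thesis by simp
qed

text \<open>The power of the unit product with exponent \<open>t = totient (p ^ b)\<close> is
  expanded to first order in two ways: through the Euler quotients of its factors, and through its
  deviation \<open>e\<close> from Wilson's theorem. The power sums bring in \<open>B_t\<close>. For
  \<open>b = 1\<close> this is Glaisher's congruence for \<open>(p - 1)!\<close> modulo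
  \<open>p^2\<close>.\<close>

lemma bernoulli_wilson:
  assumes b: "b \<ge> 1"
  shows "ord_ge p (int b + 1) (of_nat p * bernoulli (totient (p ^ b)) - of_nat (unit_fact (p ^ b)) - of_nat p)"
proof -
  let ?t = "totient (p ^ b)" and ?U = "units_upto (p ^ b)"
  let ?P = "of_nat (unit_fact (p ^ b)) :: rat"
  define pb where "pb = (of_nat p ^ b :: rat)"
  have pb: "ord_ge p (int b) pb" "pb \<noteq> 0" unfolding pb_def by (simp_all add: ord_ge_p_power)
  define Q where "Q k = (of_nat k ^ ?t - 1) / pb" for k :: nat
  have euler: "ord_ge p (int b) (of_nat k ^ ?t - 1)" if "k \<in> ?U" for k
  proof -
    have "coprime k (p ^ b)" using that prime_p prime_imp_coprime[of p k] by (auto simp: units_upto_def coprime_commute)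
    hence "[int k ^ ?t = 1] (mod int (p ^ b))" using b by (intro euler_theorem_int) (auto simp: coprime_int_iff)
    thus ?thesis using ord_ge_cong_int[of "int k ^ ?t" 1 b] by simp
  qed
  have Qint: "ord_ge p 0 (Q k)" if "k \<in> ?U" for k
    using euler[OF that] unfolding Q_def ord_ge_def pb_def by simp
  have Q: "of_nat k ^ ?t = 1 + pb * Q k" for k using pb by (simp add: Q_def)
  have "?P ^ ?t = (\<Prod>k\<in>?U. of_nat k ^ ?t)" unfolding unit_fact_eq_prod by (rule prod_power_distrib)
  also have "\<dots> = (\<Prod>k\<in>?U. 1 + pb * Q k)" by (simp only: Q)
  finally have P1: "?P ^ ?t = (\<Prod>k\<in>?U. 1 + pb * Q k)" .
  have c1: "ord_ge p (2 * int b) ((\<Prod>k\<in>?U. 1 + pb * Q k) - (1 + pb * (\<Sum>k\<in>?U. Q k)))"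
    by (intro prod_one_plus_cong pb Qint) auto
  define e where "e = - (?P + 1)"
  have e: "ord_ge p (int b) e" unfolding e_def by (intro ord_ge_minus wilson_prime_power b)
  have "even ?t" using totient_p_power[OF b] odd_p p_ge_3 by simp
  hence "?P ^ ?t = (- ?P) ^ ?t" by simp
  hence P2: "?P ^ ?t = (1 + e) ^ ?t" by (simp add: e_def)
  have c2: "ord_ge p (2 * int b) ((1 + e) ^ ?t - (1 + of_nat ?t * e))" by (rule one_plus_power_cong[OF e])
  have sumU: "(\<Sum>k\<in>?U. of_nat k ^ ?t) = of_nat ?t + pb * (\<Sum>k\<in>?U. Q k)"
    unfolding Q sum.distrib sum_distrib_left by (simp add: card_units_upto[OF b])
  have "ord_ge p (2 * int b) (((1 + e) ^ ?t - (1 + of_nat ?t * e)) - ((\<Prod>k\<in>?U. 1 + pb * Q k) - (1 + pb * (\<Sum>k\<in>?U. Q k)))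
     + ((\<Sum>k<p^b. of_nat k ^ ?t) - (\<Sum>k\<in>?U. of_nat k ^ ?t)) - ((\<Sum>k<p^b. of_nat k ^ ?t) - of_nat p ^ b * bernoulli ?t))"
    by (intro ord_ge_add ord_ge_diff c1 c2 power_sum_units_cong power_sum_cong b)
  also have "\<dots> = pb * bernoulli ?t - of_nat ?t * (1 + e)"
    unfolding P1[symmetric] P2[symmetric] sumU pb_def[symmetric] by (simp add: algebra_simps)
  also have "\<dots> = of_nat p ^ (b - 1) * (of_nat p * bernoulli ?t + of_nat (p - 1) * ?P)"
  proof -
    have "pb = of_nat p ^ (b - 1) * of_nat p" unfolding pb_def using b by (cases b) auto
    moreover have "(of_nat ?t :: rat) = of_nat p ^ (b - 1) * of_nat (p - 1)"
      unfolding totient_p_power[OF b] by simp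
    moreover have "1 + e = - ?P" by (simp add: e_def)
    ultimately show ?thesis by (simp only: distrib_left mult.assoc mult_minus_right diff_minus_eq_add)
  qed
  \<comment> \<open>Cancelling the common factor \<open>p^(b - 1)\<close> lowers the precision from
    \<open>2 b\<close> to exactly \<open>b + 1\<close>.\<close>
  finally have "ord_ge p (int b + 1 + int (b - 1)) (of_nat p ^ (b - 1) * (of_nat p * bernoulli ?t + of_nat (p - 1) * ?P))"
    by (rule ord_ge_mono) (use b in simp)
  hence 1: "ord_ge p (int b + 1) (of_nat p * bernoulli ?t + of_nat (p - 1) * ?P)" by (rule ord_ge_cancel_p_power)
  \<comment> \<open>Since \<open>?P\<close> is -1 modulo \<open>p^b\<close>,
    \<open>(p - 1) * ?P\<close> may be replaced by \<open>- p - ?P\<close> modulo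
    \<open>p^(b + 1)\<close>.\<close>
  have "ord_ge p (int b + 1) (of_nat p * e)" using ord_ge_mult[OF ord_ge_p e] by (simp add: add.commute)
  hence "ord_ge p (int b + 1) ((of_nat p * bernoulli ?t + of_nat (p - 1) * ?P) + of_nat p * e)"
    by (intro ord_ge_add 1)
  thus ?thesis using p_ge_3 by (simp add: e_def of_nat_diff algebra_simps)
qed

section \<open>The main congruence\<close>

text \<open>This is \<open>1 + p + ... + p^(b - 1)\<close>, the truncation of
  \<open>1 / (1 - p)\<close>: multiplied by \<open>s'\<close> it approximates the solution
  \<open>K\<close> of \<open>s' + (p - 1) K = 0\<close>.\<close>

definition repunit :: "nat \<Rightarrow> nat" where
  "repunit b = (p ^ b - 1) div (p - 1)"

lemma repunit_mult: "(p - 1) * repunit b + 1 = p ^ b"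
proof -
  have "(p - 1) dvd (p ^ b - 1)"
  proof -
    have "int p - 1 dvd int p ^ b - 1" using power_diff_1_eq[of "int p" b] by simp
    hence "int (p - 1) dvd int (p ^ b - 1)" by (simp add: of_nat_diff Suc_leI)
    thus ?thesis by (simp only: of_nat_dvd_iff)
  qed
  thus ?thesis by (simp add: repunit_def)
qed

lemma repunit_Suc: "repunit (Suc b) = p * repunit b + 1"
proof -
  have "(p - 1) * repunit (Suc b) + 1 = (p - 1) * (p * repunit b + 1) + 1"
  proof -
    have "(p - 1) * (p * repunit b + 1) + 1 = p * ((p - 1) * repunit b) + ((p - 1) + 1)" by (simp add: algebra_simps)
    also have "\<dots> = p * ((p - 1) * repunit b + 1)" using p_ge_3 by simp
    also have "\<dots> = (p - 1) * repunit (Suc b) + 1" unfolding repunit_mult by simp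
    finally show ?thesis ..
  qed
  hence "(p - 1) * repunit (Suc b) = (p - 1) * (p * repunit b + 1)" by (simp only: add_right_cancel)
  moreover have "p - 1 \<noteq> 0" using p_ge_3 by simp
  ultimately show ?thesis by (metis mult_left_cancel)
qed

lemma repunit_0 [simp]: "repunit 0 = 0"
  by (simp add: repunit_def)

lemma even_repunit: "even (repunit b) \<longleftrightarrow> even b"
  by (induction b) (use odd_p in \<open>auto simp: repunit_Suc\<close>)

lemma pos_residue_eq:
  assumes "\<not> (p - 1) dvd n" shows "pos_residue p n = n mod (p - 1)"
  unfolding pos_residue_def
proof (rule Least_equality)
  show "0 < n mod (p - 1) \<and> [n mod (p - 1) = n] (mod (p - 1))"
    using assms by (auto simp: cong_def dvd_eq_mod_eq_0)
  fix m assume "0 < m \<and> [m = n] (mod (p - 1))"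
  thus "n mod (p - 1) \<le> m" by (metis cong_def mod_less_eq_dividend)
qed

lemma ord_ge_of_nat_dvd: "p ^ b dvd m \<Longrightarrow> ord_ge p (int b) (of_nat m)"
  using ord_ge_of_int_iff[of b "int m"] by (metis of_int_of_nat_eq of_nat_dvd_iff of_nat_power)

lemma fermat_ord_ge:
  assumes "\<not> int p dvd r" shows "ord_ge p 1 (of_int r ^ (p - 1) - 1)"
proof -
  have "[r ^ totient p = 1] (mod int p)"
    using assms prime_imp_coprime[OF prime_int_p] by (intro euler_theorem_int) (auto simp: coprime_commute)
  thus ?thesis using ord_ge_cong_int[of "r ^ (p - 1)" 1 1] prime_p by (simp add: totient_prime)
qed

lemma one_plus_triple_cong:
  assumes "ord_ge p (int b) x" "ord_ge p (int b) y" "ord_ge p (int b) z" "b \<ge> 1"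
  shows "ord_ge p (int b + 1) ((1 + x) * (1 + y) * (1 + z) - (1 + (x + y + z)))"
proof -
  have i: "ord_ge p 0 x" "ord_ge p 0 y" "ord_ge p 0 z" using assms ord_ge_mono by (meson of_nat_0_le_iff)+
  have "ord_ge p (int b + int b) (x * y + x * z + y * z + x * y * z)"
    by (intro ord_ge_add ord_ge_mult assms ord_ge_int_mult i)
  hence "ord_ge p (int b + 1) (x * y + x * z + y * z + x * y * z)" by (rule ord_ge_mono) (use assms in simp)
  thus ?thesis by (simp add: algebra_simps)
qed

text \<open>With \<open>r^(p - 1) = 1 + e\<close> the power is \<open>(1 + e)^c\<close>, to first
  order \<open>1 + c e\<close>. As \<open>(p - 1) (c + n) = p n + p^b s\<close>, \<open>c\<close> is
  \<open>- n\<close> modulo \<open>p^b\<close>; this is the source of the minus sign.\<close>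

lemma power_residue_cong:
  assumes r: "\<not> int p dvd r" and b: "p ^ (b - 1) dvd n" "b \<ge> 1" and c: "(p - 1) * c = n + p ^ b * s"
  shows "ord_ge p (int b + 1) (of_int r ^ (n + p ^ b * s) - (1 - of_nat n * (of_int r ^ (p - 1) - 1)))"
proof -
  define e where "e = of_int r ^ (p - 1) - (1::rat)"
  have e: "ord_ge p 1 e" unfolding e_def by (rule fermat_ord_ge[OF r])
  have cop: "coprime (p - 1) (p ^ k)" for k
    using coprime_diff_one_left_nat[of p] by simp
  have "p ^ (b - 1) dvd p ^ b * s" by (simp add: le_imp_power_dvd)
  hence "p ^ (b - 1) dvd (p - 1) * c" unfolding c using b by simp
  hence "p ^ (b - 1) dvd c" using cop coprime_dvd_mult_right_iff[of "p ^ (b - 1)" "p - 1" c] coprime_commute by blast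
  hence 1: "ord_ge p (int b + 1) ((1 + e) ^ c - 1 - of_nat c * e)"
    by (intro one_plus_power_lift e b)
  have "(p - 1) * (c + n) = p * n + p ^ b * s"
  proof -
    have "(p - 1) * (c + n) = n + p ^ b * s + (p - 1) * n" by (simp only: distrib_left c)
    also have "\<dots> = p * n + p ^ b * s" using p_ge_3 by (cases p) auto
    finally show ?thesis .
  qed
  moreover have "p ^ b dvd p * n" using b by (cases b) auto
  ultimately have "p ^ b dvd (p - 1) * (c + n)" by simp
  hence "p ^ b dvd c + n" using cop coprime_dvd_mult_right_iff[of "p ^ b" "p - 1" "c + n"] coprime_commute by blast
  hence 2: "ord_ge p (int b + 1) (of_nat (c + n) * e)" by (intro ord_ge_mult ord_ge_of_nat_dvd e)
  have "of_int r ^ (n + p ^ b * s) = (1 + e) ^ c" unfolding c[symmetric] e_def power_mult by simp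
  moreover have "ord_ge p (int b + 1) (((1 + e) ^ c - 1 - of_nat c * e) + of_nat (c + n) * e)"
    by (intro ord_ge_add 1 2)
  ultimately show ?thesis unfolding e_def[symmetric] by (simp add: algebra_simps)
qed

text \<open>Since \<open>p * repunit b + 1 = p^b + repunit b\<close>, the argument is
  \<open>s\<close> blocks of length \<open>p^b\<close> followed by \<open>repunit b * s\<close>
  more. The blocks contribute \<open>(- (1 + w))^s\<close> and the shift a harmonic sum, whose
  argument matters only through its last base-p digit \<open>s\<close>.\<close>

lemma unit_fact_repunit_cong:
  assumes b: "b \<ge> 1" and s: "s < p"
  defines "w \<equiv> - (of_nat (unit_fact (p ^ b)) + 1 :: rat)"
  shows "ord_ge p (int b + 1) (of_nat (unit_fact (p * (repunit b * s) + s))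
     - (-1) ^ s * of_nat (unit_fact (repunit b * s)) * ((1 + of_nat s * w) * (1 + of_nat p ^ b * of_nat s * harmonic s)))"
proof -
  let ?u = "repunit b"
  obtain b0 where b0: "b = Suc b0" using b by (cases b) auto
  have w: "ord_ge p (int b) w" unfolding w_def by (intro ord_ge_minus wilson_prime_power b)
  define c where "c = p ^ b0 * s"
  have pc: "p * c = p ^ b * s" by (simp add: c_def b0)
  have M: "p * (?u * s) + s = p * c + ?u * s"
  proof -
    have "p * (?u * s) + s = ((p - 1) * ?u + 1) * s + ?u * s" using p_ge_3 by (cases p) (auto simp: algebra_simps)
    thus ?thesis unfolding repunit_mult pc .
  qed
  have us: "?u * s = p * (repunit b0 * s) + s" unfolding b0 repunit_Suc by (simp add: algebra_simps)
  have hs: "unit_harmonic s = harmonic s"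
    using units_upto_less_p[OF s] by (simp add: unit_harmonic_def harmonic_def atLeastSucAtMost_greaterThanAtMost)
  have "ord_ge p 1 ((unit_harmonic (p * (repunit b0 * s) + s) - unit_harmonic (p * (repunit b0 * s)) - unit_harmonic s) + unit_harmonic (p * (repunit b0 * s)))"
    by (intro ord_ge_add unit_harmonic_shift unit_harmonic_p_mult)
  hence "ord_ge p 1 (unit_harmonic (?u * s) - harmonic s)" unfolding us hs by (simp add: algebra_simps)
  moreover have "ord_ge p (int b) (of_nat (p * c))" unfolding pc by (intro ord_ge_of_nat_dvd) simp
  ultimately have h: "ord_ge p (int b + 1) (of_nat (p * c) * (unit_harmonic (?u * s) - harmonic s))" by (intro ord_ge_mult)
  have H0: "ord_ge p 0 (harmonic s)" using ord_ge_unit_harmonic[of s] unfolding hs .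
  let ?U = "of_nat (unit_fact (?u * s)) :: rat" and ?V = "of_nat (unit_fact (p * c)) :: rat"
  have 1: "ord_ge p (int b + 1) (of_nat (unit_fact (p * c + ?u * s)) - ?V * ?U * (1 + of_nat (p * c) * unit_harmonic (?u * s)))"
    by (rule unit_fact_shift) (use b pc in auto)
  have 2: "ord_ge p (int b + 1) (?V * ?U * (of_nat (p * c) * (unit_harmonic (?u * s) - harmonic s)))"
    by (intro ord_ge_mult_int h ord_ge_of_nat)
  have "ord_ge p (int b + 1) (?V - of_nat (unit_fact (p ^ b)) ^ s)"
    unfolding pc by (rule unit_fact_block[OF b])
  moreover have "ord_ge p (int b + 1) ((1 + w) ^ s - (1 + of_nat s * w))"
    by (rule ord_ge_mono[OF one_plus_power_cong[OF w]]) (use b in simp)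
  hence "ord_ge p (int b + 1) ((-1) ^ s * ((1 + w) ^ s - (1 + of_nat s * w)))"
    by (intro ord_ge_mult_int ord_ge_power ord_ge_neg_1)
  moreover have "of_nat (unit_fact (p ^ b)) ^ s = (-1) ^ s * (1 + w) ^ s"
    unfolding power_mult_distrib[symmetric] by (simp add: w_def)
  ultimately have V: "ord_ge p (int b + 1) ((?V - of_nat (unit_fact (p ^ b)) ^ s) + (of_nat (unit_fact (p ^ b)) ^ s - (-1) ^ s * (1 + of_nat s * w)))"
    by (intro ord_ge_add) (simp_all add: right_diff_distrib)
  have 3: "ord_ge p (int b + 1) ((?V - (-1) ^ s * (1 + of_nat s * w)) * (?U * (1 + of_nat (p * c) * harmonic s)))"
    by (rule ord_ge_int_mult) (use V in \<open>auto intro!: ord_ge_mult_int ord_ge_add H0 ord_ge_of_nat simp del: of_nat_mult\<close>)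
  have "ord_ge p (int b + 1) ((of_nat (unit_fact (p * c + ?u * s)) - ?V * ?U * (1 + of_nat (p * c) * unit_harmonic (?u * s)))
     + ?V * ?U * (of_nat (p * c) * (unit_harmonic (?u * s) - harmonic s))
     + (?V - (-1) ^ s * (1 + of_nat s * w)) * (?U * (1 + of_nat (p * c) * harmonic s)))"
    by (intro ord_ge_add 1 2 3)
  also have "\<dots> = of_nat (unit_fact (p * c + ?u * s)) - (-1) ^ s * ?U * ((1 + of_nat s * w) * (1 + of_nat (p * c) * harmonic s))"
    by (simp add: algebra_simps)
  also have "(of_nat (p * c) :: rat) = of_nat p ^ b * of_nat s" unfolding pc by simp
  finally show ?thesis unfolding M .
qed

text \<open>The congruence holds term by term. Reflection modulo \<open>p\<close> turns
  \<open>1 / (p - 1 - s - k)!\<close> into \<open>(s + k)!\<close> up to sign, which produces the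
  binomial coefficient, and \<open>r^(n + (p - 1 - s))\<close> is 1 modulo \<open>p\<close>.\<close>

lemma bernoulli_part_cong:
  assumes s: "1 \<le> s" "s \<le> p - 2" and r: "\<not> int p dvd r" and n: "(p - 1) dvd n + (p - 1 - s)"
  shows "ord_ge p 1 (of_int r ^ n * bernoulli_part (of_int (- r)) (p - 1 - s) / fact s
     + (\<Sum>k | 1 < k \<and> k < p - s. of_nat ((s + k) choose s) * (bernoulli k / (of_nat k * of_int r ^ k))))"
proof -
  define s' where "s' = p - 1 - s"
  have s': "s + s' = p - 1" "s' < p - 1" using s by (auto simp: s'_def)
  have r0: "(of_int r :: rat) \<noteq> 0" using r by auto
  have set: "{k. 1 < k \<and> k \<le> s'} = {k. 1 < k \<and> k < p - s}" using s by (auto simp: s'_def)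
  have rn: "ord_ge p 1 (of_int r ^ (n + s') - 1)"
  proof -
    obtain q where q: "n + s' = (p - 1) * q" using n unfolding s'_def by blast
    have "\<not> int p dvd r ^ q" using r prime_int_p prime_dvd_power by blast
    from fermat_ord_ge[OF this] show ?thesis unfolding q by (simp add: power_mult[symmetric] mult.commute)
  qed
  have "of_int r ^ n * bernoulli_part (of_int (- r)) s' / fact s
     + (\<Sum>k | 1 < k \<and> k < p - s. of_nat ((s + k) choose s) * (bernoulli k / (of_nat k * of_int r ^ k)))
    = (\<Sum>k | 1 < k \<and> k < p - s. of_int r ^ n * (log_coeff k * (of_int (- r) ^ (s' - k) / fact (s' - k))) / fact s
        + of_nat ((s + k) choose s) * (bernoulli k / (of_nat k * of_int r ^ k)))"
    unfolding bernoulli_part_def set by (simp only: sum_distrib_left sum_divide_distrib sum.distrib)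
  also have "ord_ge p 1 \<dots>"
  proof (rule ord_ge_sum)
    fix k assume "k \<in> {k. 1 < k \<and> k < p - s}"
    hence k: "1 < k" "k \<le> s'" using s by (auto simp: s'_def)
    define m where "m = s + k"
    have m: "m + (s' - k) = p - 1" "m < p" "s' - k < p" using k s' by (auto simp: m_def)
    define \<sigma> :: rat where "\<sigma> = (-1) ^ m"
    define f :: rat where "f = fact (s' - k)"
    have f: "f \<noteq> 0" "ord_ge p 0 (1 / f)" unfolding f_def using m by (auto intro: ord_ge_inverse_fact_less)
    have \<sigma>: "\<sigma> * \<sigma> = 1" "ord_ge p 0 \<sigma>" unfolding \<sigma>_def
      by (simp_all add: ord_ge_power flip: power_mult_distrib)
    have "even (p - 1)" using odd_p by simp
    hence "even (m + (s' - k))" unfolding m .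
    hence "(-1) ^ (s' - k) = \<sigma>" unfolding \<sigma>_def by (simp add: minus_one_power_iff)
    hence mr: "of_int (- r) ^ (s' - k) = \<sigma> * (of_int r ^ (s' - k) :: rat)"
      unfolding of_int_minus power_minus[of "of_int r"] by simp
    have "ord_ge p (int 1) (of_nat (unit_fact (s' - k)) * ((-1) ^ (m + m div p) * of_nat (unit_fact m)) + 1)"
      by (rule unit_fact_reflection) (use m in auto)
    hence refl: "ord_ge p 1 (f * (\<sigma> * fact m) + 1)"
      using m by (simp add: unit_fact_less_p \<sigma>_def f_def)
    have lc: "ord_ge p 0 (of_nat (fact k) * log_coeff k)"
      by (intro ord_ge_mult_int ord_ge_of_nat ord_ge_log_coeff_integral) (use k s' in auto)
    have rk: "ord_ge p 0 (1 / of_int (r ^ k))" using r prime_int_p prime_dvd_power by (intro ord_ge_inverse_int) blast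
    have bin: "(of_nat ((s + k) choose s) :: rat) = fact m / (fact s * fact k)"
      using binomial_fact[of s "s + k", where 'a = rat] by (simp add: m_def)
    have pw: "of_int r ^ (s' - k) * of_int r ^ k = (of_int r ^ s' :: rat)" using k by (simp flip: power_add)
    have lcB: "bernoulli k = of_nat k * fact k * log_coeff k" using k by (simp add: log_coeff_def)
    have k0: "(of_nat k :: rat) \<noteq> 0" using k by simp
    have "ord_ge p 1 ((1 / fact s) * (1 / fact k) * (of_nat (fact k) * log_coeff k) * (1 / of_int (r ^ k)) *
       (\<sigma> * (1 / f) * (of_int r ^ (n + s') - 1) + \<sigma> * (1 / f) * (f * (\<sigma> * fact m) + 1)))"
      by (intro ord_ge_mult_int ord_ge_add rn refl lc rk f \<sigma> ord_ge_inverse_fact_less) (use s k s' in auto)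
    also have "\<sigma> * (1 / f) * (of_int r ^ (n + s') - 1) + \<sigma> * (1 / f) * (f * (\<sigma> * fact m) + 1)
        = \<sigma> * of_int r ^ (n + s') / f + (\<sigma> * \<sigma>) * fact m"
      using f by (simp add: field_simps)
    also have "(1 / fact s) * (1 / fact k) * (of_nat (fact k) * log_coeff k) * (1 / of_int (r ^ k)) * (\<sigma> * of_int r ^ (n + s') / f + (\<sigma> * \<sigma>) * fact m)
      = of_int r ^ n * (log_coeff k * (of_int (- r) ^ (s' - k) / fact (s' - k))) / fact s
        + of_nat ((s + k) choose s) * (bernoulli k / (of_nat k * of_int r ^ k))"
    proof -
      have "of_int r ^ (n + s') = (of_int r ^ n * (of_int r ^ (s' - k) * of_int r ^ k) :: rat)"
        unfolding pw by (simp add: power_add)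
      thus ?thesis unfolding mr bin \<sigma>(1) f_def[symmetric] lcB using r0 f k0 by (simp add: field_simps)
    qed
    finally show "ord_ge p 1 (of_int r ^ n * (log_coeff k * (of_int (- r) ^ (s' - k) / fact (s' - k))) / fact s
        + of_nat ((s + k) choose s) * (bernoulli k / (of_nat k * of_int r ^ k)))" .
  qed
  finally show ?thesis unfolding s'_def .
qed

text \<open>After multiplication by \<open>r^n\<close> the Gauss sum value is a sign times
  \<open>\<rho> / v\<close>. Reflection at \<open>p^(b + 1)\<close> replaces \<open>1 / v\<close> by
  minus the product \<open>P\<close> times factors close to 1. These and \<open>\<rho>\<close>
  combine into the first-order correction \<open>T\<close>; as \<open>T\<close> has order
  \<open>b\<close>, the product \<open>P * T\<close> requires \<open>P\<close> only modulo
  \<open>p\<close>.\<close>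

lemma Fp_main_congruence:
  assumes b: "p ^ (b - 1) dvd n" "b \<ge> 1" and s: "1 \<le> s" "s \<le> p - 2" "s = n mod (p - 1)"
    and r: "\<not> int p dvd r"
  shows "ord_ge p (int b + 1)
     ((of_int ((- r) ^ n) * Fp p (p * n) r + (-1) ^ ((b - 1) * n) * of_nat (unit_fact (repunit b * s))) / fact s
      - (of_nat s * (of_nat p * bernoulli (totient (p ^ b)) - of_nat p + 1)
        - of_nat p ^ b * of_nat s * harmonic s
        + of_nat n * (of_int r ^ (p - 1) - 1)
        - of_nat p * of_nat n *
            (\<Sum>k | 1 < k \<and> k < p - s.
               of_nat ((s + k) choose s) * (bernoulli k / (of_nat k * of_int r ^ k)))))"
proof -
  define s' where "s' = p - 1 - s"
  define u where "u = repunit b"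
  \<comment> \<open>This choice makes \<open>s' + (p - 1) K\<close> equal to
    \<open>p^b s'\<close>.\<close>
  define K where "K = u * s'"
  \<comment> \<open>\<open>M\<close> is the reflection partner of \<open>M'\<close>: together they
    make \<open>p^(b + 1) - 1\<close>.\<close>
  define M where "M = p * (u * s) + s"
  define M' where "M' = p * K + s'"
  define P where "P = (of_nat (unit_fact (u * s)) :: rat)"
  define v where "v = (of_nat (unit_fact M') :: rat)"
  define w where "w = - (of_nat (unit_fact (p ^ b)) + 1 :: rat)"
  define e where "e = of_int r ^ (p - 1) - (1 :: rat)"
  define H where "H = of_nat p ^ b * of_nat s * harmonic s"
  define T where "T = - (of_nat n * e) + of_nat s * w + H"
  define \<epsilon> :: rat where "\<epsilon> = (-1) ^ ((b - 1) * n)"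
  define \<rho> :: rat where "\<rho> = of_int r ^ (n + p ^ b * s')"
  define \<beta> where "\<beta> = bernoulli_part (of_int (- r)) s'"
  define N where "N = (of_nat (p * n) :: rat)"
  define x where "x = (-1) ^ n * Fp p (p * n) r"
  define \<gamma> where "\<gamma> = of_int (- r) ^ (p ^ b * s') * (- of_nat p) ^ K * fact K / (fact M' :: rat)"
  define S where "S = (\<Sum>k | 1 < k \<and> k < p - s. of_nat ((s + k) choose s) * (bernoulli k / (of_nat k * of_int r ^ k)))"
  obtain b0 where b0: "b = Suc b0" using b by (cases b) auto
  have ss': "s + s' = p - 1" "s < p" "s' < p" "1 \<le> s'" using s p_ge_3 by (auto simp: s'_def)
  have u: "(p - 1) * u + 1 = p ^ b" unfolding u_def by (rule repunit_mult)
  have expo: "s' + (p - 1) * K = p ^ b * s'"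
    unfolding K_def u[symmetric] by (simp add: distrib_right)
  define q where "q = n div (p - 1)"
  have q: "n = (p - 1) * q + s" unfolding q_def s(3) by (rule mult_div_mod_eq[symmetric])
  have evp: "even (p - 1)" using odd_p by simp
  have n_s: "even n \<longleftrightarrow> even s" unfolding q using evp by simp
  have s'_s: "even s' \<longleftrightarrow> even s" using evp unfolding ss'(1)[symmetric] by simp
  have ev_u: "even u \<longleftrightarrow> even b" unfolding u_def by (rule even_repunit)

  have Fc: "ord_ge p (int b + 1) (x - (\<gamma> + N * \<beta>))"
  proof -
    have "[n = s] (mod (p - 1))" unfolding s(3) by (simp add: cong_def)
    from Fp_cong[OF b s(1,2) this r, of K]
    show ?thesis unfolding s'_def[symmetric] expo x_def \<gamma>_def N_def \<beta>_def M'_def by simp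
  qed

  have v0: "v \<noteq> 0" "ord_ge p 0 (1 / v)"
    using not_dvd_unit_fact[of M'] unfolding v_def by (metis dvd_0_right of_nat_eq_0_iff, rule ord_ge_inverse_nat)
  have \<gamma>: "of_int r ^ n * \<gamma> = \<epsilon> * (\<rho> / v)"
  proof -
    have "M' div p = K" using ss' by (simp add: M'_def)
    hence "(fact M' :: rat) = of_nat p ^ K * fact K * v"
      using arg_cong[OF fact_conv_unit_fact[of M'], of "of_nat :: nat \<Rightarrow> rat"] by (simp add: v_def)
    hence "\<gamma> = of_int (- r) ^ (p ^ b * s') * (-1) ^ K / v"
      unfolding \<gamma>_def power_minus[of "of_nat p" K] by simp
    also have "of_int (- r) ^ (p ^ b * s') = (-1) ^ (p ^ b * s') * (of_int r ^ (p ^ b * s') :: rat)"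
      by (simp add: power_minus[of "of_int r"])
    finally have "of_int r ^ n * \<gamma> = ((-1) ^ (p ^ b * s') * (-1) ^ K) * (\<rho> / v)"
      unfolding \<rho>_def power_add by simp
    \<comment> \<open>Since \<open>p^b\<close> is odd, \<open>u\<close> has the parity of
      \<open>b\<close>, and \<open>s'\<close>, \<open>s\<close>, \<open>n\<close> have equal parity,
      the exponent is \<open>(b + 1) n\<close> modulo 2.\<close>
    also have "(-1) ^ (p ^ b * s') * (-1) ^ K = \<epsilon>"
      unfolding power_add[symmetric] \<epsilon>_def K_def minus_one_power_iff
      using odd_p s'_s n_s ev_u b0 by simp
    finally show ?thesis .
  qed

  have T_terms: "ord_ge p (int b) (- (of_nat n * e))" "ord_ge p (int b) (of_nat s * w)" "ord_ge p (int b) H"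
  proof -
    have "ord_ge p (int (b - 1) + 1) (of_nat n * e)" unfolding e_def
      by (intro ord_ge_mult ord_ge_of_nat_dvd b fermat_ord_ge r)
    thus "ord_ge p (int b) (- (of_nat n * e))" using b by (intro ord_ge_minus) (simp add: of_nat_diff)
    show "ord_ge p (int b) (of_nat s * w)" unfolding w_def
      by (intro ord_ge_mult_int ord_ge_of_nat ord_ge_minus wilson_prime_power b)
    have "unit_harmonic s = harmonic s"
      using units_upto_less_p[OF ss'(2)] by (simp add: unit_harmonic_def harmonic_def atLeastSucAtMost_greaterThanAtMost)
    hence "ord_ge p 0 (harmonic s)" using ord_ge_unit_harmonic[of s] by simp
    thus "ord_ge p (int b) H" unfolding H_def by (intro ord_ge_int_mult ord_ge_p_power ord_ge_of_nat)
  qed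
  hence T: "ord_ge p (int b) T" unfolding T_def by (intro ord_ge_add)
  define Z where "Z = (1 + of_nat s * w) * (1 + H)"
  have P0: "ord_ge p 0 P" unfolding P_def by simp

  have inv: "ord_ge p (int b + 1) (1 / v + P * Z)"
  proof -
    have "M + M' = p ^ Suc b - 1"
    proof -
      have "M + M' = p * (u * (s + s')) + (s + s')" by (simp add: M_def M'_def K_def algebra_simps)
      also have "\<dots> + 1 = p * ((p - 1) * u) + (p - 1 + 1)" unfolding ss' by (simp only: mult.commute[of u] add.assoc)
      also have "p - 1 + 1 = p" using p_ge_3 by simp
      also have "p * ((p - 1) * u) + p = p * ((p - 1) * u + 1)" by (simp only: distrib_left mult_1_right)
      also have "\<dots> = p ^ Suc b" unfolding u by simp
      finally show ?thesis by simp
    qed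
    hence "ord_ge p (int (Suc b)) (v * ((-1) ^ (M + M div p) * of_nat (unit_fact M)) + 1)"
      unfolding v_def by (rule unit_fact_reflection) simp
    moreover have "M div p = u * s" using ss' by (simp add: M_def)
    hence "(-1) ^ (M + M div p) = ((-1) ^ s :: rat)"
      unfolding minus_one_power_iff using odd_p by (simp add: M_def)
    ultimately have 1: "ord_ge p (int b + 1) (v * ((-1) ^ s * of_nat (unit_fact M)) + 1)" by (simp add: add.commute)
    have "ord_ge p (int b + 1) (of_nat (unit_fact M) - (-1) ^ s * P * Z)"
      unfolding M_def P_def Z_def H_def w_def u_def by (rule unit_fact_repunit_cong[OF b(2) ss'(2)])
    hence "ord_ge p (int b + 1) (v * ((-1) ^ s * (of_nat (unit_fact M) - (-1) ^ s * P * Z)))"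
      unfolding v_def by (intro ord_ge_mult_int ord_ge_of_nat ord_ge_power ord_ge_neg_1)
    hence "ord_ge p (int b + 1) ((v * ((-1) ^ s * of_nat (unit_fact M)) + 1) - v * ((-1) ^ s * (of_nat (unit_fact M) - (-1) ^ s * P * Z)))"
      by (intro ord_ge_diff 1)
    also have "\<dots> = 1 + v * (((-1) ^ s * (-1) ^ s) * P * Z)" by (simp only: right_diff_distrib mult.assoc)
    also have "(-1) ^ s * (-1) ^ s = (1 :: rat)" by (simp flip: power_mult_distrib)
    finally have "ord_ge p (int b + 1) (1 / v * (1 + v * (1 * P * Z)))" by (intro ord_ge_mult_int v0)
    thus ?thesis using v0 by (simp add: distrib_left)
  qed

  have \<rho>: "ord_ge p (int b + 1) (\<rho> - (1 + - (of_nat n * e)))"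
  proof -
    have "(p - 1) * (q + 1 + K) = ((p - 1) * q + s) + (s' + (p - 1) * K)"
      using ss'(1) by (simp add: distrib_left)
    also have "\<dots> = n + p ^ b * s'" unfolding expo q[symmetric] ..
    finally have "(p - 1) * (q + 1 + K) = n + p ^ b * s'" .
    from power_residue_cong[OF r b this] show ?thesis unfolding \<rho>_def e_def by simp
  qed

  have \<rho>0: "ord_ge p 0 \<rho>" unfolding \<rho>_def using ord_ge_of_int[of "r ^ (n + p ^ b * s')"] by simp
  have Z0: "ord_ge p 0 Z"
  proof -
    have "ord_ge p 0 (of_nat s * w)" "ord_ge p 0 H" by (rule ord_ge_mono[OF T_terms(2)] ord_ge_mono[OF T_terms(3)], simp)+
    thus ?thesis unfolding Z_def by (rule ord_ge_mult_int[OF ord_ge_add[OF ord_ge_1] ord_ge_add[OF ord_ge_1]])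
  qed
  have "ord_ge p (int b + 1) (\<rho> * (1 / v + P * Z) - (\<rho> - (1 + - (of_nat n * e))) * (P * Z)
     - P * ((1 + - (of_nat n * e)) * (1 + of_nat s * w) * (1 + H) - (1 + (- (of_nat n * e) + of_nat s * w + H))))"
    by (intro ord_ge_diff ord_ge_mult_int[OF \<rho>0 inv] ord_ge_int_mult[OF _ \<rho>] ord_ge_mult_int[OF P0] one_plus_triple_cong T_terms b Z0)
  also have "\<dots> = \<rho> / v + P + P * T" unfolding Z_def T_def by (simp add: algebra_simps)
  finally have main: "ord_ge p (int b + 1) (\<rho> / v + P + P * T)" .

  \<comment> \<open>To make division by \<open>s!\<close> possible:
    \<open>u s = p (repunit b0 * s) + s\<close> and Wilson's theorem give \<open>P\<close> congruent
    to \<open>\<sigma> s!\<close> modulo \<open>p\<close>, and \<open>T\<close> supplies the other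
    \<open>p^b\<close>.\<close>
  define \<sigma> :: rat where "\<sigma> = (-1) ^ (repunit b0 * s)"
  have us: "u * s = p * (repunit b0 * s) + s" unfolding u_def b0 repunit_Suc by (simp add: algebra_simps)
  have "ord_ge p 1 ((of_nat (unit_fact (p * (repunit b0 * s) + s)) - of_nat (unit_fact (p * (repunit b0 * s))) * of_nat (unit_fact s))
      + (of_nat (unit_fact (p * (repunit b0 * s))) - \<sigma>) * of_nat (unit_fact s))"
    unfolding \<sigma>_def by (intro ord_ge_add unit_fact_mod_p ord_ge_int_mult[OF _ unit_fact_p_mult_mod_p] ord_ge_of_nat)
  hence "ord_ge p 1 (P - \<sigma> * fact s)"
    using unit_fact_less_p[OF ss'(2)] unfolding P_def us by (simp add: algebra_simps)
  hence "ord_ge p (1 + int b) ((P - \<sigma> * fact s) * T)" by (intro ord_ge_mult T)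
  hence PT: "ord_ge p (int b + 1) ((P - \<sigma> * fact s) * T)" by (simp only: add.commute)
  have "ord_ge p (int b + 1) (\<epsilon> * ((\<rho> / v + P + P * T) - (P - \<sigma> * fact s) * T))"
    unfolding \<epsilon>_def by (rule ord_ge_mult_int[OF ord_ge_power[OF ord_ge_neg_1] ord_ge_diff[OF main PT]])
  also have "\<dots> = of_int r ^ n * \<gamma> + \<epsilon> * P + (\<epsilon> * \<sigma>) * (fact s * T)" unfolding \<gamma> by (simp add: algebra_simps)
  \<comment> \<open>\<open>repunit b0\<close> has the parity of \<open>b0 = b - 1\<close> and
    \<open>s\<close> that of \<open>n\<close>, so the two signs agree.\<close>
  also have "\<epsilon> * \<sigma> = 1"
  proof -
    have "even (b0 * n + repunit b0 * s)" using n_s by (auto simp: even_repunit)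
    thus ?thesis unfolding \<epsilon>_def \<sigma>_def b0 by (simp flip: power_add)
  qed
  finally have 1: "ord_ge p (int b + 1) (of_int r ^ n * \<gamma> + \<epsilon> * P + fact s * T)" by simp

  have 2: "ord_ge p (int b + 1) (of_int r ^ n * (x - (\<gamma> + N * \<beta>)))"
    using ord_ge_mult_int[OF ord_ge_of_int[of "r ^ n"] Fc] by simp
  have fs: "ord_ge p 0 (1 / fact s)" by (rule ord_ge_inverse_fact_less[OF ss'(2)])
  have "p ^ b dvd p * n" using b b0 by auto
  moreover have "(p - 1) dvd n + s'"
  proof -
    have "n + s' = (p - 1) * (q + 1)" using ss'(1) unfolding q by (simp add: distrib_left)
    thus ?thesis by simp
  qed
  ultimately have 3: "ord_ge p (int b + 1) (N * (of_int r ^ n * \<beta> / fact s + S))"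
    unfolding N_def S_def \<beta>_def s'_def by (intro ord_ge_mult ord_ge_of_nat_dvd bernoulli_part_cong s r)
  have 4: "ord_ge p (int b + 1) (of_nat s * (of_nat p * bernoulli (totient (p ^ b)) - of_nat (unit_fact (p ^ b)) - of_nat p))"
    by (intro ord_ge_mult_int ord_ge_of_nat bernoulli_wilson b)
  have "ord_ge p (int b + 1) (1 / fact s * ((of_int r ^ n * (x - (\<gamma> + N * \<beta>))) + (of_int r ^ n * \<gamma> + \<epsilon> * P + fact s * T))
     + N * (of_int r ^ n * \<beta> / fact s + S)
     - of_nat s * (of_nat p * bernoulli (totient (p ^ b)) - of_nat (unit_fact (p ^ b)) - of_nat p))"
    by (intro ord_ge_add ord_ge_diff ord_ge_mult_int[OF fs] 1 2 3 4)
  also have "\<dots> = (of_int r ^ n * x + \<epsilon> * P) / fact s + T + N * S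
     - of_nat s * (of_nat p * bernoulli (totient (p ^ b)) - of_nat (unit_fact (p ^ b)) - of_nat p)"
    by (simp add: field_simps)
  also have "\<dots> = (of_int r ^ n * x + \<epsilon> * P) / fact s
     - (of_nat s * (of_nat p * bernoulli (totient (p ^ b)) - of_nat p + 1) - H + of_nat n * e - of_nat p * of_nat n * S)"
    unfolding T_def w_def N_def by (simp add: algebra_simps)
  also have "of_int r ^ n * x = of_int ((- r) ^ n) * Fp p (p * n) r"
    unfolding x_def by (simp add: power_minus[of "of_int r"])
  finally show ?thesis unfolding \<epsilon>_def P_def H_def e_def S_def u_def .
qed

end

theorem theorem1p3:
  fixes p n b :: nat and r :: int
  assumes "prime p" and "odd p"
    and "n > 0"
    and "\<not> (p - 1) dvd n"
    and "\<not> int p dvd r"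
    and "b \<in> {1..multiplicity p (p * n)}"
  shows "let s = pos_residue p n; b' = (p ^ b - 1) div (p - 1) in
    rat_cong p (b + 1)
      ((of_int ((- r) ^ n) * Fp p (p * n) r
          + (-1) ^ ((b - 1) * n) * of_nat (\<Prod>k | 1 \<le> k \<and> k \<le> b' * s \<and> \<not> p dvd k. k))
        / fact s)
      (of_nat s * (of_nat p * bernoulli (totient (p ^ b)) - of_nat p + 1)
        - of_nat p ^ b * of_nat s * harmonic s
        + of_nat n * (of_int r ^ (p - 1) - 1)
        - of_nat p * of_nat n *
            (\<Sum>k | 1 < k \<and> k < p - s.
               of_nat ((s + k) choose s) * (bernoulli k / (of_nat k * of_int r ^ k))))"
proof -
  interpret odd_prime p by unfold_locales (use assms in auto)
  define s where "s = n mod (p - 1)"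
  have "s < p - 1" "s \<noteq> 0" using assms(4) p_ge_3 by (auto simp: s_def dvd_eq_mod_eq_0)
  hence s: "1 \<le> s" "s \<le> p - 2" by auto
  have "p ^ b dvd p * n" using assms(6) by (intro multiplicity_dvd') auto
  moreover have "p ^ b = p * p ^ (b - 1)" using assms(6) by (cases b) auto
  ultimately have b: "p ^ (b - 1) dvd n" "b \<ge> 1" using assms(6) by auto
  have "unit_fact (repunit b * s) = (\<Prod>k | 1 \<le> k \<and> k \<le> (p ^ b - 1) div (p - 1) * s \<and> \<not> p dvd k. k)"
    by (simp add: unit_fact_def units_upto_def repunit_def)
  with Fp_main_congruence[OF b s s_def assms(5)] show ?thesis
    unfolding Let_def rat_cong_iff_ord_ge pos_residue_eq[OF assms(4)] s_def[symmetric] by (simp only: of_nat_add of_nat_1)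
qed

end
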